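(* Any type II group $C\times D\subset G=\mathrm{SU}(2)^3$ that acts freely on $M$ and is not a subgroup of a freely acting splittable group belongs, up to conjugation in $G$, to the following list. (1) $\mathcal{G}(2T,2D_4,\mathbb{Z}_3,\{1\},\varphi(r))\times\mathbb{Z}_n$ with $3\nmid n$. (2) $\mathcal{G}(2T,2D_4,\mathbb{Z}_3,\{1\},\varphi(r))\times 2D_{2l}$ with $3\nmid 2l$. (3) $\mathcal{G}(2D_{4k},2D_{2k},\mathbb{Z}_2,\{1\},\mathrm{Id})\times D$, $\mathcal{G}(2O,2T,\mathbb{Z}_2,\{1\},\mathrm{Id})\times D$, or $\mathcal{G}(2D_{2k},\mathbb{Z}_{2k},\mathbb{Z}_2,\{1\},\mathrm{Id})\times D$, with no condition on $D$. (4) $\mathcal{G}(\mathbb{Z}_{kl},\mathbb{Z}_l,\mathbb{Z}_k,\{1\},\varphi(r))\times D$ with $lr\not\equiv\pm1\bmod lk$, where, with $k_1=\gcd(1+lr,kl)$ and $k_2=\gcd(1-lr,kl)$, one of the following holds: - $k_1=k_2=1$ and $D$ is arbitrary; - at least one of $k_1,k_2$ is $>1$, and for every $i\in\{1,2\}$ with $k_i>1$: $\gcd(m,k_i)=1$ if $D=\mathbb{Z}_m$; $\gcd(2m,k_i)=1$ if $D=2D_{2m}$; $2,3\nmid k_i$ if $D\in\{2T,2O\}$; $2,3,5\nmid k_i$ if $D=2I$. (5) $\mathcal{G}(2D_{2l(2k+1)},\mathbb{Z}_{2k+1},2D_{2l},\{1\},c_g\circ\tau_{a,b})\times\mathbb{Z}_m$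 with $l>2$, $a(2k+1)\not\equiv\pm1\bmod 2l(2k+1)$, $4\nmid m$, and, with $\tilde k_1=\gcd(1-a(2k+1),2l(2k+1))$ and $\tilde k_2=\gcd(1+a(2k+1),2l(2k+1))$, $\gcd(\tilde k_i,m)=1$ for each $i\in\{1,2\}$ with $\tilde k_i>1$.
   Context: $\mathrm{SU}(2)$ is identified with the unit quaternions. $G=\mathrm{SU}(2)^3$, $K=\Delta(\mathrm{SU}(2))=\{(w,w,w)\}$, $M=G/K\cong S^3\times S^3$; subgroups of $G$ act on $M$ by left translation, and a subgroup acts freely if none of its non-trivial elements fixes a point. A finite subgroup of $G$ is splittable if it is of the form $A_1\times A_2\times A_3$ with non-trivial subgroups $A_i\subset\mathrm{SU}(2)$. ADE groups (every non-trivial finite subgroup of $\mathrm{SU}(2)$ is conjugate to one of them): $\mathbb{Z}_n=\{e^{2\pi i x/n}:x\in\mathbb{Z}\}$, $n\ge2$; $2D_{2n}=\{e^{i\pi x/n}:x\in\mathbb{Z}\}\cup\{je^{i\pi x/n}:x\in\mathbb{Z}\}$, $n\ge2$; $2T=2D_4\cup\{\tfrac12(\pm1\pm i\pm j\pm k)\}$; $2O=2T\cup e^{i\pi/4}\,2T$; $2I=\bigcup_{s=0}^4 q^s\,2T$ with $q=\frac12(\phi+\phi^{-1}i+j)$, $\phi=\frac{1+\sqrt5}{2}$. Goursat quintuples: a subgroup $C\subset\mathrm{SU}(2)^2$ corresponds to a quintuple $(A,A_0,B,B_0,\theta)$, where $A,B$ are the projections of $C$ to the two factors, $A_0=\{a:(a,1)\in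 C\}\triangleleft A$, $B_0=\{b:(1,b)\in C\}\triangleleft B$, and $\theta:A/A_0\to B/B_0$ is the isomorphism with $\theta(aA_0)=bB_0$ for $(a,b)\in C$; conversely $\mathcal{G}(A,A_0,B,B_0,\theta)=\{(a,b)\in A\times B:\theta(aA_0)=bB_0\}$. A group $C\times D$, with $C\subset\mathrm{SU}(2)^2$ and $D\subset\mathrm{SU}(2)$ non-trivial finite subgroups and $A,B$ non-trivial ADE groups (up to conjugation), is of type II if $A_0\ne\{1\}$ and $B_0=\{1\}$ and it is not splittable. When $B_0=\{1\}$, $A/A_0$ is identified with $B$ and $\theta$ is regarded as an automorphism of $B$, via the projections $A\to B$ with kernel $A_0$: $\mathbb{Z}_{kl}\to\mathbb{Z}_k$, $e^{2\pi iy/(kl)}\mapsto e^{2\pi iy/k}$; $2T\to\mathbb{Z}_3$, sending $2D_4$, $\frac{-1+i+j+k}{2}2D_4$, $\frac{1+i+j+k}{2}2D_4$ to $1,e^{2\pi i/3},e^{4\pi i/3}$ respectively; $2D_{2l(2k+1)}\to2D_{2l}$, $e^{i\pi x/(l(2k+1))}\mapsto e^{i\pi x/l}$, $je^{i\pi x/(l(2k+1))}\mapsto je^{i\pi x/l}$; and the unique surjection onto $\mathbb{Z}_2$ with the given kernel. Automorphisms: $\varphi(r)$ is $x\mapsto x^r$ on $\mathbb{Z}_n$, $r\in\mathbb{Z}_n^\times$; for $l>2$ and $(a,b)\in\mathbb{Z}_{2l}^\times\times\mathbb{Z}_{2l}$, $\tau_{a,b}$ is the automorphism of $2D_{2l}$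 with $\tau_{a,b}(t^p)=t^{ap}$, $\tau_{a,b}(st^p)=st^{ap+b}$, where $t=e^{i\pi/l}$, $s=je^{i\pi/l}$; $c_g$ is conjugation by an element $g\in2D_{2l}$. "$2,3\nmid N$" means that none of the listed primes divides $N$. *)

theory Defs
  imports Complex_Main "HOL-Algebra.Coset" "HOL-Number_Theory.Cong"
begin

section \<open>Quaternions and SU(2)\<close>

text \<open>\<open>Quat a b c d\<close> is the quaternion $a + b i + c j + d k$.\<close>

datatype quat = Quat (qRe: real) (qI: real) (qJ: real) (qK: real)

instantiation quat :: ring_1
begin

definition "0 = Quat 0 0 0 0"
definition "1 = Quat 1 0 0 0"
definition "x + y = Quat (qRe x + qRe y) (qI x + qI y) (qJ x + qJ y) (qK x + qK y)"
definition "- x = Quat (- qRe x) (- qI x) (- qJ x) (- qK x)"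
definition "x - y = Quat (qRe x - qRe y) (qI x - qI y) (qJ x - qJ y) (qK x - qK y)"
definition "x * y = Quat
  (qRe x * qRe y - qI x * qI y - qJ x * qJ y - qK x * qK y)
  (qRe x * qI y + qI x * qRe y + qJ x * qK y - qK x * qJ y)
  (qRe x * qJ y - qI x * qK y + qJ x * qRe y + qK x * qI y)
  (qRe x * qK y + qI x * qJ y - qJ x * qI y + qK x * qRe y)"

instance
  by standard
    (simp_all add: zero_quat_def one_quat_def plus_quat_def uminus_quat_def minus_quat_def
      times_quat_def algebra_simps quat.expand)

end

definition quat_j :: quat where
  "quat_j = Quat 0 0 1 0"

text \<open>\<open>qcis t\<close> is $e^{it}$.\<close>

definition qcis :: "real \<Rightarrow> quat" where
  "qcis t = Quat (cos t) (sin t) 0 0"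

definition qcnj :: "quat \<Rightarrow> quat" where
  "qcnj x = Quat (qRe x) (- qI x) (- qJ x) (- qK x)"

definition qnorm :: "quat \<Rightarrow> real" where
  "qnorm x = sqrt ((qRe x)\<^sup>2 + (qI x)\<^sup>2 + (qJ x)\<^sup>2 + (qK x)\<^sup>2)"

definition SU2 :: "quat monoid" where
  "SU2 = \<lparr>carrier = {x. qnorm x = 1}, monoid.mult = (*), monoid.one = 1\<rparr>"

lemma qnorm_eq_1_iff: "qnorm x = 1 \<longleftrightarrow> (qRe x)\<^sup>2 + (qI x)\<^sup>2 + (qJ x)\<^sup>2 + (qK x)\<^sup>2 = 1"
  by (simp add: qnorm_def)

lemma qnorm_mult: "qnorm (x * y) = qnorm x * qnorm y"
  unfolding qnorm_def real_sqrt_mult [symmetric]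
  by (rule arg_cong [of _ _ sqrt]) (simp add: times_quat_def power2_eq_square algebra_simps)

lemma qcnj_mult_unit: "qnorm x = 1 \<Longrightarrow> qcnj x * x = 1"
  by (simp add: qnorm_eq_1_iff qcnj_def times_quat_def one_quat_def power2_eq_square algebra_simps)

lemma group_SU2: "group SU2"
proof (rule groupI)
  fix x assume x: "x \<in> carrier SU2"
  then have "qnorm (qcnj x) = 1"
    by (simp add: SU2_def qnorm_eq_1_iff qcnj_def)
  with x qcnj_mult_unit [of x] show "\<exists>y\<in>carrier SU2. y \<otimes>\<^bsub>SU2\<^esub> x = \<one>\<^bsub>SU2\<^esub>"
    by (auto simp: SU2_def)
next
  show "\<one>\<^bsub>SU2\<^esub> \<in> carrier SU2"
    by (simp add: SU2_def qnorm_eq_1_iff one_quat_def)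
qed (auto simp: SU2_def qnorm_mult mult.assoc)

section \<open>The homogeneous space and the action on it\<close>

abbreviation SU2sq :: "(quat \<times> quat) monoid" where
  "SU2sq \<equiv> SU2 \<times>\<times> SU2"

abbreviation G3 :: "(quat \<times> quat \<times> quat) monoid" where
  "G3 \<equiv> SU2 \<times>\<times> SU2 \<times>\<times> SU2"

definition diagK :: "(quat \<times> quat \<times> quat) set" where
  "diagK = {(w, w, w) | w. w \<in> carrier SU2}"

definition homM :: "(quat \<times> quat \<times> quat) set set" where
  "homM = {x <#\<^bsub>G3\<^esub> diagK | x. x \<in> carrier G3}"

definition acts_freely :: "(quat \<times> quat \<times> quat) set \<Rightarrow> bool" where
  "acts_freely H \<longleftrightarrow> (\<forall>h\<in>H. h \<noteq> \<one>\<^bsub>G3\<^esub> \<longrightarrow> (\<forall>p\<in>homM. h <#\<^bsub>G3\<^esub> p \<noteq> p))"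

definition conjugate :: "('a, 'b) monoid_scheme \<Rightarrow> 'a set \<Rightarrow> 'a set \<Rightarrow> bool" where
  "conjugate G H H' \<longleftrightarrow>
     (\<exists>g\<in>carrier G. H' = (\<lambda>h. g \<otimes>\<^bsub>G\<^esub> h \<otimes>\<^bsub>G\<^esub> inv\<^bsub>G\<^esub> g) ` H)"

definition nontriv_finite_subgroup :: "'a set \<Rightarrow> ('a, 'b) monoid_scheme \<Rightarrow> bool" where
  "nontriv_finite_subgroup H G \<longleftrightarrow> subgroup H G \<and> finite H \<and> H \<noteq> {\<one>\<^bsub>G\<^esub>}"

definition splittable :: "(quat \<times> quat \<times> quat) set \<Rightarrow> bool" where
  "splittable H \<longleftrightarrow> (\<exists>A1 A2 A3. nontriv_finite_subgroup A1 SU2 \<and>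
     nontriv_finite_subgroup A2 SU2 \<and> nontriv_finite_subgroup A3 SU2 \<and> H = A1 \<times> A2 \<times> A3)"

text \<open>The product \<open>C \<times> D\<close> as a subset of the right-nested triple product.\<close>

definition prod3 :: "(quat \<times> quat) set \<Rightarrow> quat set \<Rightarrow> (quat \<times> quat \<times> quat) set" where
  "prod3 C D = {(a, b, d) | a b d. (a, b) \<in> C \<and> d \<in> D}"

section \<open>ADE groups\<close>

definition Zc :: "nat \<Rightarrow> quat set" where
  "Zc n = {qcis (2 * pi * of_int x / of_nat n) | x :: int. True}"

text \<open>\<open>binD n\<close> is the group $2D_{2n}$ of order $4n$ (so $2D_4$ is \<open>binD 2\<close>).\<close>

definition binD :: "nat \<Rightarrow> quat set" where
  "binD n = {qcis (pi * of_int x / of_nat n) | x :: int. True} \<union>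
            {quat_j * qcis (pi * of_int x / of_nat n) | x :: int. True}"

definition binT :: "quat set" where
  "binT = binD 2 \<union> {Quat (a/2) (b/2) (c/2) (d/2) | a b c d.
             a \<in> {1,-1} \<and> b \<in> {1,-1} \<and> c \<in> {1,-1} \<and> d \<in> {1,-1}}"

definition binO :: "quat set" where
  "binO = binT \<union> (\<lambda>x. qcis (pi / 4) * x) ` binT"

definition golden :: real where
  "golden = (1 + sqrt 5) / 2"

definition icos_q :: quat where
  "icos_q = Quat (golden / 2) (inverse golden / 2) (1/2) 0"

definition binI :: "quat set" where
  "binI = (\<Union>s\<in>{0..4::nat}. (\<lambda>x. icos_q ^ s * x) ` binT)"

definition ADE :: "quat set \<Rightarrow> bool" where
  "ADE A \<longleftrightarrow> (\<exists>n\<ge>2. A = Zc n) \<or> (\<exists>n\<ge>2. A = binD n) \<or> A = binT \<or> A = binO \<or> A = binI"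

section \<open>Goursat quintuples and type II groups\<close>

definition goursat ::
  "quat set \<Rightarrow> quat set \<Rightarrow> quat set \<Rightarrow> quat set \<Rightarrow> (quat set \<Rightarrow> quat set) \<Rightarrow> (quat \<times> quat) set" where
  "goursat A A0 B B0 \<theta> =
     {(a, b). a \<in> A \<and> b \<in> B \<and> \<theta> (a <#\<^bsub>SU2\<^esub> A0) = b <#\<^bsub>SU2\<^esub> B0}"

definition gA :: "(quat \<times> quat) set \<Rightarrow> quat set" where
  "gA C = fst ` C"

definition gA0 :: "(quat \<times> quat) set \<Rightarrow> quat set" where
  "gA0 C = {a. (a, 1) \<in> C}"

definition gB :: "(quat \<times> quat) set \<Rightarrow> quat set" where
  "gB C = snd ` C"

definition gB0 :: "(quat \<times> quat) set \<Rightarrow> quat set" where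
  "gB0 C = {b. (1, b) \<in> C}"

definition type_II :: "(quat \<times> quat) set \<Rightarrow> quat set \<Rightarrow> bool" where
  "type_II C D \<longleftrightarrow>
     nontriv_finite_subgroup C SU2sq \<and> nontriv_finite_subgroup D SU2 \<and>
     (\<exists>A. ADE A \<and> conjugate SU2 (gA C) A) \<and> (\<exists>B. ADE B \<and> conjugate SU2 (gB C) B) \<and>
     gA0 C \<noteq> {1} \<and> gB0 C = {1} \<and> \<not> splittable (prod3 C D)"

text \<open>For $B_0 = 1$: given a projection \<open>\<pi>\<close> from \<open>A\<close> to \<open>B\<close> with kernel $A_0$ and an automorphism
  \<open>f\<close> of \<open>B\<close>, this is the isomorphism $A/A_0 \to B/\{1\}$ sending the coset $aA_0$ to the
  singleton coset of $f(\pi(a))$. The map \<open>\<pi>\<close> is constant on \<open>X\<close> if \<open>X\<close> is a coset of $A_0$.\<close>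

definition iso_of :: "(quat \<Rightarrow> quat) \<Rightarrow> (quat \<Rightarrow> quat) \<Rightarrow> quat set \<Rightarrow> quat set" where
  "iso_of \<pi> f X = f ` (\<pi> ` X)"

text \<open>The projections. \<open>projZ k l\<close> is $Z_{kl} \to Z_k$, \<open>projD k l\<close> is
  $2D_{2l(2k+1)} \to 2D_{2l}$, and \<open>proj2 A0\<close> is the surjection onto $Z_2$ with kernel \<open>A0\<close>.
  They are relevant on their respective domains only.\<close>

definition projZ :: "nat \<Rightarrow> nat \<Rightarrow> quat \<Rightarrow> quat" where
  "projZ k l x = (THE z. \<exists>y::int. x = qcis (2 * pi * of_int y / of_nat (k * l)) \<and>
                                 z = qcis (2 * pi * of_int y / of_nat k))"

definition projT :: "quat \<Rightarrow> quat" where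
  "projT x =
     (if x \<in> binD 2 then 1
      else if x \<in> Quat (-1/2) (1/2) (1/2) (1/2) <#\<^bsub>SU2\<^esub> binD 2 then qcis (2 * pi / 3)
      else qcis (4 * pi / 3))"

definition projD :: "nat \<Rightarrow> nat \<Rightarrow> quat \<Rightarrow> quat" where
  "projD k l x = (THE z. \<exists>y::int.
     (x = qcis (pi * of_int y / of_nat (l * (2 * k + 1))) \<and> z = qcis (pi * of_int y / of_nat l)) \<or>
     (x = quat_j * qcis (pi * of_int y / of_nat (l * (2 * k + 1))) \<and>
      z = quat_j * qcis (pi * of_int y / of_nat l)))"

definition proj2 :: "quat set \<Rightarrow> quat \<Rightarrow> quat" where
  "proj2 A0 x = (if x \<in> A0 then 1 else -1)"

text \<open>The automorphisms. Residue classes are represented by natural numbers; since $t = e^{i\pi/l}$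
  has finite order, natural exponents \<open>p\<close> suffice in \<open>autD\<close>, which is $\tau_{a,b}$ on $2D_{2l}$.\<close>

definition autZ :: "nat \<Rightarrow> quat \<Rightarrow> quat" where
  "autZ r x = x ^ r"

definition autD :: "nat \<Rightarrow> nat \<Rightarrow> nat \<Rightarrow> quat \<Rightarrow> quat" where
  "autD l a b x =
     (let t = qcis (pi / of_nat l); s = quat_j * t
      in THE z. \<exists>p::nat. (x = t ^ p \<and> z = t ^ (a * p)) \<or> (x = s * t ^ p \<and> z = s * t ^ (a * p + b)))"

definition conj_by :: "quat \<Rightarrow> quat \<Rightarrow> quat" where
  "conj_by g x = g \<otimes>\<^bsub>SU2\<^esub> x \<otimes>\<^bsub>SU2\<^esub> inv\<^bsub>SU2\<^esub> g"

text \<open>The coprimality condition relating an ADE group \<open>D\<close> and one of the numbers $k_1, k_2$ for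
  cyclic \<open>A\<close>. Exactly one of the conjuncts is non-vacuous for a given ADE group.\<close>

definition coprime_cond :: "quat set \<Rightarrow> int \<Rightarrow> bool" where
  "coprime_cond D \<kappa> \<longleftrightarrow>
     (\<forall>m\<ge>2. D = Zc m \<longrightarrow> gcd (int m) \<kappa> = 1) \<and>
     (\<forall>m\<ge>2. D = binD m \<longrightarrow> gcd (2 * int m) \<kappa> = 1) \<and>
     (D = binT \<or> D = binO \<longrightarrow> \<not> 2 dvd \<kappa> \<and> \<not> 3 dvd \<kappa>) \<and>
     (D = binI \<longrightarrow> \<not> 2 dvd \<kappa> \<and> \<not> 3 dvd \<kappa> \<and> \<not> 5 dvd \<kappa>)"

end

theory Submission
  imports Defs "HOL-Algebra.Multiplicative_Group"
begin

text \<open>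
Two unit quaternions are conjugate exactly when their real parts agree, so an element \<open>(a, b, d)\<close> of
\<open>G\<close> fixes a point of \<open>M\<close> if and only if \<open>a\<close>, \<open>b\<close>, \<open>d\<close> have the same real part
(\<open>fixes_point_iff\<close>). Freeness is therefore a statement about real parts.

For a type II group the condition \<open>B\<^sub>0 = 1\<close> says that \<open>C\<close> is the graph of a homomorphism \<open>f\<close> from
\<open>A\<close> onto \<open>B\<close> with kernel \<open>A\<^sub>0\<close>. The group \<open>A \<times> B \<times> D\<close> is splittable and contains
\<open>C \<times> D\<close>, so by hypothesis it does not act freely: some \<open>a \<in> A\<close>, \<open>b \<in> B\<close> and \<open>d \<in> D\<close> with
\<open>d \<noteq> 1\<close> have a common real part. The locale \<open>free_graph\<close> collects these facts. The rest is a case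
distinction on \<open>A\<close> and on whether \<open>-1\<close> lies in the kernel.

If \<open>A\<close> is cyclic, \<open>f\<close> becomes a power map after a conjugation. A rotation of prime order \<open>p\<close>
dividing \<open>k\<^sub>1\<close> or \<open>k\<^sub>2\<close> has the same real part as its image, so freeness forbids elements of
order \<open>p\<close> in \<open>D\<close>; this is the coprimality condition (\<open>cyclic_case\<close>).

If \<open>f (-1) = 1\<close>, every \<open>a \<in> A\<close> with \<open>a\<^sup>2 = -1\<close> is sent to \<open>1\<close> or \<open>-1\<close>. Such elements control
the dihedral, octahedral and icosahedral groups: \<open>f\<close> takes only the values \<open>1\<close> and \<open>-1\<close> and its kernel
has index two, or \<open>f\<close> is trivial. For \<open>A = 2T\<close> the image has order three, and then both an element
of order three and its image have real part \<open>-1/2\<close>; so no element of \<open>D\<close> has this real part and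
\<open>A \<times> B \<times> D\<close> would act freely.

If \<open>f (-1) = -1\<close>, the kernel is a finite group without \<open>-1\<close>, hence cyclic and contained in the
rotations about one axis, which \<open>A\<close> must preserve. This excludes the polyhedral groups. In the dihedral
case \<open>(-1, -1) \<in> C\<close> forces \<open>-1 \<notin> D\<close>, so \<open>D\<close> is cyclic of odd order, and the overlap with
\<open>B\<close> forces \<open>B\<close> to have elements whose order does not divide four, that is \<open>l > 2\<close>
(\<open>dihedral_odd_kernel_case\<close>).

Bringing \<open>D\<close> into standard form requires the classification of the finite subgroups of \<open>SU(2)\<close>
(\<open>finite_subgroup_ADE\<close>). It rests on the element \<open>p \<noteq> 1\<close> of largest real part. If this real
part is at least \<open>cos 30\<degree>\<close>, the commutator of \<open>p\<close> with a conjugate of \<open>p\<close> is even closer to \<open>1\<close>, so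
it is \<open>1\<close>, all conjugates of \<open>p\<close> share an axis, and the group is cyclic or binary dihedral. Otherwise
only finitely many real parts can occur. They determine the angle between the axes of \<open>p\<close> and a conjugate
of \<open>p\<close>; these two elements generate a group containing a conjugate of \<open>2T\<close>, and a covering argument
shows that the whole group is \<open>2T\<close>, \<open>2O\<close> or \<open>2I\<close>.
\<close>

section \<open>Unit quaternions, conjugation and rotations about the first axis\<close>

abbreviation U :: "quat set" where "U \<equiv> carrier SU2"

lemma U_iff: "x \<in> U \<longleftrightarrow> (qRe x)\<^sup>2 + (qI x)\<^sup>2 + (qJ x)\<^sup>2 + (qK x)\<^sup>2 = 1"
  by (simp add: SU2_def qnorm_eq_1_iff)

lemma SU2_simps [simp]: "x \<otimes>\<^bsub>SU2\<^esub> y = x * y" "\<one>\<^bsub>SU2\<^esub> = 1"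
  by (simp_all add: SU2_def)

lemmas quat_arith = zero_quat_def one_quat_def plus_quat_def uminus_quat_def minus_quat_def
  times_quat_def qcnj_def qcis_def quat_j_def

lemma quat_eq_iff: "x = y \<longleftrightarrow> qRe x = qRe y \<and> qI x = qI y \<and> qJ x = qJ y \<and> qK x = qK y"
  by (cases x; cases y) simp

lemma component_simps [simp]:
  "qRe 1 = 1" "qI 1 = 0" "qJ 1 = 0" "qK 1 = 0"
  "qRe 0 = 0" "qI 0 = 0" "qJ 0 = 0" "qK 0 = 0"
  "qRe (- x) = - qRe x" "qI (- x) = - qI x" "qJ (- x) = - qJ x" "qK (- x) = - qK x"
  "qRe (x + y) = qRe x + qRe y" "qI (x + y) = qI x + qI y"
  "qJ (x + y) = qJ x + qJ y" "qK (x + y) = qK x + qK y"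
  "qRe (x - y) = qRe x - qRe y" "qI (x - y) = qI x - qI y"
  "qJ (x - y) = qJ x - qJ y" "qK (x - y) = qK x - qK y"
  "qRe (qcnj x) = qRe x" "qI (qcnj x) = - qI x" "qJ (qcnj x) = - qJ x" "qK (qcnj x) = - qK x"
  by (simp_all add: quat_arith)

text \<open>
Kept apart from the simplification rules: expanding products into components is only useful at the end of a
computation.
\<close>

lemma component_mult:
  "qRe (x * y) = qRe x * qRe y - qI x * qI y - qJ x * qJ y - qK x * qK y"
  "qI (x * y) = qRe x * qI y + qI x * qRe y + qJ x * qK y - qK x * qJ y"
  "qJ (x * y) = qRe x * qJ y - qI x * qK y + qJ x * qRe y + qK x * qI y"
  "qK (x * y) = qRe x * qK y + qI x * qJ y - qJ x * qI y + qK x * qRe y"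
  by (simp_all add: quat_arith)

lemma U_one [simp]: "1 \<in> U" and U_neg [simp]: "- x \<in> U \<longleftrightarrow> x \<in> U"
  and U_qcnj [simp]: "qcnj x \<in> U \<longleftrightarrow> x \<in> U" and U_qcis [simp]: "qcis t \<in> U"
  and U_j [simp]: "quat_j \<in> U"
  by (simp_all add: U_iff) (simp_all add: quat_arith)

lemma U_mult [simp]: "x \<in> U \<Longrightarrow> y \<in> U \<Longrightarrow> x * y \<in> U"
  by (simp add: SU2_def qnorm_mult)

lemma qcnj_left [simp]: "x \<in> U \<Longrightarrow> qcnj x * x = 1"
  by (simp add: SU2_def qcnj_mult_unit)

lemma qcnj_qcnj [simp]: "qcnj (qcnj x) = x"
  by (simp add: quat_eq_iff)

lemma qcnj_right [simp]: "x \<in> U \<Longrightarrow> x * qcnj x = 1"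
  using qcnj_left[of "qcnj x"] by simp

lemma qcnj_mult: "qcnj (x * y) = qcnj y * qcnj x"
  by (simp add: quat_eq_iff component_mult algebra_simps)

lemma qcnj_misc [simp]: "qcnj 1 = 1" "qcnj (- x) = - qcnj x"
  by (simp_all add: quat_eq_iff)

lemma cancel_left [simp]: "x \<in> U \<Longrightarrow> qcnj x * (x * y) = y" "x \<in> U \<Longrightarrow> x * (qcnj x * y) = y"
  by (simp_all add: mult.assoc[symmetric])

lemma inv_SU2 [simp]: "x \<in> U \<Longrightarrow> inv\<^bsub>SU2\<^esub> x = qcnj x"
  by (rule group.inv_equality[OF group_SU2]) simp_all

lemma minus_one_ne_one: "(-1::quat) \<noteq> 1" by (simp add: quat_eq_iff)

lemma Re_mult_commute: "qRe (x * y) = qRe (y * x)"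
  by (simp add: component_mult algebra_simps)

lemma U_Re_one: "x \<in> U \<Longrightarrow> qRe x = 1 \<longleftrightarrow> x = 1"
  by (auto simp: U_iff quat_eq_iff add_nonneg_eq_0_iff add.assoc)

lemma U_Re_minus_one: "x \<in> U \<Longrightarrow> qRe x = -1 \<longleftrightarrow> x = -1"
  using U_Re_one[of "-x"] by (auto simp: quat_eq_iff)

lemma U_Re_le: assumes "x \<in> U" shows "qRe x \<le> 1" "-1 \<le> qRe x"
proof -
  have "(qRe x)\<^sup>2 \<le> 1" using assms unfolding U_iff
    by (smt (verit) zero_le_power2)
  then have "\<bar>qRe x\<bar> \<le> 1" by (simp add: abs_square_le_1)
  then show "qRe x \<le> 1" "-1 \<le> qRe x" by auto
qed

definition cj :: "quat \<Rightarrow> quat \<Rightarrow> quat" where "cj g x = g * x * qcnj g"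

lemma cj_mult: "g \<in> U \<Longrightarrow> cj g (x * y) = cj g x * cj g y"
  by (simp add: cj_def mult.assoc)

lemma cj_one [simp]: "g \<in> U \<Longrightarrow> cj g 1 = 1" and cj_minus [simp]: "cj g (- x) = - cj g x"
  by (simp_all add: cj_def)

lemma cj_id [simp]: "cj 1 x = x" by (simp add: cj_def)

lemma cj_cj: "cj g (cj h x) = cj (g * h) x"
  by (simp add: cj_def qcnj_mult mult.assoc)

lemma cj_inv [simp]: "g \<in> U \<Longrightarrow> cj (qcnj g) (cj g x) = x" "g \<in> U \<Longrightarrow> cj g (cj (qcnj g) x) = x"
  by (simp_all add: cj_cj)

lemma cj_inj: "g \<in> U \<Longrightarrow> cj g x = cj g y \<longleftrightarrow> x = y"
  by (metis cj_inv(1))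

lemma cj_qcnj: "cj g (qcnj x) = qcnj (cj g x)"
  by (simp add: cj_def qcnj_mult mult.assoc)

lemma Re_cj [simp]: "g \<in> U \<Longrightarrow> qRe (cj g x) = qRe x"
  by (metis cj_def Re_mult_commute mult.assoc qcnj_left mult_1_left)

lemma U_cj [simp]: "g \<in> U \<Longrightarrow> cj g x \<in> U \<longleftrightarrow> x \<in> U"
proof
  assume g: "g \<in> U"
  show "cj g x \<in> U \<Longrightarrow> x \<in> U"
    using g cj_inv(1)[of g x] by (metis U_mult U_qcnj cj_def)
  show "x \<in> U \<Longrightarrow> cj g x \<in> U" using g by (simp add: cj_def)
qed

lemma qcis_add: "qcis (s + t) = qcis s * qcis t"
  by (simp add: qcis_def times_quat_def cos_add sin_add algebra_simps)

lemma qcis_0 [simp]: "qcis 0 = 1" by (simp add: quat_arith)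
lemma qcnj_qcis: "qcnj (qcis t) = qcis (- t)" by (simp add: quat_arith)
lemma qcis_power: "qcis t ^ n = qcis (of_nat n * t)"
  by (induction n) (simp_all add: qcis_add [symmetric] algebra_simps)
lemma Re_qcis [simp]: "qRe (qcis t) = cos t" by (simp add: qcis_def)
lemma qcis_pi [simp]: "qcis pi = -1" by (simp add: quat_arith)

lemma qcis_eq_iff: "qcis s = qcis t \<longleftrightarrow> (\<exists>n::int. s = t + 2 * pi * of_int n)"
  by (simp add: qcis_def sin_cos_eq_iff [symmetric] conj_commute)

lemma qcis_eq_1: "qcis t = 1 \<longleftrightarrow> (\<exists>n::int. t = 2 * pi * of_int n)"
  using qcis_eq_iff[of t 0] by simp

lemma j_qcis: "quat_j * qcis t = qcis (- t) * quat_j"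
  by (simp add: quat_arith)

lemma j_sq [simp]: "quat_j * quat_j = -1" by (simp add: quat_arith)

lemma subgroup_U_iff: "subgroup H SU2 \<longleftrightarrow> H \<subseteq> U \<and> 1 \<in> H \<and> (\<forall>x\<in>H. \<forall>y\<in>H. x * y \<in> H) \<and> (\<forall>x\<in>H. qcnj x \<in> H)"
  by (auto simp: subgroup_def subset_iff)

lemma cj_subgroup: "g \<in> U \<Longrightarrow> subgroup H SU2 \<Longrightarrow> subgroup (cj g ` H) SU2"
  unfolding subgroup_U_iff
  by (auto simp: image_iff cj_mult[symmetric] cj_qcnj[symmetric] intro: bexI[where x = 1])

lemma subgroup_power: assumes "subgroup H SU2" "x \<in> H" shows "x ^ n \<in> H"
  by (induction n) (use assms in \<open>auto simp: subgroup_U_iff\<close>)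

lemma SU2_pow: "x [^]\<^bsub>SU2\<lparr>carrier := H\<rparr>\<^esub> (n::nat) = x ^ n"
  by (induction n) (simp_all add: nat_pow_def SU2_def power_commutes)

lemma finite_subgroup_power_card:
  assumes "subgroup H SU2" "finite H" "x \<in> H" shows "x ^ card H = 1"
proof -
  interpret H: group "SU2\<lparr>carrier := H\<rparr>"
    using assms(1) group_SU2 by (simp add: subgroup.subgroup_is_group)
  show ?thesis using H.pow_order_eq_1[of x] assms by (simp add: order_def SU2_pow)
qed

lemma qcis_frac_eq_iff:
  assumes n: "n > 0"
  shows "qcis (2 * pi * of_int x / of_nat n) = qcis (2 * pi * of_int y / of_nat n) \<longleftrightarrow> int n dvd x - y"
proof -
  have "2 * pi * of_int x / of_nat n = 2 * pi * of_int y / of_nat n + 2 * pi * of_int w \<longleftrightarrow> x - y = int n * w"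
    for w :: int
  proof -
    have "2 * pi * of_int x / of_nat n = 2 * pi * of_int y / of_nat n + 2 * pi * of_int w \<longleftrightarrow>
       2 * pi * real_of_int x = 2 * pi * real_of_int (y + int n * w)" using n by (simp add: field_simps)
    also have "\<dots> \<longleftrightarrow> real_of_int x = real_of_int (y + int n * w)" by simp
    also have "\<dots> \<longleftrightarrow> x - y = int n * w" by (simp only: of_int_eq_iff) auto
    finally show ?thesis .
  qed
  then show ?thesis unfolding qcis_eq_iff dvd_def by simp
qed

lemma int_period:
  assumes "n > 0" obtains y :: nat and w :: int where "x = int y + int n * w" "y < n"
proof
  show "x = int (nat (x mod int n)) + int n * (x div int n)" using assms by simp
  show "nat (x mod int n) < n" using assms by (simp add: nat_less_iff)
qed

lemma Zc_image: assumes "n > 0" shows "Zc n = (\<lambda>x. qcis (2 * pi * real x / real n)) ` {..<n}"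
proof
  show "Zc n \<subseteq> (\<lambda>x. qcis (2 * pi * real x / real n)) ` {..<n}"
  proof
    fix z assume "z \<in> Zc n"
    then obtain x :: int where z: "z = qcis (2 * pi * of_int x / of_nat n)" by (auto simp: Zc_def)
    obtain y w where "x = int y + int n * w" and y: "y < n" using int_period[OF assms] by metis
    then have "z = qcis (2 * pi * of_int (int y) / of_nat n)" unfolding z qcis_frac_eq_iff[OF assms] by simp
    with y show "z \<in> (\<lambda>x. qcis (2 * pi * real x / real n)) ` {..<n}" by auto
  qed
  show "(\<lambda>x. qcis (2 * pi * real x / real n)) ` {..<n} \<subseteq> Zc n"
    unfolding Zc_def by (auto, metis of_int_of_nat_eq)
qed

text \<open>
By Lagrange every element of the group is a root of unity of order dividing the order of the group, and there
are no more such roots than elements.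
\<close>

lemma circle_subgroup:
  assumes H: "subgroup H SU2" and fin: "finite H" and circ: "\<And>x. x \<in> H \<Longrightarrow> qJ x = 0 \<and> qK x = 0"
  shows "H = Zc (card H)" "card H > 0"
proof -
  show c: "card H > 0" using H fin by (auto simp: card_gt_0_iff subgroup_U_iff)
  have "H \<subseteq> Zc (card H)"
  proof
    fix x assume x: "x \<in> H"
    then have "(qRe x)\<^sup>2 + (qI x)\<^sup>2 = 1" using H circ[OF x] by (auto simp: subgroup_U_iff U_iff)
    then obtain t where t: "qRe x = cos t" "qI x = sin t" using sincos_total_2pi by metis
    then have xt: "x = qcis t" using circ[OF x] by (simp add: quat_eq_iff qcis_def)
    have "qcis (of_nat (card H) * t) = 1" using finite_subgroup_power_card[OF H fin x] by (simp add: xt qcis_power)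
    then obtain n :: int where "of_nat (card H) * t = 2 * pi * of_int n" by (auto simp: qcis_eq_1)
    then have "t = 2 * pi * of_int n / of_nat (card H)" using c by (simp add: field_simps)
    then show "x \<in> Zc (card H)" unfolding xt Zc_def by blast
  qed
  moreover have "finite (Zc (card H))" "card (Zc (card H)) \<le> card H"
    unfolding Zc_image[OF c] by (auto intro: card_image_le[THEN order_trans])
  ultimately show "H = Zc (card H)" by (metis card_seteq)
qed

section \<open>Conjugacy and fixed points\<close>

text \<open>
A nonzero solution of \<open>a x = x b\<close> can be normalised because real scalars are central. This turns
conjugacy into a linear problem.
\<close>

lemma intertwiner:
  assumes x: "x \<noteq> 0" and ab: "a * x = x * b"
  obtains g where "g \<in> U" "cj g a = b"
proof -
  define n where "n = (qRe x)\<^sup>2 + (qI x)\<^sup>2 + (qJ x)\<^sup>2 + (qK x)\<^sup>2"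
  have n: "n > 0"
  proof (rule ccontr)
    assume "\<not> n > 0"
    then have "(qRe x)\<^sup>2 + (qI x)\<^sup>2 + (qJ x)\<^sup>2 + (qK x)\<^sup>2 \<le> 0" by (simp add: n_def)
    then have "qRe x = 0 \<and> qI x = 0 \<and> qJ x = 0 \<and> qK x = 0"
      by (smt (verit) zero_le_power2 power2_eq_square zero_less_power2)
    with x show False by (simp add: quat_eq_iff)
  qed
  define r where "r = Quat (inverse (sqrt n)) 0 0 0"
  define y where "y = x * r"
  have r: "r * z = z * r" for z by (simp add: r_def quat_eq_iff component_mult)
  have "(inverse (sqrt n))\<^sup>2 * n = 1" using n by (simp add: power_inverse)
  then have y: "y \<in> U"
    unfolding U_iff n_def y_def r_def component_mult by (simp add: power_mult_distrib algebra_simps)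
  have "a * y = y * b" using ab by (metis y_def r mult.assoc)
  then have "cj (qcnj y) a = b" using y by (simp add: cj_def mult.assoc)
  with y that show ?thesis by (metis U_qcnj)
qed

text \<open>
If \<open>v\<close> is the vector part of \<open>a\<close> and \<open>s\<close> its length, then \<open>v + s
i\<close> intertwines \<open>v\<close> with \<open>s i\<close>, since \<open>v\<^sup>2 = -s\<^sup>2\<close>.
It vanishes only if \<open>v\<close> is a nonpositive multiple of \<open>i\<close>, and then \<open>j\<close>
serves.
\<close>

lemma conj_into_circle:
  assumes a: "a \<in> U"
  obtains g t where "g \<in> U" "cj g a = qcis t" "sin t \<ge> 0"
proof -
  define s where "s = sqrt ((qI a)\<^sup>2 + (qJ a)\<^sup>2 + (qK a)\<^sup>2)"
  have s2: "s\<^sup>2 = (qI a)\<^sup>2 + (qJ a)\<^sup>2 + (qK a)\<^sup>2" and s0: "s \<ge> 0" by (simp_all add: s_def)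
  have "(qRe a)\<^sup>2 + s\<^sup>2 = 1" using a s2 by (simp add: U_iff)
  then obtain t where t: "qRe a = cos t" "s = sin t" using sincos_total_2pi by metis
  have *: "\<exists>x. x \<noteq> 0 \<and> a * x = x * qcis t"
  proof (cases "qJ a = 0 \<and> qK a = 0 \<and> qI a \<le> 0")
    case True
    then have "s = - qI a" by (simp add: s_def)
    then show ?thesis using True t
      by (intro exI[of _ quat_j]) (simp add: quat_eq_iff component_mult, simp add: quat_arith)
  next
    case False
    define x where "x = Quat 0 (qI a + s) (qJ a) (qK a)"
    have "x \<noteq> 0"
    proof
      assume "x = 0"
      then have "qJ a = 0" "qK a = 0" "qI a = - s" by (auto simp: x_def zero_quat_def)
      with False s0 show False by simp
    qed
    moreover have "a * x = x * qcis t"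
      using t s2 by (simp add: quat_eq_iff component_mult x_def qcis_def power2_eq_square algebra_simps)
    ultimately show ?thesis by blast
  qed
  then obtain g where "g \<in> U" "cj g a = qcis t" using intertwiner by metis
  with that t s0 show ?thesis by metis
qed

lemma conj_if_Re_eq:
  assumes "a \<in> U" "b \<in> U" "qRe a = qRe b"
  obtains g where "g \<in> U" "cj g a = b"
proof -
  obtain g s where g: "g \<in> U" "cj g a = qcis s" "sin s \<ge> 0" using conj_into_circle assms by metis
  obtain h t where h: "h \<in> U" "cj h b = qcis t" "sin t \<ge> 0" using conj_into_circle assms by metis
  have "cos s = cos t" using g h assms by (metis Re_cj Re_qcis)
  then have "sin s = sin t" using g(3) h(3) by (metis abs_of_nonneg sin_cos_sqrt)
  then have "qcis s = qcis t" using \<open>cos s = cos t\<close> by (simp add: qcis_def)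
  then have "cj (qcnj h * g) a = b" using g h by (metis cj_cj cj_inv(1))
  with g h that show ?thesis by (metis U_mult U_qcnj)
qed

text \<open>
Once \<open>a\<close> lies in the circle, conjugation by the circle rotates the
\<open>j\<close>-\<open>k\<close> plane and leaves \<open>a\<close> alone.
\<close>

lemma pair_normal_form:
  assumes a: "a \<in> U" and b: "b \<in> U"
  obtains g t where "g \<in> U" "cj g a = qcis t" "sin t \<ge> 0" "qJ (cj g b) \<ge> 0" "qK (cj g b) = 0"
proof -
  obtain g t where g: "g \<in> U" "cj g a = qcis t" "sin t \<ge> 0" using conj_into_circle a by metis
  define c where "c = cj g b"
  define r where "r = sqrt ((qJ c)\<^sup>2 + (qK c)\<^sup>2)"
  obtain \<phi> where p: "qJ c = r * cos \<phi>" "qK c = r * sin \<phi>"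
  proof (cases "r = 0")
    case True
    then have "qJ c = 0 \<and> qK c = 0" by (simp add: r_def sum_power2_eq_zero_iff)
    then show ?thesis using that True by simp
  next
    case False
    then have "(qJ c / r)\<^sup>2 + (qK c / r)\<^sup>2 = 1"
      by (simp add: r_def power_divide add_divide_distrib[symmetric])
    then obtain \<phi> where "qJ c / r = cos \<phi>" "qK c / r = sin \<phi>" using sincos_total_2pi by metis
    then show ?thesis using that[of \<phi>] False by (simp add: field_simps)
  qed
  define s where "s = - \<phi> / 2"
  have cs: "cos \<phi> = (cos s)\<^sup>2 - (sin s)\<^sup>2" "sin \<phi> = - (2 * sin s * cos s)"
    using cos_double[of "\<phi>/2"] sin_double[of "\<phi>/2"] by (simp_all add: s_def)
  have one: "(cos s)\<^sup>2 + (sin s)\<^sup>2 = 1" by simp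
  have J: "qJ (cj (qcis s) c) = r * ((cos s)\<^sup>2 + (sin s)\<^sup>2)\<^sup>2"
    unfolding cj_def component_mult p cs
    by (simp add: quat_arith power2_eq_square algebra_simps
        del: sin_cos_squared_add sin_cos_squared_add2 sin_cos_squared_add3)
  have K: "qK (cj (qcis s) c) = 0"
    unfolding cj_def by (simp add: component_mult p cs) (simp add: quat_arith power2_eq_square algebra_simps)
  have A: "cj (qcis s) (qcis t) = qcis t"
    by (simp add: cj_def qcnj_qcis qcis_add[symmetric])
  have "r \<ge> 0" by (simp add: r_def)
  then show ?thesis using that[of "qcis s * g" t] g J K A one by (simp add: cj_cj[symmetric] c_def)
qed

text \<open>
The three real parts determine the common normal form: they fix the angle of \<open>a\<close>, the first two
components of \<open>b\<close> and, by the norm, the third. This is the statement that two axes with given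
rotation angles are determined up to rotation by the angle between them.
\<close>

lemma simultaneous_conj:
  assumes U: "a \<in> U" "b \<in> U" "a' \<in> U" "b' \<in> U"
    and eq: "qRe a = qRe a'" "qRe b = qRe b'" "qRe (a * b) = qRe (a' * b')"
    and nc: "\<bar>qRe a\<bar> < 1"
  obtains g where "g \<in> U" "cj g a = a'" "cj g b = b'"
proof -
  obtain g s where g: "g \<in> U" "cj g a = qcis s" "sin s \<ge> 0" "qJ (cj g b) \<ge> 0" "qK (cj g b) = 0"
    using pair_normal_form U by metis
  obtain h t where h: "h \<in> U" "cj h a' = qcis t" "sin t \<ge> 0" "qJ (cj h b') \<ge> 0" "qK (cj h b') = 0"
    using pair_normal_form U by metis
  have c: "cos s = cos t" using g h eq by (metis Re_cj Re_qcis)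
  have sn: "sin s = sin t" using c g(3) h(3) by (metis abs_of_nonneg sin_cos_sqrt)
  then have A: "qcis s = qcis t" using c by (simp add: qcis_def)
  have "cos s \<noteq> 1" "cos s \<noteq> -1" using nc g by (metis Re_cj Re_qcis abs_one less_irrefl, metis Re_cj Re_qcis abs_minus_cancel abs_one less_irrefl)
  then have s0: "sin s \<noteq> 0" by (metis cos_one_sin_zero sin_zero_abs_cos_one abs_eq_iff abs_one)
  have R: "qRe (cj g b) = qRe (cj h b')" using g h eq by simp
  have "qRe (cj g a * cj g b) = qRe (cj h a' * cj h b')" using eq(3) g(1) h(1) by (simp only: cj_mult[symmetric] Re_cj)
  then have I: "qI (cj g b) = qI (cj h b')" using g h A R s0 c sn
    by (simp add: component_mult) (simp add: qcis_def)
  have "cj g b \<in> U" "cj h b' \<in> U" using g h U by simp_all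
  then have "(qJ (cj g b))\<^sup>2 = (qJ (cj h b'))\<^sup>2"
    unfolding U_iff R I g(5) h(5) by linarith
  then have J: "qJ (cj g b) = qJ (cj h b')" using g(4) h(4) by (metis abs_of_nonneg real_sqrt_abs)
  have B: "cj g b = cj h b'" using R I J g h by (simp add: quat_eq_iff)
  have "cj (qcnj h * g) a = a'" "cj (qcnj h * g) b = b'" using A B g h by (metis cj_cj cj_inv(1))+
  with g h that show ?thesis by (metis U_mult U_qcnj)
qed

lemma carrier_G3: "carrier G3 = U \<times> U \<times> U" by (simp add: DirProd_def)
lemma mult_G3: "(a, b, c) \<otimes>\<^bsub>G3\<^esub> (x, y, z) = (a * x, b * y, c * z)" by (simp add: DirProd_def)
lemma one_G3: "\<one>\<^bsub>G3\<^esub> = (1, 1, 1)" by (simp add: DirProd_def)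

lemma coset_diagK:
  "(a, b, c) <#\<^bsub>G3\<^esub> diagK = {(a * w, b * w, c * w) | w. w \<in> U}"
  by (auto simp: l_coset_def diagK_def mult_G3)

lemma fixes_point_iff:
  assumes U: "a \<in> U" "b \<in> U" "d \<in> U"
  shows "(\<exists>p\<in>homM. (a, b, d) <#\<^bsub>G3\<^esub> p = p) \<longleftrightarrow> qRe a = qRe b \<and> qRe b = qRe d"
proof
  assume "\<exists>p\<in>homM. (a, b, d) <#\<^bsub>G3\<^esub> p = p"
  then obtain x y z where xyz: "x \<in> U" "y \<in> U" "z \<in> U"
    and fix_p: "(a, b, d) <#\<^bsub>G3\<^esub> ((x, y, z) <#\<^bsub>G3\<^esub> diagK) = (x, y, z) <#\<^bsub>G3\<^esub> diagK"
    by (auto simp: homM_def carrier_G3)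
  have "(x, y, z) \<in> (x, y, z) <#\<^bsub>G3\<^esub> diagK"
    unfolding coset_diagK by (auto intro: exI[of _ 1])
  then have "(a * x, b * y, d * z) \<in> (a, b, d) <#\<^bsub>G3\<^esub> ((x, y, z) <#\<^bsub>G3\<^esub> diagK)"
    by (force simp: l_coset_def mult_G3)
  then obtain w where w: "a * x = x * w" "b * y = y * w" "d * z = z * w"
    unfolding fix_p by (auto simp: coset_diagK)
  have "qRe e = qRe w" if "e * v = v * w" "v \<in> U" for e v
  proof -
    have "e = cj v w" using that by (metis cj_def mult.assoc mult.right_neutral qcnj_right)
    then show ?thesis using that by simp
  qed
  then show "qRe a = qRe b \<and> qRe b = qRe d" using w xyz by metis
next
  assume eq: "qRe a = qRe b \<and> qRe b = qRe d"
  obtain g where g: "g \<in> U" "cj g d = a" using conj_if_Re_eq[of d a] U eq by metis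
  obtain h where h: "h \<in> U" "cj h d = b" using conj_if_Re_eq[of d b] U eq by metis
  define p where "p = (g, h, 1) <#\<^bsub>G3\<^esub> diagK"
  have ag: "a * g = g * d" "b * h = h * d" using g h by (auto simp: cj_def mult.assoc)
  have "(a, b, d) <#\<^bsub>G3\<^esub> p = {(a * (g * w), b * (h * w), d * w) | w. w \<in> U}"
    unfolding p_def coset_diagK by (force simp: l_coset_def mult_G3)
  also have "\<dots> = {(g * (d * w), h * (d * w), d * w) | w. w \<in> U}"
    by (simp add: mult.assoc[symmetric] ag)
  also have "\<dots> = {(g * w, h * w, 1 * w) | w. w \<in> U}"
  proof -
    have "w \<in> (\<lambda>w. d * w) ` U" if "w \<in> U" for w
      using that U by (intro image_eqI[of _ _ "qcnj d * w"]) simp_all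
    then have d: "(\<lambda>w. d * w) ` U = U" using U by auto
    have "{F (d * w) | w. w \<in> U} = F ` (\<lambda>w. d * w) ` U" for F :: "quat \<Rightarrow> quat \<times> quat \<times> quat"
      by blast
    then have "{F (d * w) | w. w \<in> U} = {F w | w. w \<in> U}" for F :: "quat \<Rightarrow> quat \<times> quat \<times> quat"
      unfolding d by blast
    from this[of "\<lambda>w. (g * w, h * w, w)"] show ?thesis by simp
  qed
  finally have "(a, b, d) <#\<^bsub>G3\<^esub> p = p" by (simp add: p_def coset_diagK)
  moreover have "(g, h, 1) \<in> carrier G3" using g h by (simp add: carrier_G3)
  then have "p \<in> homM" unfolding p_def homM_def by blast
  ultimately show "\<exists>p\<in>homM. (a, b, d) <#\<^bsub>G3\<^esub> p = p" by blast
qed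

text \<open>
It is enough to ask for \<open>d = 1\<close>: real part one characterises the identity, so then \<open>a = b =
1\<close> as well.
\<close>

lemma acts_freely_iff:
  assumes "H \<subseteq> U \<times> U \<times> U"
  shows "acts_freely H \<longleftrightarrow>
    (\<forall>a b d. (a, b, d) \<in> H \<longrightarrow> qRe a = qRe b \<longrightarrow> qRe b = qRe d \<longrightarrow> d = 1)"
proof -
  have one: "(a, b, d) = (1, 1, 1) \<longleftrightarrow> d = 1" if "(a, b, d) \<in> H" "qRe a = qRe b" "qRe b = qRe d" for a b d
  proof -
    have "a \<in> U" "b \<in> U" "d \<in> U" using that assms by auto
    then show ?thesis using that U_Re_one[of a] U_Re_one[of b] U_Re_one[of d] by auto
  qed
  have fp: "(\<exists>p\<in>homM. (a, b, d) <#\<^bsub>G3\<^esub> p = p) \<longleftrightarrow> qRe a = qRe b \<and> qRe b = qRe d"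
    if "(a, b, d) \<in> H" for a b d
    using that assms by (intro fixes_point_iff) auto
  have "acts_freely H \<longleftrightarrow>
      (\<forall>a b d. (a, b, d) \<in> H \<longrightarrow> (\<exists>p\<in>homM. (a, b, d) <#\<^bsub>G3\<^esub> p = p) \<longrightarrow> (a, b, d) = (1, 1, 1))"
    unfolding acts_freely_def one_G3 by (simp only: Ball_def split_paired_All) blast
  also have "\<dots> \<longleftrightarrow> (\<forall>a b d. (a, b, d) \<in> H \<longrightarrow> qRe a = qRe b \<longrightarrow> qRe b = qRe d \<longrightarrow> d = 1)"
  proof (intro iff_allI)
    fix a b d
    show "((a, b, d) \<in> H \<longrightarrow> (\<exists>p\<in>homM. (a, b, d) <#\<^bsub>G3\<^esub> p = p) \<longrightarrow> (a, b, d) = (1, 1, 1)) \<longleftrightarrow>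
        ((a, b, d) \<in> H \<longrightarrow> qRe a = qRe b \<longrightarrow> qRe b = qRe d \<longrightarrow> d = 1)"
      using fp[of a b d] one[of a b d] by argo
  qed
  finally show ?thesis .
qed

section \<open>Finite groups preserving an axis\<close>

lemma subgroupD:
  assumes "subgroup H SU2"
  shows "H \<subseteq> U" "1 \<in> H" "\<And>x y. x \<in> H \<Longrightarrow> y \<in> H \<Longrightarrow> x * y \<in> H" "\<And>x. x \<in> H \<Longrightarrow> qcnj x \<in> H"
    "\<And>x. x \<in> H \<Longrightarrow> x \<in> U"
  using assms by (auto simp: subgroup_U_iff)

definition circle_part :: "quat set \<Rightarrow> quat set" where
  "circle_part H = {x \<in> H. qJ x = 0 \<and> qK x = 0}"

lemma circle_part_Zc:
  assumes "subgroup H SU2" "finite H"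
  obtains m where "m > 0" "circle_part H = Zc m"
proof -
  have "subgroup (circle_part H) SU2"
    unfolding subgroup_U_iff
  proof (intro conjI ballI)
    show "circle_part H \<subseteq> U" using subgroupD(1)[OF assms(1)] by (auto simp: circle_part_def)
    show "1 \<in> circle_part H" using subgroupD(2)[OF assms(1)] by (simp add: circle_part_def)
    show "x * y \<in> circle_part H" if "x \<in> circle_part H" "y \<in> circle_part H" for x y
      using that subgroupD(3)[OF assms(1), of x y] by (simp add: circle_part_def component_mult)
    show "qcnj x \<in> circle_part H" if "x \<in> circle_part H" for x
      using that subgroupD(4)[OF assms(1), of x] by (simp add: circle_part_def)
  qed
  moreover have "finite (circle_part H)" using assms(2) by (simp add: circle_part_def)
  ultimately have "circle_part H = Zc (card (circle_part H))" "card (circle_part H) > 0"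
    by (rule circle_subgroup; simp add: circle_part_def)+
  with that show ?thesis by blast
qed

lemma qcis_in_Zc: "qcis (2 * pi * of_int x / of_nat n) \<in> Zc n"
  unfolding Zc_def by blast

lemma Zc_1: "Zc 1 = {1}"
  unfolding Zc_image[OF zero_less_one] by (simp add: lessThan_Suc)

lemma Zc_2: "Zc 2 = {1, -1}"
  unfolding Zc_image[OF zero_less_numeral] by (auto simp: lessThan_nat_numeral lessThan_Suc)

lemma minus_one_Zc:
  assumes "m > 0" "-1 \<in> Zc m" obtains n where "m = 2 * n" "n > 0"
proof -
  obtain x :: int where "qcis pi = qcis (2 * pi * of_int x / of_nat m)" using assms(2) by (auto simp: Zc_def)
  then obtain n :: int where "2 * pi * of_int x / of_nat m = pi + 2 * pi * of_int n" by (metis qcis_eq_iff)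
  then have "pi * (2 * of_int x) = pi * (of_nat m * (1 + 2 * of_int n))" using assms(1) by (simp add: field_simps)
  then have "2 * real_of_int x = of_nat m * (1 + 2 * of_int n)" by simp
  then have "real_of_int (2 * x) = real_of_int (int m * (1 + 2 * n))" by simp
  then have "2 * x = int m * (1 + 2 * n)" by (simp only: of_int_eq_iff)
  then have "even (int m * (1 + 2 * n))" by (metis dvd_triv_left)
  then have "even m" by simp
  with assms(1) that show ?thesis by (auto elim!: evenE)
qed

lemma binD_eq: "binD n = Zc (2 * n) \<union> (*) quat_j ` Zc (2 * n)"
  unfolding binD_def Zc_def by auto

lemma ADE_if_in_circle:
  assumes "subgroup G SU2" "finite G" "G \<noteq> {1}" "\<And>x. x \<in> G \<Longrightarrow> qJ x = 0 \<and> qK x = 0"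
  shows "ADE G"
proof -
  have "circle_part G = G" using assms(4) by (auto simp: circle_part_def)
  then obtain m where "m > 0" "G = Zc m" using circle_part_Zc assms by metis
  moreover have "m \<noteq> 1" using assms(3) Zc_1 calculation(2) by metis
  ultimately show ?thesis unfolding ADE_def by (intro disjI1 exI[of _ m]) auto
qed

text \<open>
The vector \<open>P\<close> spans the axis: conjugation by \<open>h\<close> fixes it or reverses it.
\<close>

definition preserves_axis :: "quat set \<Rightarrow> bool" where
  "preserves_axis G \<longleftrightarrow> (\<exists>P. qRe P = 0 \<and> P \<noteq> 0 \<and> (\<forall>h\<in>G. h * P = P * h \<or> h * P = - (P * h)))"

lemma axis_to_i:
  assumes "qRe P = 0" "P \<noteq> 0"
  obtains g s where "g \<in> U" "s \<noteq> 0" "cj g P = Quat 0 s 0 0"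
proof -
  define n where "n = (qI P)\<^sup>2 + (qJ P)\<^sup>2 + (qK P)\<^sup>2"
  have "n \<ge> 0" by (simp add: n_def)
  moreover have "n \<noteq> 0"
  proof
    assume "n = 0"
    then have "qI P = 0 \<and> qJ P = 0 \<and> qK P = 0" unfolding n_def
      by (smt (verit) zero_le_power2 power2_eq_square zero_less_power2)
    with assms show False by (simp add: quat_eq_iff)
  qed
  ultimately have n: "n > 0" by simp
  define r where "r = inverse (sqrt n)"
  have r2: "r\<^sup>2 * n = 1" using n by (simp add: r_def power_inverse)
  define u where "u = Quat 0 (r * qI P) (r * qJ P) (r * qK P)"
  have "u \<in> U" using r2 by (simp add: U_iff u_def n_def power_mult_distrib algebra_simps)
  then obtain g t where g: "g \<in> U" "cj g u = qcis t" using conj_into_circle by metis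
  have "cos t = 0" using g Re_cj[of g u] by (simp add: u_def)
  have Pu: "P = Quat (sqrt n) 0 0 0 * u"
    using n by (simp add: u_def r_def quat_eq_iff component_mult assms)
  have "cj g P = Quat (sqrt n) 0 0 0 * cj g u"
  proof -
    have "g * Quat (sqrt n) 0 0 0 = Quat (sqrt n) 0 0 0 * g" by (simp add: quat_eq_iff component_mult)
    then show ?thesis unfolding Pu cj_def by (metis mult.assoc)
  qed
  also have "\<dots> = Quat 0 (sqrt n * sin t) 0 0"
    unfolding g using \<open>cos t = 0\<close> by (simp add: quat_eq_iff component_mult) (simp add: qcis_def)
  finally have "cj g P = Quat 0 (sqrt n * sin t) 0 0" .
  moreover have "sqrt n * sin t \<noteq> 0" using n \<open>cos t = 0\<close> sin_zero_abs_cos_one[of t] by auto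
  ultimately show ?thesis using that g by metis
qed

lemma minus_one_in_conj: assumes "g \<in> U" shows "-1 \<in> cj g ` G \<longleftrightarrow> -1 \<in> G"
proof -
  have "cj g (-1) = -1" using assms by simp
  then show ?thesis using cj_inj[OF assms] by (metis imageE imageI)
qed

lemma cj_image_triv: "g \<in> U \<Longrightarrow> cj g ` G = {1} \<longleftrightarrow> G = {1}"
proof
  assume "g \<in> U" "cj g ` G = {1}"
  then have "cj (qcnj g) ` cj g ` G = {1}" by simp
  then show "G = {1}" using \<open>g \<in> U\<close> by (simp add: image_image)
qed auto

lemma conj_to_j:
  assumes v: "v \<in> U" "qRe v = 0" "qI v = 0"
  obtains s where "cj (qcis s) v = quat_j"
proof -
  have "(qJ v)\<^sup>2 + (qK v)\<^sup>2 = 1" using v by (simp add: U_iff)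
  then obtain \<psi> where p: "qJ v = cos \<psi>" "qK v = sin \<psi>" using sincos_total_2pi by metis
  have vj: "v = quat_j * qcis (- \<psi>)"
    using v p by (simp add: quat_eq_iff component_mult) (simp add: quat_arith)
  have "cj (qcis (- \<psi> / 2)) v = qcis (- \<psi> / 2) * (quat_j * qcis (- \<psi>)) * qcis (\<psi> / 2)"
    by (simp add: vj cj_def qcnj_qcis)
  also have "\<dots> = qcis (- \<psi> / 2) * quat_j * (qcis (- \<psi>) * qcis (\<psi> / 2))" by (simp only: mult.assoc)
  also have "\<dots> = qcis (- \<psi> / 2) * (quat_j * qcis (- \<psi> / 2))" by (simp add: qcis_add[symmetric] mult.assoc)
  also have "\<dots> = quat_j" by (simp add: j_qcis mult.assoc[symmetric] qcis_add[symmetric])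
  finally show ?thesis using that by blast
qed

text \<open>
With the axis moved to \<open>i\<close>, every element lies in the circle or in \<open>j\<close> times the
circle. The circle part is cyclic. If there is an element outside, a rotation moves it to \<open>j\<close>;
its square \<open>-1\<close> makes the order of the circle part even, and the group is binary dihedral. The
smallest instance \<open>{1, -1, j, -j}\<close> is cyclic of order four about another axis.
\<close>

lemma axis_imp_ADE:
  assumes G: "subgroup G SU2" "finite G" "G \<noteq> {1}" and ax: "preserves_axis G"
  obtains g where "g \<in> U" "ADE (cj g ` G)"
proof -
  obtain P where P: "qRe P = 0" "P \<noteq> 0" and GP: "\<And>h. h \<in> G \<Longrightarrow> h * P = P * h \<or> h * P = - (P * h)"
    using ax unfolding preserves_axis_def by blast
  obtain g s where g: "g \<in> U" and s: "s \<noteq> 0" "cj g P = Quat 0 s 0 0" using axis_to_i P by metis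
  define H where "H = cj g ` G"
  have H: "subgroup H SU2" "finite H" "H \<noteq> {1}"
    using G g by (simp_all add: H_def cj_subgroup cj_image_triv)
  have dich: "(qJ h = 0 \<and> qK h = 0) \<or> (qRe h = 0 \<and> qI h = 0)" if hH: "h \<in> H" for h
  proof -
    obtain h' where h': "h' \<in> G" "h = cj g h'" using hH H_def by blast
    have "h * Quat 0 s 0 0 = Quat 0 s 0 0 * h \<or> h * Quat 0 s 0 0 = - (Quat 0 s 0 0 * h)"
      using GP[OF h'(1)] g unfolding h'(2) s(2)[symmetric] by (metis cj_mult cj_minus)
    then show ?thesis using s(1) by (auto simp: quat_eq_iff component_mult)
  qed
  show ?thesis
  proof (cases "\<forall>h\<in>H. qJ h = 0 \<and> qK h = 0")
    case True
    then show ?thesis using that g ADE_if_in_circle H unfolding H_def by blast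
  next
    case False
    then obtain v where v: "v \<in> H" "qRe v = 0" "qI v = 0" using dich by blast
    moreover have "v \<in> U" using v(1) subgroupD(5)[OF H(1)] by blast
    ultimately obtain \<sigma> where \<sigma>: "cj (qcis \<sigma>) v = quat_j" using conj_to_j by metis
    define f where "f = qcis \<sigma>"
    have f: "f \<in> U" and cjv: "cj f v = quat_j" using \<sigma> by (simp_all add: f_def)
    define K where "K = cj f ` H"
    have K: "subgroup K SU2" "finite K" "K \<noteq> {1}"
      using H f by (simp_all add: K_def cj_subgroup cj_image_triv)
    have jK: "quat_j \<in> K" using v cjv K_def by (metis imageI)
    have KG: "K = cj (f * g) ` G" by (simp add: K_def H_def image_image cj_cj)
    have dichK: "(qJ h = 0 \<and> qK h = 0) \<or> (qRe h = 0 \<and> qI h = 0)" if hK: "h \<in> K" for h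
    proof -
      obtain h' where h': "h' \<in> H" "h = cj f h'" using hK K_def by blast
      from dich[OF h'(1)] show ?thesis
        by (auto simp: h'(2) cj_def f_def component_mult) (auto simp: quat_arith algebra_simps)
    qed
    obtain m where m: "m > 0" "circle_part K = Zc m" using circle_part_Zc K by metis
    have "-1 \<in> K" using jK subgroupD(3)[OF K(1) jK jK] by simp
    then have "-1 \<in> circle_part K" by (simp add: circle_part_def)
    then have "-1 \<in> Zc m" by (simp only: m)
    then obtain n where n: "m = 2 * n" "n > 0" using minus_one_Zc m by metis
    have K_eq: "K = binD n"
    proof
      show "K \<subseteq> binD n"
      proof
        fix h assume h: "h \<in> K"
        from dichK[OF h] show "h \<in> binD n"
        proof
          assume "qJ h = 0 \<and> qK h = 0"
          then show ?thesis using h m(2) unfolding binD_eq n circle_part_def by blast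
        next
          assume a: "qRe h = 0 \<and> qI h = 0"
          have "qcnj quat_j * h \<in> K" using K(1) jK h by (metis subgroupD(3,4))
          moreover have "qJ (qcnj quat_j * h) = 0 \<and> qK (qcnj quat_j * h) = 0"
            using a by (simp add: component_mult) (simp add: quat_arith)
          ultimately have "qcnj quat_j * h \<in> circle_part K" by (simp add: circle_part_def)
          then have "qcnj quat_j * h \<in> Zc m" by (simp only: m)
          then have "quat_j * (qcnj quat_j * h) \<in> binD n" unfolding binD_eq n by blast
          then show ?thesis by simp
        qed
      qed
      show "binD n \<subseteq> K"
        using m(2) subgroupD(3)[OF K(1) jK] unfolding binD_eq n circle_part_def by blast
    qed
    show ?thesis
    proof (cases "n = 1")
      case False
      then have "ADE K" using n K_eq unfolding ADE_def by (intro disjI2 disjI1 exI[of _ n]) auto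
      then show ?thesis using that[of "f * g"] KG f g by simp
    next
      case True
      obtain e where e: "e \<in> U" "cj e quat_j = qcis (pi / 2)"
        by (rule conj_if_Re_eq[of quat_j "qcis (pi/2)"]) (simp_all, simp add: quat_j_def)
      have "qJ x = 0 \<and> qK x = 0" if "x \<in> cj e ` K" for x
        using that e unfolding K_eq binD_eq True by (auto simp: Zc_2) (auto simp: qcis_def)
      then have "ADE (cj e ` K)"
        using K e by (intro ADE_if_in_circle) (simp_all add: cj_subgroup cj_image_triv)
      then show ?thesis using that[of "e * (f * g)"] KG e f g by (simp add: image_image cj_cj)
    qed
  qed
qed

section \<open>Groups without small rotations\<close>

lemma golden_sq: "golden * golden = golden + 1"
  by (simp add: golden_def field_simps)
lemma golden_bounds: "1.618 < golden" "golden < 1.619"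
proof -
  have "2.236 < sqrt 5" by (rule real_less_rsqrt) (simp add: power2_eq_square)
  moreover have "sqrt 5 < 2.238" by (rule real_less_lsqrt) (simp_all add: power2_eq_square)
  ultimately show "1.618 < golden" "golden < 1.619" by (simp_all add: golden_def)
qed
lemma inverse_golden: "inverse golden = golden - 1"
  using golden_sq golden_bounds by (simp add: field_simps)

lemma cos_cases_4: "sin (2 * t) = 0 \<Longrightarrow> cos t \<in> {0, 1, -1::real}"
  using sin_zero_abs_cos_one[of t] by (auto simp: sin_double abs_if split: if_splits)

lemma cos_cases_6: assumes "sin (3 * t) = 0" shows "cos t \<in> {1, -1, 1/2, -1/2::real}"
proof -
  have "sin (3 * t) = sin (2 * t + t)" by (simp add: algebra_simps)
  also have "\<dots> = sin t * (2 * cos t * cos t + 2 * (cos t)\<^sup>2 - 1)"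
    by (simp only: sin_add sin_double cos_double_cos) (simp add: power2_eq_square algebra_simps)
  finally have "sin t = 0 \<or> (2 * cos t - 1) * (2 * cos t + 1) = 0" using assms by (auto simp: power2_eq_square algebra_simps)
  then show ?thesis using sin_zero_abs_cos_one[of t] by (auto simp: abs_eq_iff')
qed

lemma cos_cases_8: assumes "sin (4 * t) = 0" shows "cos t \<in> {0, 1, -1, sqrt 2 / 2, - sqrt 2 / 2::real}"
proof -
  have "sin (4 * t) = 2 * sin (2 * t) * cos (2 * t)" using sin_double[of "2 * t"] by simp
  then have "sin (2 * t) = 0 \<or> 2 * (cos t)\<^sup>2 - 1 = 0" using assms by (simp add: cos_double_cos)
  then show ?thesis
  proof
    assume "2 * (cos t)\<^sup>2 - 1 = 0"
    then have "(cos t)\<^sup>2 = (sqrt 2 / 2)\<^sup>2" by (simp add: power_divide)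
    then show ?thesis unfolding power2_eq_iff by auto
  qed (use cos_cases_4[of t] in auto)
qed

text \<open>
The factor \<open>16 c\<^sup>4 - 12 c\<^sup>2 + 1\<close> of \<open>sin 5t\<close> splits over the golden
ratio.
\<close>

lemma cos_cases_10: assumes "sin (5 * t) = 0"
  shows "cos t \<in> {1, -1, golden / 2, - golden / 2, (golden - 1) / 2, (1 - golden) / 2::real}"
proof -
  define c where "c = cos t"
  have s2: "sin t * sin t = 1 - c * c" using sin_cos_squared_add[of t] by (simp add: c_def power2_eq_square)
  have "sin (5 * t) = sin (2 * (2 * t) + t)" by (simp add: algebra_simps)
  also have "\<dots> = sin t * (16 * c^4 - 12 * c\<^sup>2 + 1)"
    by (simp only: sin_add sin_double cos_double_cos c_def) (simp add: power2_eq_square power4_eq_xxxx algebra_simps)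
  finally have "sin t = 0 \<or> 16 * c^4 - 12 * c\<^sup>2 + 1 = 0" using assms by auto
  then show ?thesis
  proof
    assume *: "16 * c^4 - 12 * c\<^sup>2 + 1 = 0"
    have "(2 * c - golden) * (2 * c + golden) * ((2 * c - (golden - 1)) * (2 * c + (golden - 1)))
       = (4 * c * c - golden * golden) * (4 * c * c - (golden - 1) * (golden - 1))" by (simp add: algebra_simps)
    also have "\<dots> = (4 * c * c - (golden + 1)) * (4 * c * c - (2 - golden))"
      by (simp add: golden_sq algebra_simps)
    also have "\<dots> = 16 * c^4 - 12 * c\<^sup>2 + 1"
      using golden_sq by (simp add: power2_eq_square power4_eq_xxxx algebra_simps)
    finally have "(2 * c - golden) * (2 * c + golden) * ((2 * c - (golden - 1)) * (2 * c + (golden - 1))) = 0" using * by simp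
    then have "2 * c = golden \<or> 2 * c = - golden \<or> 2 * c = golden - 1 \<or> 2 * c = 1 - golden" by auto
    then show ?thesis unfolding c_def[symmetric] by auto
  qed (use sin_zero_abs_cos_one[of t] in \<open>auto simp: abs_eq_iff'\<close>)
qed

lemma cos_pi_5: "cos (pi / 5) = golden / 2"
proof -
  have "cos (pi / 3) < cos (pi / 5)" by (intro cos_monotone_0_pi) auto
  then have gt: "1 / 2 < cos (pi / 5)" by (simp add: cos_60)
  have "cos (pi / 5) < cos 0" by (intro cos_monotone_0_pi) auto
  then have "cos (pi / 5) \<noteq> 1" by simp
  then show ?thesis using cos_cases_10[of "pi / 5"] gt golden_bounds by auto
qed

text \<open>
The elements sharing the axis of a given one form a cyclic group of even order \<open>2n\<close>;
\<open>h\<close> is a generator. Its real part is the largest one below \<open>1\<close> on this axis, so a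
bound on all real parts bounds \<open>n\<close>.
\<close>

lemma circle_part_generator:
  assumes G: "subgroup G SU2" "finite G" "-1 \<in> G" and c: "c \<in> U"
  obtains n h where "n > 0" "circle_part (cj c ` G) = Zc (2 * n)"
    "h \<in> G" "h \<noteq> 1" "qRe h = cos (pi / of_nat n)"
proof -
  define H where "H = cj c ` G"
  have H: "subgroup H SU2" "finite H" using G c by (simp_all add: H_def cj_subgroup)
  obtain m where m: "m > 0" "circle_part H = Zc m" using circle_part_Zc H by metis
  have "-1 \<in> H" using G(3) minus_one_in_conj[OF c] H_def by blast
  then have "-1 \<in> circle_part H" by (simp add: circle_part_def)
  then have "-1 \<in> Zc m" by (simp only: m)
  then obtain n where n: "m = 2 * n" "n > 0" using minus_one_Zc m by metis
  have "qcis (2 * pi * of_int 1 / of_nat m) \<in> circle_part H" using m(2) qcis_in_Zc by metis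
  then obtain h where h: "h \<in> G" "cj c h = qcis (2 * pi * of_int 1 / of_nat m)"
    unfolding circle_part_def H_def by (metis (no_types, lifting) imageE mem_Collect_eq)
  then have R: "qRe h = cos (pi / of_nat n)" using c n Re_cj[of c h] by simp
  have "cos (pi / of_nat n) < cos 0" using n by (intro cos_monotone_0_pi) (auto simp: field_simps)
  then have "h \<noteq> 1" using R by auto
  then show ?thesis using that[of n h] n m h(1) R by (simp add: H_def)
qed

lemma element_angle:
  assumes G: "subgroup G SU2" "finite G" "-1 \<in> G" and g: "g \<in> G"
  obtains n k h where "n > 0" "qRe g = cos (pi * of_int k / of_nat n)"
    "h \<in> G" "h \<noteq> 1" "qRe h = cos (pi / of_nat n)"
proof -
  obtain c t where c: "c \<in> U" "cj c g = qcis t" using conj_into_circle G(1) g by (metis subgroupD(5))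
  obtain n h where n: "n > 0" "circle_part (cj c ` G) = Zc (2 * n)"
    and h: "h \<in> G" "h \<noteq> 1" "qRe h = cos (pi / of_nat n)"
    using circle_part_generator[OF G c(1)] by metis
  have "qcis t \<in> cj c ` G" using g c(2) by (metis imageI)
  then have "qcis t \<in> circle_part (cj c ` G)" by (simp add: circle_part_def) (simp add: qcis_def)
  then have "qcis t \<in> Zc (2 * n)" by (simp only: n)
  then obtain k :: int where k: "qcis t = qcis (2 * pi * of_int k / of_nat (2 * n))" by (auto simp: Zc_def)
  have "qRe g = qRe (cj c g)" using c(1) by simp
  also have "\<dots> = cos (pi * of_int k / of_nat n)" unfolding c(2) k by simp
  finally show ?thesis using that n(1) h by blast
qed

text \<open>
The bound forces \<open>n < 6\<close> on every axis, which leaves the angles of the polyhedral groups. The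
recorded lower bounds on \<open>x\<close> say that a family of angles occurs only if the generator of its axis
respects the bound.
\<close>

lemma possible_real_parts:
  assumes G: "subgroup G SU2" "finite G" "-1 \<in> G" and g: "g \<in> G"
    and bound: "\<And>h. h \<in> G \<Longrightarrow> h \<noteq> 1 \<Longrightarrow> qRe h \<le> x" and x: "x < sqrt 3 / 2"
  shows "qRe g \<in> {0, 1, -1} \<or> (qRe g \<in> {1/2, -1/2} \<and> 1/2 \<le> x) \<or>
    (qRe g \<in> {sqrt 2 / 2, - sqrt 2 / 2} \<and> sqrt 2 / 2 \<le> x) \<or>
    (qRe g \<in> {golden / 2, - golden / 2, (golden - 1) / 2, (1 - golden) / 2} \<and> golden / 2 \<le> x)"
proof -
  obtain n k h where n: "n > 0" and gk: "qRe g = cos (pi * of_int k / of_nat n)"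
    and h: "h \<in> G" "h \<noteq> 1" "qRe h = cos (pi / of_nat n)" using element_angle[OF G g] by metis
  have le: "cos (pi / of_nat n) \<le> x" using bound h by metis
  have "n < 6"
  proof (rule ccontr)
    assume "\<not> n < 6"
    then have "pi / of_nat n \<le> pi / 6" by (intro divide_left_mono) auto
    then have "cos (pi / 6) \<le> cos (pi / of_nat n)" by (intro cos_monotone_0_pi_le) auto
    then show False using le x by (simp add: cos_30)
  qed
  define t where "t = pi * of_int k / of_nat n"
  have s: "sin (of_nat n * t) = 0" using n by (simp add: t_def sin_zero_iff_int2 mult.commute)
  have gt: "qRe g = cos t" by (simp add: gk t_def)
  consider "n = 1" | "n = 2" | "n = 3" | "n = 4" | "n = 5" using n \<open>n < 6\<close> by linarith
  then show ?thesis
  proof cases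
    case 1
    then have "sin t = 0" using s by simp
    then show ?thesis using cos_cases_4[of t] by (auto simp: gt sin_double)
  next
    case 2
    then show ?thesis using cos_cases_4[of t] s by (auto simp: gt)
  next
    case 3
    then show ?thesis using cos_cases_6[of t] s le by (auto simp: gt cos_60)
  next
    case 4
    then show ?thesis using cos_cases_8[of t] s le by (auto simp: gt cos_45)
  next
    case 5
    then show ?thesis using cos_cases_10[of t] s le by (auto simp: gt cos_pi_5)
  qed
qed

lemma parallel_if_cross_zero:
  fixes v1 v2 v3 w1 w2 w3 :: real
  assumes "v2 * w3 = v3 * w2" "v3 * w1 = v1 * w3" "v1 * w2 = v2 * w1"
    and n: "v1\<^sup>2 + v2\<^sup>2 + v3\<^sup>2 = w1\<^sup>2 + w2\<^sup>2 + w3\<^sup>2"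
  shows "(w1 = v1 \<and> w2 = v2 \<and> w3 = v3) \<or> (w1 = -v1 \<and> w2 = -v2 \<and> w3 = -v3)"
proof -
  define N where "N = v1\<^sup>2 + v2\<^sup>2 + v3\<^sup>2"
  define d where "d = v1 * w1 + v2 * w2 + v3 * w3"
  have "d\<^sup>2 + ((v2 * w3 - v3 * w2)\<^sup>2 + (v3 * w1 - v1 * w3)\<^sup>2 + (v1 * w2 - v2 * w1)\<^sup>2)
      = N * (w1\<^sup>2 + w2\<^sup>2 + w3\<^sup>2)"
    by (simp add: d_def N_def power2_eq_square algebra_simps)
  then have "d\<^sup>2 = N\<^sup>2" using assms(1-3) n by (simp add: N_def power2_eq_square)
  then have "d = N \<or> d = - N" by (simp add: power2_eq_iff)
  then show ?thesis
  proof
    assume "d = N"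
    have "(w1 - v1)\<^sup>2 + (w2 - v2)\<^sup>2 + (w3 - v3)\<^sup>2 = (w1\<^sup>2 + w2\<^sup>2 + w3\<^sup>2) + N - 2 * d"
      by (simp add: d_def N_def power2_eq_square algebra_simps)
    then have "(w1 - v1)\<^sup>2 + (w2 - v2)\<^sup>2 + (w3 - v3)\<^sup>2 = 0" using n \<open>d = N\<close> N_def by simp
    then have "w1 - v1 = 0 \<and> w2 - v2 = 0 \<and> w3 - v3 = 0"
      by (smt (verit) zero_le_power2 zero_less_power2)
    then show ?thesis by auto
  next
    assume "d = - N"
    have "(w1 + v1)\<^sup>2 + (w2 + v2)\<^sup>2 + (w3 + v3)\<^sup>2 = (w1\<^sup>2 + w2\<^sup>2 + w3\<^sup>2) + N + 2 * d"
      by (simp add: d_def N_def power2_eq_square algebra_simps)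
    then have "(w1 + v1)\<^sup>2 + (w2 + v2)\<^sup>2 + (w3 + v3)\<^sup>2 = 0" using n \<open>d = - N\<close> N_def by simp
    then have "w1 + v1 = 0 \<and> w2 + v2 = 0 \<and> w3 + v3 = 0"
      by (smt (verit) zero_le_power2 zero_less_power2)
    then show ?thesis by auto
  qed
qed

text \<open>
Commuting non-central unit quaternions have parallel vector parts; for conjugate ones these have equal length,
so they agree up to sign.
\<close>

lemma commuting_conj_axis:
  assumes p: "p \<in> U" "\<bar>qRe p\<bar> < 1" and h: "h \<in> U" and comm: "cj h p * p = p * cj h p"
  defines "P \<equiv> Quat 0 (qI p) (qJ p) (qK p)"
  shows "h * P = P * h \<or> h * P = - (P * h)" "qRe P = 0" "P \<noteq> 0"
proof -
  define p' where "p' = cj h p"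
  have p': "p' \<in> U" "qRe p' = qRe p" using p h by (simp_all add: p'_def)
  have "p' * p = p * p'" using comm by (simp add: p'_def)
  then have "qJ p * qK p' = qK p * qJ p'" "qK p * qI p' = qI p * qK p'" "qI p * qJ p' = qJ p * qI p'"
    by (auto simp: quat_eq_iff component_mult algebra_simps)
  moreover have "(qI p)\<^sup>2 + (qJ p)\<^sup>2 + (qK p)\<^sup>2 = (qI p')\<^sup>2 + (qJ p')\<^sup>2 + (qK p')\<^sup>2"
    using p p' by (simp add: U_iff)
  ultimately have *: "(qI p' = qI p \<and> qJ p' = qJ p \<and> qK p' = qK p) \<or> (qI p' = - qI p \<and> qJ p' = - qJ p \<and> qK p' = - qK p)"
    by (rule parallel_if_cross_zero)
  have pP: "p = P + Quat (qRe p) 0 0 0" by (simp add: P_def quat_eq_iff)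
  have "p' = cj h P + Quat (qRe p) 0 0 0"
  proof -
    have "cj h (Quat (qRe p) 0 0 0) = Quat (qRe p) 0 0 0 * cj h 1"
    proof -
      have "h * Quat (qRe p) 0 0 0 = Quat (qRe p) 0 0 0 * h" by (simp add: quat_eq_iff component_mult)
      then show ?thesis by (simp add: cj_def mult.assoc)
    qed
    then have "cj h (Quat (qRe p) 0 0 0) = Quat (qRe p) 0 0 0" using h by simp
    moreover have "p' = cj h P + cj h (Quat (qRe p) 0 0 0)"
      unfolding p'_def by (subst pP) (simp add: cj_def distrib_left distrib_right)
    ultimately show ?thesis by simp
  qed
  then have c: "cj h P = p' - Quat (qRe p) 0 0 0" by simp
  have "p' - Quat (qRe p) 0 0 0 = P \<or> p' - Quat (qRe p) 0 0 0 = - P"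
    using * p' unfolding P_def by (elim disjE) (simp_all add: quat_eq_iff)
  then have "cj h P = P \<or> cj h P = - P" by (simp only: c)
  moreover have hP: "h * P = cj h P * h" using h by (simp add: cj_def mult.assoc)
  ultimately show "h * P = P * h \<or> h * P = - (P * h)" by auto
  show "qRe P = 0" by (simp add: P_def)
  show "P \<noteq> 0"
  proof
    assume "P = 0"
    then have "(qRe p)\<^sup>2 = 1" using p by (simp add: P_def quat_eq_iff U_iff)
    then show False using p(2) by (simp add: power2_eq_1_iff) auto
  qed
qed

lemma preserves_axis_if_conjugates_commute:
  assumes G: "G \<subseteq> U" and p: "p \<in> U" "\<bar>qRe p\<bar> < 1"
    and comm: "\<And>h. h \<in> G \<Longrightarrow> cj h p * p = p * cj h p"
  shows "preserves_axis G"
proof -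
  define P where "P = Quat 0 (qI p) (qJ p) (qK p)"
  note ax = commuting_conj_axis[OF p, folded P_def]
  have "qRe P = 0" "P \<noteq> 0" using ax(2,3)[of 1] by simp_all
  moreover have "h * P = P * h \<or> h * P = - (P * h)" if "h \<in> G" for h
    using ax(1)[of h] comm[OF that] G that by blast
  ultimately show ?thesis unfolding preserves_axis_def by blast
qed

text \<open>
The real part of the commutator is \<open>1 - 2 |v \<times> w|\<^sup>2\<close> for the vector parts
\<open>v\<close>, \<open>w\<close>, and \<open>|v \<times> w| \<le> 1 - x\<^sup>2\<close>. The threshold comes
from \<open>2 (1 - x) (1 + x)\<^sup>2 < 1\<close>, which holds for \<open>x \<ge> cos 30\<degree>\<close>.
\<close>

lemma commutator_Re:
  assumes p: "p \<in> U" "q \<in> U" "qRe q = qRe p" and x: "sqrt 3 / 2 \<le> qRe p" "qRe p < 1"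
  shows "qRe (p * q * qcnj p * qcnj q) > qRe p"
proof -
  define x where "x = qRe p"
  define d where "d = qI p * qI q + qJ p * qJ q + qK p * qK q"
  define A where "A = (qI p)\<^sup>2 + (qJ p)\<^sup>2 + (qK p)\<^sup>2"
  define B where "B = (qI q)\<^sup>2 + (qJ q)\<^sup>2 + (qK q)\<^sup>2"
  have "qRe (p * q * qcnj p * qcnj q) = (x\<^sup>2 + A) * ((qRe q)\<^sup>2 + B) - 2 * (A * B - d\<^sup>2)"
    by (simp add: component_mult x_def A_def B_def d_def power2_eq_square algebra_simps)
  moreover have A: "A = 1 - x\<^sup>2" and B: "B = 1 - x\<^sup>2" using p by (simp_all add: U_iff A_def B_def x_def)
  ultimately have "qRe (p * q * qcnj p * qcnj q) = 1 - 2 * (1 - x\<^sup>2)\<^sup>2 + 2 * d\<^sup>2"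
    using p(3) by (simp add: x_def power2_eq_square algebra_simps)
  moreover have "2 * (1 - x\<^sup>2)\<^sup>2 < 1 - x"
  proof -
    have "(sqrt 3 / 2)\<^sup>2 \<le> x\<^sup>2" using x by (intro power_mono) (simp_all add: x_def)
    then have 1: "1 - x\<^sup>2 \<le> 1 / 4" by (simp add: power_divide)
    have x0: "0 \<le> x" using x(1) x_def by (smt (verit) real_sqrt_ge_zero divide_nonneg_nonneg)
    have "(1 - x\<^sup>2) * (1 + x) \<le> 1/4 * (1 + x)" using 1 x0 by (intro mult_right_mono) auto
    also have "\<dots> < 1 / 2" using x(2) by (simp add: x_def)
    finally have "2 * (1 - x) * ((1 - x\<^sup>2) * (1 + x)) < 2 * (1 - x) * (1/2)"
      using x(2) by (intro mult_strict_left_mono) (simp_all add: x_def)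
    then show ?thesis by (simp add: power2_eq_square algebra_simps)
  qed
  moreover have "d\<^sup>2 \<ge> 0" by simp
  ultimately show ?thesis unfolding x_def[symmetric] by linarith
qed

text \<open>
A commutator closer to the identity than the element of largest real part can only be the identity.
\<close>

lemma small_rotation_preserves_axis:
  assumes G: "subgroup G SU2" and p: "p \<in> G" "sqrt 3 / 2 \<le> qRe p" "p \<noteq> 1"
    and max: "\<And>h. h \<in> G \<Longrightarrow> h \<noteq> 1 \<Longrightarrow> qRe h \<le> qRe p"
  shows "preserves_axis G"
proof -
  have pU: "p \<in> U" using p subgroupD[OF G] by blast
  then have p1: "qRe p < 1" using p(3) U_Re_le[of p] U_Re_one[of p] by auto
  have s: "sqrt 3 / 2 > 0" by simp
  show ?thesis
  proof (rule preserves_axis_if_conjugates_commute[of G p])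
    show "\<bar>qRe p\<bar> < 1" using p1 p(2) s by linarith
    fix h assume h: "h \<in> G"
    define q where "q = cj h p"
    have qG: "q \<in> G" unfolding q_def cj_def by (intro subgroupD(3,4)[OF G] h p)
    have hU: "h \<in> U" and qU: "q \<in> U" using h qG subgroupD[OF G] by blast+
    have "qRe (p * q * qcnj p * qcnj q) > qRe p"
      using commutator_Re[OF pU qU] hU p p1 by (simp add: q_def)
    moreover have "p * q * qcnj p * qcnj q \<in> G" by (intro subgroupD(3,4)[OF G] qG p)
    ultimately have "p * q * qcnj p * qcnj q = 1" using max by fastforce
    then have "p * q * qcnj p * qcnj q * (q * p) = q * p" by simp
    then have "p * q = q * p" using pU qU by (simp add: mult.assoc)
    then show "cj h p * p = p * cj h p" by (simp add: q_def)
  qed (use G pU subgroupD in auto)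
qed

section \<open>Groups containing the binary tetrahedral group\<close>

lemma binD2_explicit: "binD 2 = {1, -1, Quat 0 1 0 0, Quat 0 (-1) 0 0,
   Quat 0 0 1 0, Quat 0 0 (-1) 0, Quat 0 0 0 1, Quat 0 0 0 (-1)}"
proof -
  have 4: "{..<4} = {0, 1, 2, 3::nat}" by auto
  have i: "qcis (pi / 2) = Quat 0 1 0 0" by (simp add: qcis_def)
  have "qcis (2 * pi * real x / real 4) = Quat 0 1 0 0 ^ x" for x
    unfolding i[symmetric] qcis_power by (simp add: algebra_simps)
  then have "Zc 4 = {1, -1, Quat 0 1 0 0, Quat 0 (-1) 0 0}"
    unfolding Zc_image[OF zero_less_numeral] 4
    by (auto simp: power2_eq_square power3_eq_cube) (auto simp: quat_arith)
  then show ?thesis unfolding binD_eq by (auto simp: quat_arith)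
qed

lemma binT_explicit: "binT = binD 2 \<union> {Quat a b c d | a b c d.
    a \<in> {1/2, -1/2} \<and> b \<in> {1/2, -1/2} \<and> c \<in> {1/2, -1/2} \<and> d \<in> {1/2, -1/2}}"
proof -
  have *: "a \<in> {1/2, -1/2} \<longleftrightarrow> (\<exists>a'. a = a' / 2 \<and> a' \<in> {1, -1})" for a :: real by auto
  show ?thesis unfolding binT_def * by blast
qed

abbreviation "omega \<equiv> Quat (1/2) (1/2) (1/2) (1/2)"

lemma Quat_in_binT_iff:
  "Quat a b c d \<in> binT \<longleftrightarrow> \<bar>a\<bar> = 1/2 \<and> \<bar>b\<bar> = 1/2 \<and> \<bar>c\<bar> = 1/2 \<and> \<bar>d\<bar> = 1/2 \<or>
    \<bar>a\<bar> = 1 \<and> b = 0 \<and> c = 0 \<and> d = 0 \<or> a = 0 \<and> \<bar>b\<bar> = 1 \<and> c = 0 \<and> d = 0 \<or>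
    a = 0 \<and> b = 0 \<and> \<bar>c\<bar> = 1 \<and> d = 0 \<or> a = 0 \<and> b = 0 \<and> c = 0 \<and> \<bar>d\<bar> = 1"
proof -
  have *: "\<bar>x\<bar> * 2 = 1 \<longleftrightarrow> x * 2 = 1 \<or> x = - (1/2)" "\<bar>x\<bar> = 1 \<longleftrightarrow> x = 1 \<or> x = -1" for x :: real by auto
  show ?thesis unfolding binT_explicit binD2_explicit one_quat_def uminus_quat_def by (simp add: *) argo
qed

lemma qcnj_binT: "x \<in> binT \<Longrightarrow> qcnj x \<in> binT" and minus_binT: "x \<in> binT \<Longrightarrow> - x \<in> binT"
  by (cases x; simp add: qcnj_def uminus_quat_def Quat_in_binT_iff)+

lemma binT_half_eq:
  assumes "a \<in> {1/2, -1/2}" "b \<in> {1/2, -1/2}" "c \<in> {1/2, -1/2}" "d \<in> {1/2, -1/2}"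
  shows "\<exists>y \<in> binD 2. Quat a b c d = y * omega \<or> Quat a b c d = y * qcnj omega"
proof -
  have "Quat a b c d * qcnj omega \<in> binD 2 \<or> Quat a b c d * omega \<in> binD 2"
    using assms unfolding binD2_explicit by (elim insertE emptyE; simp add: quat_arith)
  moreover have "x = x * qcnj omega * omega" "x = x * omega * qcnj omega" for x
  proof -
    have "omega \<in> U" by (simp add: U_iff power2_eq_square)
    then show "x = x * qcnj omega * omega" "x = x * omega * qcnj omega" by (simp_all add: mult.assoc)
  qed
  ultimately show ?thesis by metis
qed

lemma binT_generated:
  assumes G: "subgroup G SU2" and "Quat 0 1 0 0 \<in> G" "Quat 0 0 1 0 \<in> G" "omega \<in> G"
  shows "binT \<subseteq> G"
proof -
  have i: "Quat 0 1 0 0 \<in> G" "Quat 0 0 1 0 \<in> G" by fact+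
  have "Quat 0 1 0 0 * Quat 0 0 1 0 \<in> G" "Quat 0 1 0 0 * Quat 0 1 0 0 \<in> G"
    "qcnj (Quat 0 1 0 0) \<in> G" "qcnj (Quat 0 0 1 0) \<in> G" by (intro subgroupD(3,4)[OF G] i)+
  then have k: "Quat 0 0 0 1 \<in> G" "-1 \<in> G" "Quat 0 (-1) 0 0 \<in> G" "Quat 0 0 (-1) 0 \<in> G" by (simp_all add: quat_arith)
  then have "qcnj (Quat 0 0 0 1) \<in> G" by (intro subgroupD(4)[OF G])
  then have D: "binD 2 \<subseteq> G" using k i subgroupD(2)[OF G] unfolding binD2_explicit by (auto simp: quat_arith)
  have "qcnj omega \<in> G" by (intro subgroupD(4)[OF G] assms)
  have "Quat a b c d \<in> G" if "a \<in> {1/2, -1/2}" "b \<in> {1/2, -1/2}" "c \<in> {1/2, -1/2}" "d \<in> {1/2, -1/2}" for a b c d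
    using binT_half_eq[OF that] D assms(4) \<open>qcnj omega \<in> G\<close> subgroupD(3)[OF G] by (metis subsetD)
  then show ?thesis using D unfolding binT_explicit by blast
qed

lemma binT_cases:
  assumes "x \<in> binT"
  obtains "x \<in> binD 2" | a b c d where "x = Quat a b c d"
    "a \<in> {1/2, -1/2}" "b \<in> {1/2, -1/2}" "c \<in> {1/2, -1/2}" "d \<in> {1/2, -1/2}"
  using assms unfolding binT_explicit by blast

text \<open>
The points with two coordinates \<open>1/\<surd>2\<close> up to sign and two coordinates zero are the vertices
of the dual 24-cell; dividing by \<open>e\<^sup>i\<^sup>\<pi>\<^sup>/\<^sup>4\<close> maps them to the 24-cell
\<open>2T\<close>.
\<close>

lemma binT_from_D4_roots:
  assumes "a \<in> {0, 1, -1}" "b \<in> {0, 1, -1}" "c \<in> {0, 1, -1}" "d \<in> {0, 1, -1}" "a * a + b * b + c * c + d * d = 2"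
  shows "Quat ((a + b) / 2) ((b - a) / 2) ((c + d) / 2) ((d - c) / 2) \<in> binT"
  unfolding Quat_in_binT_iff using assms by (elim insertE emptyE; simp)

lemma qcis_pi_4: "qcis (pi / 4) = Quat (sqrt 2 / 2) (sqrt 2 / 2) 0 0"
  by (simp add: qcis_def cos_45 sin_45)

text \<open>
Covering argument for the 24-cell. Comparing \<open>g\<close> with all elements of \<open>2T\<close>, the
bound gives \<open>|g\<^sub>i| \<le> s\<close> and \<open>|g\<^sub>0| + \<dots> + |g\<^sub>3| \<le> 2s\<close>
with \<open>s = 1/\<surd>2\<close>. Since \<open>1 = \<Sum> g\<^sub>i\<^sup>2 \<le> s \<Sum> |g\<^sub>i| \<le>
2s\<^sup>2 = 1\<close>, equality holds throughout and every coordinate is \<open>0\<close> or \<open>s\<close>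
up to sign.
\<close>

lemma near_binT:
  assumes G: "subgroup G SU2" and T: "binT \<subseteq> G"
    and bound: "\<And>h. h \<in> G \<Longrightarrow> h \<noteq> 1 \<Longrightarrow> qRe h \<le> sqrt 2 / 2" and g: "g \<in> G" "g \<notin> binT"
  shows "qcis (- pi / 4) * g \<in> binT"
proof -
  define s where "s = sqrt 2 / 2"
  have s: "s * s = 1/2" "s > 0" by (simp_all add: s_def)
  have le: "qRe (qcnj t * g) \<le> s" if "t \<in> binT" for t
  proof -
    have "t \<in> G" using that T by blast
    then have "qcnj t * g \<in> G" "t \<in> U" using g subgroupD[OF G] by blast+
    moreover have "qcnj t * g \<noteq> 1"
    proof
      assume "qcnj t * g = 1"
      then have "t * (qcnj t * g) = t" by simp
      then show False using g that \<open>t \<in> U\<close> by simp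
    qed
    ultimately show ?thesis using bound unfolding s_def by blast
  qed
  obtain a b c d where gq: "g = Quat a b c d" by (cases g)
  have coord: "\<bar>a\<bar> \<le> s" "\<bar>b\<bar> \<le> s" "\<bar>c\<bar> \<le> s" "\<bar>d\<bar> \<le> s"
    using le[of 1] le[of "-1"] le[of "Quat 0 1 0 0"] le[of "Quat 0 (-1) 0 0"] le[of "Quat 0 0 1 0"]
      le[of "Quat 0 0 (-1) 0"] le[of "Quat 0 0 0 1"] le[of "Quat 0 0 0 (-1)"]
    unfolding gq by (simp_all add: binT_explicit binD2_explicit component_mult)
  have sgn: "\<exists>e \<in> {1/2, -1/2}. e * z = \<bar>z\<bar> / 2" for z :: real by (cases "z \<ge> 0") auto
  \<comment> \<open>The element of \<open>2T\<close> whose signs match those of \<open>g\<close> turns the bound into one on the sum of absolute values.\<close>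
  obtain e1 e2 e3 e4 where e: "e1 \<in> {1/2, -1/2}" "e1 * a = \<bar>a\<bar> / 2" "e2 \<in> {1/2, -1/2}" "e2 * b = \<bar>b\<bar> / 2"
    "e3 \<in> {1/2, -1/2}" "e3 * c = \<bar>c\<bar> / 2" "e4 \<in> {1/2, -1/2}" "e4 * d = \<bar>d\<bar> / 2"
    using sgn by meson
  have "Quat e1 e2 e3 e4 \<in> binT" using e unfolding binT_explicit by blast
  from le[OF this] have sum: "\<bar>a\<bar> + \<bar>b\<bar> + \<bar>c\<bar> + \<bar>d\<bar> \<le> 2 * s"
    using e by (simp add: gq component_mult)
  have norm: "a * a + b * b + c * c + d * d = 1"
    using subgroupD(5)[OF G g(1)] by (simp add: gq U_iff power2_eq_square)
  have nn: "0 \<le> \<bar>z\<bar> * (s - \<bar>z\<bar>)" if "\<bar>z\<bar> \<le> s" for z using that by simp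
  have ab: "\<bar>z\<bar> * (s - \<bar>z\<bar>) = s * \<bar>z\<bar> - z * z" for z by (simp add: algebra_simps)
  have "s * (\<bar>a\<bar> + \<bar>b\<bar> + \<bar>c\<bar> + \<bar>d\<bar>) \<le> s * (2 * s)" using sum s by (intro mult_left_mono) auto
  then have tot: "s * \<bar>a\<bar> + s * \<bar>b\<bar> + s * \<bar>c\<bar> + s * \<bar>d\<bar> \<le> 1" using s by (simp add: algebra_simps)
  have z: "\<bar>a\<bar> * (s - \<bar>a\<bar>) = 0" "\<bar>b\<bar> * (s - \<bar>b\<bar>) = 0" "\<bar>c\<bar> * (s - \<bar>c\<bar>) = 0" "\<bar>d\<bar> * (s - \<bar>d\<bar>) = 0"
    using nn[OF coord(1)] nn[OF coord(2)] nn[OF coord(3)] nn[OF coord(4)] norm tot unfolding ab by linarith+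
  have "\<exists>y \<in> {0, 1, -1}. x = s * y" if "\<bar>x\<bar> * (s - \<bar>x\<bar>) = 0" for x
    using that by (auto simp: abs_if split: if_splits)
  then obtain a' b' c' d' where v: "a = s * a'" "b = s * b'" "c = s * c'" "d = s * d'"
    and v': "a' \<in> {0, 1, -1}" "b' \<in> {0, 1, -1}" "c' \<in> {0, 1, -1}" "d' \<in> {0, 1, -1}"
    using z by meson
  have ss: "s * (s * x) = x / 2" for x using s(1) by (simp add: mult.assoc[symmetric])
  have sq: "s * x * (s * x) = x * x / 2" for x using ss[of "x * x"] by (simp add: algebra_simps)
  have norm': "a' * a' + b' * b' + c' * c' + d' * d' = 2" using norm unfolding v sq by simp
  have "qcis (- pi / 4) * g = Quat (s * a + s * b) (s * b - s * a) (s * c + s * d) (s * d - s * c)"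
    unfolding gq by (simp add: qcis_def cos_45 sin_45 quat_eq_iff component_mult s_def algebra_simps)
  also have "\<dots> = Quat ((a' + b') / 2) ((b' - a') / 2) ((c' + d') / 2) ((d' - c') / 2)"
    unfolding v ss by (simp add: diff_divide_distrib add_divide_distrib)
  also have "\<dots> \<in> binT" by (rule binT_from_D4_roots[OF v' norm'])
  finally show ?thesis .
qed

text \<open>
By \<open>near_binT\<close> such a group is \<open>2T\<close> or consists of \<open>2T\<close> and the coset
of \<open>e\<^sup>i\<^sup>\<pi>\<^sup>/\<^sup>4\<close>.
\<close>

lemma contains_binT_ADE:
  assumes G: "subgroup G SU2" and T: "binT \<subseteq> G"
    and bound: "\<And>h. h \<in> G \<Longrightarrow> h \<noteq> 1 \<Longrightarrow> qRe h \<le> sqrt 2 / 2"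
  shows "ADE G"
proof (cases "G = binT")
  case False
  then obtain g where g: "g \<in> G" "g \<notin> binT" using T by blast
  define e where "e = qcis (pi / 4)"
  have ee: "qcis (- pi / 4) * (e * x) = x" "e * (qcis (- pi / 4) * x) = x" for x
    by (simp_all add: e_def mult.assoc[symmetric] qcis_add[symmetric])
  have "e \<in> G"
  proof -
    have t: "qcis (- pi / 4) * g \<in> binT" using near_binT[OF G T bound g] by simp
    then have "qcnj (qcis (- pi / 4) * g) \<in> G" using qcnj_binT T by blast
    then have "g * qcnj (qcis (- pi / 4) * g) \<in> G" using g subgroupD(3)[OF G] by blast
    moreover have "g * qcnj (qcis (- pi / 4) * g) = e"
    proof -
      have "g \<in> U" using g subgroupD(5)[OF G] by blast
      then show ?thesis by (simp add: qcnj_mult mult.assoc[symmetric] qcnj_qcis e_def)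
    qed
    ultimately show ?thesis by simp
  qed
  have "G = binO"
  proof
    show "binO \<subseteq> G" unfolding binO_def e_def[symmetric] using T \<open>e \<in> G\<close> subgroupD(3)[OF G] by blast
    show "G \<subseteq> binO"
    proof
      fix x assume x: "x \<in> G"
      show "x \<in> binO"
      proof (cases "x \<in> binT")
        case False
        then have "e * (qcis (- pi / 4) * x) \<in> binO"
          unfolding binO_def e_def[symmetric] using near_binT[OF G T bound x] by blast
        then show ?thesis by (simp only: ee)
      qed (simp add: binO_def)
    qed
  qed
  then show ?thesis by (simp add: ADE_def)
qed (simp add: ADE_def)

section \<open>The binary icosahedral group\<close>

lemma cj_power: "g \<in> U \<Longrightarrow> cj g (x ^ n) = cj g x ^ n"
  by (induction n) (simp_all add: cj_mult)

lemma conj_to_qcis_of_Re: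
  assumes "q \<in> U" "qRe q = cos t" "sin t \<ge> 0"
  obtains g where "g \<in> U" "cj g q = qcis t"
  using conj_if_Re_eq[of q "qcis t"] assms by auto

lemma pow5_of_Re:
  assumes "q \<in> U" "qRe q = cos (pi / 5)" shows "q ^ 5 = -1"
proof -
  have "sin (pi / 5) \<ge> 0" by (intro sin_ge_zero) auto
  then obtain g where g: "g \<in> U" "cj g q = qcis (pi / 5)" using conj_to_qcis_of_Re assms by metis
  then have "cj g (q ^ 5) = -1" by (simp add: cj_power qcis_power)
  also have "\<dots> = cj g (-1)" using g by simp
  finally show ?thesis using cj_inj[OF g(1)] by blast
qed

text \<open>
The centralizer of \<open>q\<close> in the group is the cyclic group of its axis, of order \<open>2n\<close>.
The bound gives \<open>n \<le> 5\<close>, and \<open>q\<close>, of order ten, gives \<open>5 | n\<close>.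
\<close>

lemma centralizer_order_10:
  assumes G: "subgroup G SU2" "finite G" "-1 \<in> G" and q: "q \<in> G" "qRe q = cos (pi / 5)"
    and bound: "\<And>h. h \<in> G \<Longrightarrow> h \<noteq> 1 \<Longrightarrow> qRe h \<le> cos (pi / 5)"
    and c: "c \<in> G" "c * q = q * c"
  shows "\<exists>n<10. c = q ^ n"
proof -
  have qU: "q \<in> U" using q subgroupD(5)[OF G(1)] by blast
  have s0: "sin (pi / 5) > 0" by (intro sin_gt_zero) auto
  then obtain g where g: "g \<in> U" "cj g q = qcis (pi / 5)" using conj_to_qcis_of_Re[OF qU q(2)] less_imp_le by metis
  obtain n h where n: "n > 0" "circle_part (cj g ` G) = Zc (2 * n)"
    and h: "h \<in> G" "h \<noteq> 1" "qRe h = cos (pi / of_nat n)"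
    using circle_part_generator[OF G g(1)] by metis
  have le: "cos (pi / of_nat n) \<le> cos (pi / 5)" using bound h by metis
  have n5: "n \<le> 5"
  proof (rule ccontr)
    assume "\<not> n \<le> 5"
    then have "pi / of_nat n < pi / 5" by (intro divide_strict_left_mono) auto
    then have "cos (pi / 5) < cos (pi / of_nat n)" by (intro cos_monotone_0_pi) auto
    then show False using le by simp
  qed
  have "qcis (pi / 5) \<in> cj g ` G" using q g(2) by (metis imageI)
  then have "qcis (pi / 5) \<in> circle_part (cj g ` G)" by (simp add: circle_part_def) (simp add: qcis_def)
  then have "qcis (pi / 5) \<in> Zc (2 * n)" by (simp only: n)
  then obtain x :: int where "qcis (pi / 5) = qcis (2 * pi * of_int x / of_nat (2 * n))" by (auto simp: Zc_def)
  moreover have "qcis (pi / 5) = qcis (2 * pi * of_int (int n) / of_nat (10 * n))"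
    "qcis (2 * pi * of_int x / of_nat (2 * n)) = qcis (2 * pi * of_int (5 * x) / of_nat (10 * n))" using n(1) by simp_all
  ultimately have "qcis (2 * pi * of_int (int n) / of_nat (10 * n)) = qcis (2 * pi * of_int (5 * x) / of_nat (10 * n))"
    by metis
  moreover have "10 * n > 0" using n(1) by simp
  ultimately have "int (10 * n) dvd int n - 5 * x" using qcis_frac_eq_iff by blast
  then obtain w where "int n - 5 * x = int (10 * n) * w" by (auto elim: dvdE)
  then have "int n = 5 * (x + 2 * int n * w)" by simp
  then have "(5::int) dvd int n" by (metis dvd_triv_left)
  then have "n = 5" using n n5 by presburger
  have "cj g c * qcis (pi / 5) = qcis (pi / 5) * cj g c" using c(2) g by (metis cj_mult)
  then have "qJ (cj g c) = 0 \<and> qK (cj g c) = 0" using s0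
    by (simp add: quat_eq_iff component_mult) (simp add: qcis_def)
  then have "cj g c \<in> circle_part (cj g ` G)" using c(1) by (simp add: circle_part_def)
  then have "cj g c \<in> Zc 10" using n(2) \<open>n = 5\<close> by simp
  then obtain x where x: "x < 10" "cj g c = qcis (2 * pi * real x / real 10)"
    unfolding Zc_image[OF zero_less_numeral] by blast
  have "qcis (2 * pi * real x / real 10) = qcis (pi / 5) ^ x" by (simp add: qcis_power algebra_simps)
  then have "cj g c = cj g (q ^ x)" using x(2) g by (simp add: cj_power)
  then have "c = q ^ x" using cj_inj[OF g(1)] by blast
  then show ?thesis using x(1) by blast
qed

text \<open>
The inverse of the golden ratio. With \<open>psi_sq\<close> as a rewrite rule, icosahedral coordinates have a
normal form \<open>x + y psi\<close>.
\<close>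

definition psi :: real where "psi = golden - 1"
lemma psi_sq: "psi * psi = 1 - psi"
  using golden_sq by (simp add: psi_def algebra_simps)
lemma golden_psi: "golden = 1 + psi" by (simp add: psi_def)
lemma psi_sq': "psi * (psi * x) = x - psi * x"
  using psi_sq by (simp add: mult.assoc[symmetric] left_diff_distrib)
lemma psi_bounds: "0.618 < psi" "psi < 0.619" using golden_bounds by (simp_all add: psi_def)

lemma icos_q_psi: "icos_q = Quat ((1 + psi) / 2) (psi / 2) (1/2) 0"
  by (simp add: icos_q_def inverse_golden psi_def)

text \<open>
The elements of real part \<open>cos 36\<degree>\<close> in the binary icosahedral group; their vector parts
are the twelve vertices of an icosahedron.
\<close>

definition vertices :: "quat set" where
  "vertices = {Quat ((1 + psi) / 2) a b c | a b c.
     \<bar>a\<bar> = psi / 2 \<and> \<bar>b\<bar> = 1 / 2 \<and> c = 0 \<or> a = 0 \<and> \<bar>b\<bar> = psi / 2 \<and> \<bar>c\<bar> = 1 / 2 \<or>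
     \<bar>a\<bar> = 1 / 2 \<and> b = 0 \<and> \<bar>c\<bar> = psi / 2}"

lemma Quat_in_vertices_iff:
  "Quat ((1 + psi) / 2) a b c \<in> vertices \<longleftrightarrow>
     \<bar>a\<bar> = psi / 2 \<and> \<bar>b\<bar> = 1 / 2 \<and> c = 0 \<or> a = 0 \<and> \<bar>b\<bar> = psi / 2 \<and> \<bar>c\<bar> = 1 / 2 \<or>
     \<bar>a\<bar> = 1 / 2 \<and> b = 0 \<and> \<bar>c\<bar> = psi / 2"
  unfolding vertices_def mem_Collect_eq quat.inject by blast

lemma cj_rot:
  "cj omega (Quat r x y z) = Quat r z x y" "cj (qcnj omega) (Quat r x y z) = Quat r y z x"
  by (simp_all add: cj_def quat_arith algebra_simps)

lemma cj_flip:
  "cj (Quat 0 1 0 0) (Quat r x y z) = Quat r x (- y) (- z)"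
  "cj (Quat 0 0 1 0) (Quat r x y z) = Quat r (- x) y (- z)"
  "cj (Quat 0 0 0 1) (Quat r x y z) = Quat r (- x) (- y) z"
  by (simp_all add: cj_def quat_arith)

text \<open>
The tetrahedral rotations act simply transitively on the twelve vertices: the quaternion units change signs
and \<open>omega\<close> permutes the coordinates cyclically.
\<close>

lemma vertices_orbit:
  assumes "v \<in> vertices" shows "\<exists>x\<in>binT. cj x icos_q = v"
proof -
  obtain a b c where v: "v = Quat ((1 + psi) / 2) a b c" and abc:
    "\<bar>a\<bar> = psi / 2 \<and> \<bar>b\<bar> = 1 / 2 \<and> c = 0 \<or> a = 0 \<and> \<bar>b\<bar> = psi / 2 \<and> \<bar>c\<bar> = 1 / 2 \<or>
     \<bar>a\<bar> = 1 / 2 \<and> b = 0 \<and> \<bar>c\<bar> = psi / 2" using assms unfolding vertices_def by blast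
  have flip: "\<exists>y\<in>{1, Quat 0 1 0 0, Quat 0 0 1 0, Quat 0 0 0 1}. cj y icos_q = Quat ((1 + psi) / 2) x z 0"
    if "\<bar>x\<bar> = psi / 2" "\<bar>z\<bar> = 1 / 2" for x z
  proof -
    have "x = psi / 2 \<or> x = - psi / 2" "z = 1/2 \<or> z = -1/2" using that by (auto simp: abs_if split: if_splits)
    then show ?thesis unfolding icos_q_psi by (auto simp: cj_flip)
  qed
  have T: "y \<in> binT \<and> omega * y \<in> binT \<and> qcnj omega * y \<in> binT"
    if "y \<in> {1, Quat 0 1 0 0, Quat 0 0 1 0, Quat 0 0 0 1}" for y
    using that by (elim insertE emptyE) (simp_all add: quat_arith Quat_in_binT_iff)
  from abc show ?thesis
  proof (elim disjE conjE)
    assume "\<bar>a\<bar> = psi / 2" "\<bar>b\<bar> = 1 / 2" "c = 0"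
    with flip[of a b] T show ?thesis unfolding v by metis
  next
    assume "a = 0" "\<bar>b\<bar> = psi / 2" "\<bar>c\<bar> = 1 / 2"
    with flip[of b c] obtain y where y: "y \<in> {1, Quat 0 1 0 0, Quat 0 0 1 0, Quat 0 0 0 1}"
      "cj y icos_q = Quat ((1 + psi) / 2) b c 0" by blast
    have "cj (omega * y) icos_q = v" unfolding cj_cj[symmetric] y(2) v \<open>a = 0\<close> cj_rot ..
    then show ?thesis using T[OF y(1)] by blast
  next
    assume "\<bar>a\<bar> = 1 / 2" "b = 0" "\<bar>c\<bar> = psi / 2"
    with flip[of c a] obtain y where y: "y \<in> {1, Quat 0 1 0 0, Quat 0 0 1 0, Quat 0 0 0 1}"
      "cj y icos_q = Quat ((1 + psi) / 2) c a 0" by blast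
    have "cj (qcnj omega * y) icos_q = v" unfolding cj_cj[symmetric] y(2) v \<open>b = 0\<close> cj_rot ..
    then show ?thesis using T[OF y(1)] by blast
  qed
qed

text \<open>
The twelve vertices form a tight frame: the squares of the inner products of a vector with them sum to a
multiple of its squared length. If all inner products were small, this sum would be too small.
\<close>

lemma frame_inequality:
  assumes v: "v \<in> U" "qRe v = (1 + psi) / 2"
  shows "\<exists>w\<in>vertices. qRe (v * qcnj w) > (1 + psi) / 2"
proof (rule ccontr)
  assume "\<not> ?thesis"
  then have le: "qRe (v * qcnj w) \<le> (1 + psi) / 2" if "w \<in> vertices" for w using that by force
  obtain a b c where vq: "v = Quat ((1 + psi) / 2) a b c" using v(2) by (cases v) auto
  have dot: "a * x + b * y + c * z \<le> psi / 4" if "Quat ((1 + psi) / 2) x y z \<in> vertices" for x y z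
    using le[OF that] by (simp add: vq component_mult psi_sq field_simps)
  have sq: "(psi * x + y)\<^sup>2 \<le> (psi / 2)\<^sup>2"
    if "psi * x + y \<le> psi / 2" "- (psi * x + y) \<le> psi / 2" for x y
  proof -
    have "\<bar>psi * x + y\<bar> \<le> \<bar>psi / 2\<bar>" using that by linarith
    then show ?thesis by (simp only: abs_le_square_iff)
  qed
  have p0: "\<bar>psi\<bar> = psi" using psi_bounds by simp
  have 1: "(psi * a + b)\<^sup>2 \<le> (psi / 2)\<^sup>2"
    using dot[of "psi/2" "1/2" 0] dot[of "-psi/2" "-1/2" 0] by (intro sq) (simp_all add: Quat_in_vertices_iff p0 field_simps)
  have 2: "(psi * a + (- b))\<^sup>2 \<le> (psi / 2)\<^sup>2"
    using dot[of "psi/2" "-1/2" 0] dot[of "-psi/2" "1/2" 0] by (intro sq) (simp_all add: Quat_in_vertices_iff p0 field_simps)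
  have 3: "(psi * b + c)\<^sup>2 \<le> (psi / 2)\<^sup>2"
    using dot[of 0 "psi/2" "1/2"] dot[of 0 "-psi/2" "-1/2"] by (intro sq) (simp_all add: Quat_in_vertices_iff p0 field_simps)
  have 4: "(psi * b + (- c))\<^sup>2 \<le> (psi / 2)\<^sup>2"
    using dot[of 0 "psi/2" "-1/2"] dot[of 0 "-psi/2" "1/2"] by (intro sq) (simp_all add: Quat_in_vertices_iff p0 field_simps)
  have 5: "(psi * c + a)\<^sup>2 \<le> (psi / 2)\<^sup>2"
    using dot[of "1/2" 0 "psi/2"] dot[of "-1/2" 0 "-psi/2"] by (intro sq) (simp_all add: Quat_in_vertices_iff p0 field_simps)
  have 6: "(psi * c + (- a))\<^sup>2 \<le> (psi / 2)\<^sup>2"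
    using dot[of "-1/2" 0 "psi/2"] dot[of "1/2" 0 "-psi/2"] by (intro sq) (simp_all add: Quat_in_vertices_iff p0 field_simps)
  have "2 * (psi * psi + 1) * (a\<^sup>2 + b\<^sup>2 + c\<^sup>2) \<le> 6 * (psi / 2)\<^sup>2"
    using 1 2 3 4 5 6 by (simp add: power2_eq_square algebra_simps)
  moreover have "a\<^sup>2 + b\<^sup>2 + c\<^sup>2 = 1 - ((1 + psi) / 2)\<^sup>2" using v(1) by (simp add: vq U_iff)
  then have n: "a\<^sup>2 + b\<^sup>2 + c\<^sup>2 = (2 - psi) / 4"
    by (simp add: power2_eq_square algebra_simps psi_sq add_divide_distrib diff_divide_distrib)
  ultimately have "2 * (2 - psi) * ((2 - psi) / 4) \<le> 6 * ((1 - psi) / 4)"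
    unfolding n by (simp add: power2_eq_square psi_sq)
  then have "(2 - psi) * (2 - psi) \<le> 3 * (1 - psi)" by (simp add: field_simps)
  then show False using psi_sq psi_bounds by (simp add: algebra_simps)
qed

lemma cos_pi_5_psi: "cos (pi / 5) = (1 + psi) / 2" by (simp add: cos_pi_5 psi_def)

text \<open>
For \<open>g\<close> in the group, \<open>g q g\<^sup>-\<^sup>1\<close> lies within \<open>36\<degree>\<close>
of one of the twelve vertices, hence equals it by the bound. It is therefore conjugate to \<open>q\<close> by
some \<open>x \<in> 2T\<close>, and \<open>x\<^sup>-\<^sup>1 g\<close> is a power of \<open>q\<close>. Applied
to inverses this is the description of \<open>2I\<close> by the cosets \<open>q\<^sup>s 2T\<close>.
\<close>

lemma icos_group_eq:
  assumes G: "subgroup G SU2" "finite G" and T: "binT \<subseteq> G" and q: "icos_q \<in> G"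
    and bound: "\<And>h. h \<in> G \<Longrightarrow> h \<noteq> 1 \<Longrightarrow> qRe h \<le> (1 + psi) / 2"
  shows "G = binI"
proof
  have m1: "-1 \<in> binT" by (simp add: binT_explicit binD2_explicit)
  show "binI \<subseteq> G"
    unfolding binI_def using subgroup_power[OF G(1) q] T subgroupD(3)[OF G(1)] by blast
  show "G \<subseteq> binI"
  proof
    fix h assume h: "h \<in> G"
    define g where "g = qcnj h"
    have g: "g \<in> G" "g \<in> U" using h subgroupD[OF G(1)] by (auto simp: g_def)
    define v where "v = cj g icos_q"
    have qU: "icos_q \<in> U" and qR: "qRe icos_q = (1 + psi) / 2" using q subgroupD(5)[OF G(1)] by (auto simp: icos_q_psi)
    have v: "v \<in> U" "qRe v = (1 + psi) / 2" using g qU qR by (simp_all add: v_def)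
    obtain w where w: "w \<in> vertices" "qRe (v * qcnj w) > (1 + psi) / 2" using frame_inequality[OF v] by blast
    obtain x where x: "x \<in> binT" "cj x icos_q = w" using vertices_orbit[OF w(1)] by blast
    have xG: "x \<in> G" "x \<in> U" using x T subgroupD(5)[OF G(1)] by auto
    have "v \<in> G" unfolding v_def cj_def by (intro subgroupD(3,4)[OF G(1)] g q)
    moreover have wG: "w \<in> G" unfolding x(2)[symmetric] cj_def by (intro subgroupD(3,4)[OF G(1)] xG q)
    ultimately have "v * qcnj w \<in> G" by (intro subgroupD(3,4)[OF G(1)])
    then have one: "v * qcnj w = 1" using bound w(2) by fastforce
    have "v = v * qcnj w * w" using wG subgroupD(5)[OF G(1)] by (simp add: mult.assoc)
    then have "v = w" by (simp add: one)
    then have "cj (qcnj x * g) icos_q = icos_q" using x xG unfolding v_def by (metis cj_cj cj_inv(1))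
    then have comm: "qcnj x * g * icos_q = icos_q * (qcnj x * g)"
      using xG g by (metis U_mult U_qcnj cj_def mult.assoc mult.right_neutral qcnj_left)
    have "qcnj x * g \<in> G" by (intro subgroupD(3,4)[OF G(1)] xG g)
    then obtain n where n: "n < 10" "qcnj x * g = icos_q ^ n"
      using centralizer_order_10[OF G _ q] m1 T comm qR bound unfolding cos_pi_5_psi by blast
    have q5: "icos_q ^ 5 = -1" using pow5_of_Re[OF qU] qR by (simp add: cos_pi_5_psi)
    have "icos_q ^ (10 - n) * icos_q ^ n = icos_q ^ (5 + 5)" using n(1) by (simp add: power_add[symmetric])
    then have q10: "icos_q ^ (10 - n) * icos_q ^ n = 1" unfolding power_add q5 by simp
    have "icos_q ^ n \<in> U" using subgroup_power[OF G(1) q] subgroupD(5)[OF G(1)] by blast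
    then have qc: "qcnj (icos_q ^ n) = icos_q ^ (10 - n)" using q10
      by (metis mult.assoc mult_1_left mult.right_neutral qcnj_right)
    have "h = qcnj g" by (simp add: g_def)
    also have "g = x * icos_q ^ n" using n(2) xG by (metis cancel_left(2))
    also have "qcnj (x * icos_q ^ n) = icos_q ^ (10 - n) * qcnj x" by (simp add: qcnj_mult qc)
    finally have h': "h = icos_q ^ (10 - n) * qcnj x" .
    \<comment> \<open>The definition of \<open>2I\<close> uses the exponents below five; \<open>q\<^sup>5 = -1\<close> is absorbed into \<open>2T\<close>.\<close>
    define s where "s = (10 - n) mod 5"
    have "icos_q ^ (10 - n) = icos_q ^ (5 * ((10 - n) div 5) + s)" by (simp add: s_def)
    also have "\<dots> = (-1) ^ ((10 - n) div 5) * icos_q ^ s" by (simp add: power_add power_mult q5)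
    finally have "icos_q ^ (10 - n) = icos_q ^ s \<or> icos_q ^ (10 - n) = - (icos_q ^ s)"
      using neg_one_even_power neg_one_odd_power by (metis mult_1_left mult_minus_left)
    then have "h = icos_q ^ s * qcnj x \<or> h = icos_q ^ s * (- qcnj x)" using h' by auto
    moreover have "qcnj x \<in> binT" "- qcnj x \<in> binT" using qcnj_binT[OF x(1)] minus_binT[OF qcnj_binT[OF x(1)]] by blast+
    moreover have "s \<in> {0..4}" by (auto simp: s_def)
    ultimately show "h \<in> binI" unfolding binI_def by blast
  qed
qed

section \<open>Classification of the finite subgroups of SU(2)\<close>

lemma Re_mult_add_qcnj: "qRe (p * q) + qRe (p * qcnj q) = 2 * qRe p * qRe q"
  by (simp add: component_mult)

text \<open>
The element \<open>q\<close> is a conjugate of \<open>p\<close> about a different axis. The sum of the real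
parts of \<open>p q\<close> and \<open>p q\<^sup>-\<^sup>1\<close> is known and both are at most \<open>qRe
p\<close>; with finitely many possible real parts this determines the angle between the two axes.
\<close>

lemma irreducible_pair:
  assumes G: "subgroup G SU2" and irr: "\<not> preserves_axis G" and p: "p \<in> G" "\<bar>qRe p\<bar> < 1"
    and max: "\<And>h. h \<in> G \<Longrightarrow> h \<noteq> 1 \<Longrightarrow> qRe h \<le> qRe p"
  obtains q where "q \<in> G" "qRe q = qRe p"
    "qRe (p * q) + qRe (p * qcnj q) = 2 * (qRe p)\<^sup>2" "qRe (p * q) \<le> qRe p" "qRe (p * qcnj q) \<le> qRe p"
proof -
  have pU: "p \<in> U" using p subgroupD(5)[OF G] by blast
  obtain h where h: "h \<in> G" "cj h p * p \<noteq> p * cj h p"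
    using preserves_axis_if_conjugates_commute[OF subgroupD(1)[OF G] pU p(2)] irr by blast
  define q where "q = cj h p"
  have hU: "h \<in> U" using h subgroupD(5)[OF G] by blast
  have q: "q \<in> G" unfolding q_def cj_def by (intro subgroupD(3,4)[OF G] h p)
  have qU: "q \<in> U" using q subgroupD(5)[OF G] by blast
  have R: "qRe q = qRe p" using hU by (simp add: q_def)
  have nc: "q * p \<noteq> p * q" using h(2) by (simp add: q_def)
  have "p * q \<noteq> 1"
  proof
    assume "p * q = 1"
    then have "qcnj p * (p * q) = qcnj p" by simp
    then have "q = qcnj p" using pU by simp
    then show False using nc pU by simp
  qed
  moreover have "p * qcnj q \<noteq> 1"
  proof
    assume "p * qcnj q = 1"
    then have "p * (qcnj q * q) = q" by (simp add: mult.assoc[symmetric])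
    then show False using nc qU by simp
  qed
  moreover have "p * q \<in> G" "p * qcnj q \<in> G" by (intro subgroupD(3,4)[OF G] p q)+
  ultimately have "qRe (p * q) \<le> qRe p" "qRe (p * qcnj q) \<le> qRe p" using max by blast+
  then show ?thesis using that q R Re_mult_add_qcnj[of p q] by (simp add: power2_eq_square)
qed

text \<open>
Pure elements of such a group commute or anticommute, so each of them spans a preserved axis.
\<close>

lemma pure_group_preserves_axis:
  assumes G: "subgroup G SU2" and R: "\<And>h. h \<in> G \<Longrightarrow> qRe h \<in> {0, 1, -1}"
  shows "preserves_axis G"
proof (cases "\<exists>u\<in>G. qRe u = 0")
  case True
  then obtain u where u: "u \<in> G" "qRe u = 0" by blast
  have uU: "u \<in> U" using u subgroupD(5)[OF G] by blast
  have "h * u = u * h \<or> h * u = - (u * h)" if h: "h \<in> G" for h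
  proof -
    have hU: "h \<in> U" using h subgroupD(5)[OF G] by blast
    have hu: "h * u \<in> G" by (intro subgroupD(3)[OF G] h u)
    consider "h = 1" | "h = -1" | "qRe h = 0" using R[OF h] U_Re_one[OF hU] U_Re_minus_one[OF hU] by auto
    then show ?thesis
    proof cases
      case 3
      consider "h * u = 1" | "h * u = -1" | "qRe (h * u) = 0"
        using R[OF hu] U_Re_one[of "h * u"] U_Re_minus_one[of "h * u"] hU uU by auto
      then show ?thesis
      proof cases
        case 1
        then have "h * (u * qcnj u) = qcnj u" by (simp add: mult.assoc[symmetric])
        then have "h = qcnj u" using uU by simp
        then show ?thesis using uU by simp
      next
        case 2
        then have "h * (u * qcnj u) = - qcnj u" by (simp add: mult.assoc[symmetric])
        then have "h = - qcnj u" using uU by simp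
        then show ?thesis using uU by simp
      next
        case c: 3
        then have "h * u = - (u * h)" using 3 u(2) by (simp add: quat_eq_iff component_mult algebra_simps)
        then show ?thesis by simp
      qed
    qed simp_all
  qed
  moreover have "u \<noteq> 0" using uU by (auto simp: U_iff)
  ultimately show ?thesis using u(2) unfolding preserves_axis_def by blast
next
  case False
  have "h * P = P * h" if h: "h \<in> G" for h P
  proof -
    have "h = 1 \<or> h = -1"
      using R[OF h] False h U_Re_one[of h] U_Re_minus_one[of h] subgroupD(5)[OF G h] by auto
    then show ?thesis by auto
  qed
  then show ?thesis unfolding preserves_axis_def
    by (intro exI[of _ quat_j]) (auto simp: quat_j_def zero_quat_def)
qed

lemma conj_group_bounded:
  assumes G: "subgroup G SU2" "finite G" and g: "g \<in> U"
    and bound: "\<And>h. h \<in> G \<Longrightarrow> h \<noteq> 1 \<Longrightarrow> qRe h \<le> x"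
  shows "subgroup (cj g ` G) SU2" "finite (cj g ` G)" "h \<in> cj g ` G \<Longrightarrow> h \<noteq> 1 \<Longrightarrow> qRe h \<le> x"
proof -
  show "subgroup (cj g ` G) SU2" "finite (cj g ` G)" using assms by (simp_all add: cj_subgroup)
  assume "h \<in> cj g ` G" "h \<noteq> 1"
  then obtain k where "k \<in> G" "h = cj g k" "k \<noteq> 1" using g by fastforce
  then show "qRe h \<le> x" using bound[of k] g by simp
qed

text \<open>
Two elements of order six whose product is pure can be moved to standard generators of \<open>2T\<close>;
their products in the two orders are \<open>i\<close> and \<open>j\<close>.
\<close>

lemma tetrahedral_ADE:
  assumes G: "subgroup G SU2" "finite G"
    and bound: "\<And>h. h \<in> G \<Longrightarrow> h \<noteq> 1 \<Longrightarrow> qRe h \<le> 1/2"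
    and p: "p \<in> G" "q \<in> G" "qRe p = 1/2" "qRe q = 1/2" "qRe (p * q) = 0"
  shows "\<exists>g\<in>U. ADE (cj g ` G) \<and> binT \<subseteq> cj g ` G"
proof -
  define a where "a = Quat (1/2) (1/2) (1/2) (1/2)"
  define b where "b = Quat (1/2) (1/2) (1/2) (-1/2)"
  have ab: "a \<in> U" "b \<in> U" "qRe (a * b) = 0" "qRe a = 1/2" "qRe b = 1/2"
    by (simp_all add: a_def b_def U_iff component_mult power2_eq_square)
  have pq: "p \<in> U" "q \<in> U" using p subgroupD(5)[OF G(1)] by blast+
  have p1: "\<bar>qRe p\<bar> < 1" by (simp add: p(3))
  obtain g where g: "g \<in> U" "cj g p = a" "cj g q = b"
    using simultaneous_conj[OF pq ab(1,2)] p ab p1 by metis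
  note H = conj_group_bounded[OF G g(1) bound]
  have in_H: "a \<in> cj g ` G" "b \<in> cj g ` G" using p g by blast+
  have "b * a \<in> cj g ` G" "a * b \<in> cj g ` G" using subgroupD(3)[OF H(1)] in_H by blast+
  then have "Quat 0 1 0 0 \<in> cj g ` G" "Quat 0 0 1 0 \<in> cj g ` G" by (simp_all add: a_def b_def times_quat_def)
  then have T: "binT \<subseteq> cj g ` G" using binT_generated H(1) in_H(1) by (simp add: a_def)
  have "1 / 2 \<le> sqrt 2 / 2" by simp
  then have "ADE (cj g ` G)" using contains_binT_ADE[OF H(1) T] H(3) by (meson order_trans)
  with T g show ?thesis by blast
qed

text \<open>
Two elements of order eight about orthogonal axes are moved to \<open>(1 + i)/\<surd>2\<close> and \<open>(1 +
j)/\<surd>2\<close>, with squares \<open>i\<close>, \<open>j\<close> and product \<open>omega\<close>.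
\<close>

lemma octahedral_ADE:
  assumes G: "subgroup G SU2" "finite G"
    and bound: "\<And>h. h \<in> G \<Longrightarrow> h \<noteq> 1 \<Longrightarrow> qRe h \<le> sqrt 2 / 2"
    and p: "p \<in> G" "q \<in> G" "qRe p = sqrt 2 / 2" "qRe q = sqrt 2 / 2" "qRe (p * q) = 1 / 2"
  shows "\<exists>g\<in>U. ADE (cj g ` G) \<and> binT \<subseteq> cj g ` G"
proof -
  define a where "a = Quat (sqrt 2 / 2) (sqrt 2 / 2) 0 0"
  define b where "b = Quat (sqrt 2 / 2) 0 (sqrt 2 / 2) 0"
  have ab: "a \<in> U" "b \<in> U" "qRe (a * b) = 1/2" "qRe a = sqrt 2 / 2" "qRe b = sqrt 2 / 2"
    by (simp_all add: a_def b_def U_iff component_mult power_divide)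
  have pq: "p \<in> U" "q \<in> U" using p subgroupD(5)[OF G(1)] by blast+
  have "sqrt 2 / 2 < 1" using real_sqrt_less_mono[of 2 4] by simp
  then have "\<bar>qRe p\<bar> < 1" by (simp add: p(3))
  then obtain g where g: "g \<in> U" "cj g p = a" "cj g q = b"
    using simultaneous_conj[OF pq ab(1,2)] p ab by metis
  note H = conj_group_bounded[OF G g(1) bound]
  have in_H: "a \<in> cj g ` G" "b \<in> cj g ` G" using p g by blast+
  have "a * a \<in> cj g ` G" "b * b \<in> cj g ` G" "a * b \<in> cj g ` G"
    using subgroupD(3)[OF H(1)] in_H by blast+
  then have "Quat 0 1 0 0 \<in> cj g ` G" "Quat 0 0 1 0 \<in> cj g ` G" "omega \<in> cj g ` G"
    by (simp_all add: a_def b_def times_quat_def)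
  then have T: "binT \<subseteq> cj g ` G" using binT_generated H(1) by simp
  then have "ADE (cj g ` G)" using contains_binT_ADE[OF H(1) T] H(3) by blast
  with T g show ?thesis by blast
qed

text \<open>
Two elements of order ten about axes through neighbouring vertices of an icosahedron. The words \<open>a b a b
a\<close>, \<open>a b\<^sup>-\<^sup>1 a\<close> and \<open>b a a\<close> in the standard pair are
\<open>i\<close>, \<open>j\<close> and \<open>omega\<close>.
\<close>

lemma icosahedral_ADE:
  assumes G: "subgroup G SU2" "finite G"
    and bound: "\<And>h. h \<in> G \<Longrightarrow> h \<noteq> 1 \<Longrightarrow> qRe h \<le> (1 + psi) / 2"
    and p: "p \<in> G" "q \<in> G" "qRe p = (1 + psi) / 2" "qRe q = (1 + psi) / 2" "qRe (p * q) = (1 + psi) / 2"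
  shows "\<exists>g\<in>U. ADE (cj g ` G) \<and> binT \<subseteq> cj g ` G"
proof -
  define a where "a = icos_q"
  define b where "b = Quat ((1 + psi) / 2) (psi / 2) (-1/2) 0"
  have ab: "a \<in> U" "b \<in> U" "qRe (a * b) = (1 + psi) / 2" "qRe a = (1 + psi) / 2" "qRe b = (1 + psi) / 2"
    by (simp_all add: a_def b_def icos_q_psi U_iff component_mult power2_eq_square psi_sq field_simps)
  have pq: "p \<in> U" "q \<in> U" using p subgroupD(5)[OF G(1)] by blast+
  have "\<bar>qRe p\<bar> < 1" using psi_bounds by (simp add: p(3))
  then obtain g where g: "g \<in> U" "cj g p = a" "cj g q = b"
    using simultaneous_conj[OF pq ab(1,2)] p ab by metis
  note H = conj_group_bounded[OF G g(1) bound]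
  have in_H: "a \<in> cj g ` G" "b \<in> cj g ` G" using p g by blast+
  have "a * (b * (a * (b * a))) \<in> cj g ` G" "a * (qcnj b * a) \<in> cj g ` G" "b * (a * a) \<in> cj g ` G"
    using in_H by (simp_all add: subgroupD(3,4)[OF H(1)])
  moreover have "a * a = Quat (psi / 2) (1 / 2) ((1 + psi) / 2) 0"
    by (simp add: a_def icos_q_psi times_quat_def psi_sq field_simps)
  moreover have "b * a = Quat ((1 + psi) / 2) (1 / 2) 0 (psi / 2)"
    by (simp add: a_def b_def icos_q_psi times_quat_def psi_sq field_simps)
  moreover have "a * Quat ((1 + psi) / 2) (1 / 2) 0 (psi / 2) = Quat (1/2) ((1 + psi) / 2) (psi / 2) 0"
    by (simp add: a_def b_def icos_q_psi times_quat_def psi_sq field_simps)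
  ultimately have "Quat 0 1 0 0 \<in> cj g ` G" "Quat 0 0 1 0 \<in> cj g ` G" "omega \<in> cj g ` G"
    by (simp_all add: a_def b_def icos_q_psi times_quat_def qcnj_def psi_sq psi_sq' field_simps)
  then have T: "binT \<subseteq> cj g ` G" using binT_generated H(1) by simp
  then have "cj g ` G = binI" using icos_group_eq[OF H(1,2) T _ H(3)] in_H by (simp add: a_def)
  then have "ADE (cj g ` G)" by (simp add: ADE_def)
  with T g show ?thesis by blast
qed

text \<open>
Let \<open>p\<close> have the largest real part \<open>x < 1\<close>. Unless an axis is preserved,
\<open>x\<close> is \<open>cos 60\<degree>\<close>, \<open>cos 45\<degree>\<close> or \<open>cos
36\<degree>\<close>. The real parts of \<open>p q\<close> and \<open>p q\<^sup>-\<^sup>1\<close> then are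
\<open>0\<close> and \<open>1/2\<close>, or both \<open>1/2\<close>, or \<open>1/2\<close> and \<open>cos
36\<degree>\<close>, respectively.
\<close>

theorem finite_subgroup_with_minus_one:
  assumes G: "subgroup G SU2" "finite G" "-1 \<in> G"
  shows "preserves_axis G \<or> (\<exists>g\<in>U. ADE (cj g ` G) \<and> binT \<subseteq> cj g ` G)"
proof (cases "preserves_axis G")
  case irr: False
  note m1 = minus_one_ne_one
  define R where "R = qRe ` (G - {1})"
  have R: "finite R" "R \<noteq> {}" using G m1 by (auto simp: R_def)
  obtain p where "p \<in> G - {1}" "Max R = qRe p" using Max_in[OF R] unfolding R_def by blast
  then have p: "p \<in> G" "p \<noteq> 1" "qRe p = Max R" by simp_all
  have max: "qRe h \<le> qRe p" if "h \<in> G" "h \<noteq> 1" for h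
    unfolding p(3) using that R by (intro Max_ge) (auto simp: R_def)
  have pU: "p \<in> U" using p subgroupD(5)[OF G(1)] by blast
  have p1: "qRe p < 1" using U_Re_le(1)[OF pU] U_Re_one[OF pU] p(2) by linarith
  have lt: "qRe p < sqrt 3 / 2" using small_rotation_preserves_axis[OF G(1) p(1) _ p(2) max] irr by force
  have spec: "qRe h \<in> {0, 1, -1} \<or> (qRe h \<in> {1/2, -1/2} \<and> 1/2 \<le> qRe p) \<or>
    (qRe h \<in> {sqrt 2 / 2, - sqrt 2 / 2} \<and> sqrt 2 / 2 \<le> qRe p) \<or>
    (qRe h \<in> {(1 + psi) / 2, - (1 + psi) / 2, psi / 2, - psi / 2} \<and> (1 + psi) / 2 \<le> qRe p)" if "h \<in> G" for h
    using possible_real_parts[OF G that max lt] by (simp add: golden_psi)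
  have s2: "1.41 < sqrt 2" "sqrt 2 < 1.42"
    by (rule real_less_rsqrt, simp add: power2_eq_square) (rule real_less_lsqrt, simp_all add: power2_eq_square)
  have pos: "\<not> qRe p \<le> 0"
  proof
    assume le: "qRe p \<le> 0"
    have "qRe h \<in> {0, 1, -1}" if "h \<in> G" for h using spec[OF that] le s2 psi_bounds by auto
    then show False using pure_group_preserves_axis[OF G(1)] irr by blast
  qed
  have p1': "\<bar>qRe p\<bar> < 1" using pos p1 by simp
  obtain q where q: "q \<in> G" "qRe q = qRe p" "qRe (p * q) + qRe (p * qcnj q) = 2 * (qRe p)\<^sup>2"
    "qRe (p * q) \<le> qRe p" "qRe (p * qcnj q) \<le> qRe p"
    using irreducible_pair[OF G(1) irr p(1) p1' max] by metis
  have mem: "qcnj q \<in> G" "p * q \<in> G" "p * qcnj q \<in> G" by (intro subgroupD(3,4)[OF G(1)] p q)+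
  note S = spec[OF mem(2)] spec[OF mem(3)]
  consider "qRe p = 1/2" | "qRe p = sqrt 2 / 2" | "qRe p = (1 + psi) / 2"
    using spec[OF p(1)] pos p1 s2 psi_bounds by auto
  then show ?thesis
  proof cases
    case 1
    have "qRe (p * q) + qRe (p * qcnj q) = 1/2" using q(3) by (simp add: 1 power2_eq_square)
    then have "qRe (p * q) = 0 \<or> qRe (p * qcnj q) = 0" using S s2 psi_bounds q(4,5) unfolding 1 by auto
    moreover have "\<And>h. h \<in> G \<Longrightarrow> h \<noteq> 1 \<Longrightarrow> qRe h \<le> 1/2" using max 1 by simp
    ultimately show ?thesis
      using tetrahedral_ADE[OF G(1,2) _ p(1) q(1)] tetrahedral_ADE[OF G(1,2) _ p(1) mem(1)] q(2) 1 by auto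
  next
    case 2
    have "qRe (p * q) + qRe (p * qcnj q) = 1" using q(3) by (simp add: 2 power_divide)
    then have "qRe (p * q) = 1/2" using S s2 psi_bounds q(4,5) unfolding 2 by auto
    moreover have "\<And>h. h \<in> G \<Longrightarrow> h \<noteq> 1 \<Longrightarrow> qRe h \<le> sqrt 2 / 2" using max 2 by simp
    ultimately show ?thesis
      using octahedral_ADE[OF G(1,2) _ p(1) q(1)] q(2) 2 by auto
  next
    case 3
    have "qRe (p * q) + qRe (p * qcnj q) = 1 + psi / 2"
      using q(3) by (simp add: 3 power2_eq_square psi_sq field_simps)
    then have "qRe (p * q) = (1 + psi) / 2 \<or> qRe (p * qcnj q) = (1 + psi) / 2"
      using S s2 psi_bounds q(4,5) unfolding 3 by auto
    moreover have "\<And>h. h \<in> G \<Longrightarrow> h \<noteq> 1 \<Longrightarrow> qRe h \<le> (1 + psi) / 2" using max 3 by simp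
    ultimately show ?thesis
      using icosahedral_ADE[OF G(1,2) _ p(1) q(1)] icosahedral_ADE[OF G(1,2) _ p(1) mem(1)] q(2) 3 by auto
  qed
qed simp

text \<open>
If \<open>-1 \<notin> G\<close>, the classification is applied to \<open>G \<union> -G\<close>. When this
preserves no axis it contains an element of square \<open>-1\<close>, which lies in \<open>G\<close> up to
sign, so \<open>-1 \<in> G\<close> after all.
\<close>

theorem finite_subgroup_ADE:
  assumes G: "subgroup G SU2" "finite G" "G \<noteq> {1}"
  obtains g where "g \<in> U" "ADE (cj g ` G)"
proof (cases "preserves_axis G")
  case True
  then show ?thesis using axis_imp_ADE[OF G] that by blast
next
  case irr: False
  have G': "subgroup (G \<union> uminus ` G) SU2" "finite (G \<union> uminus ` G)" "-1 \<in> G \<union> uminus ` G"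
    using subgroupD[OF G(1)] G(2) unfolding subgroup_U_iff by auto
  have "\<not> preserves_axis (G \<union> uminus ` G)" using irr unfolding preserves_axis_def by blast
  then obtain g where g: "g \<in> U" "ADE (cj g ` (G \<union> uminus ` G))" "binT \<subseteq> cj g ` (G \<union> uminus ` G)"
    using finite_subgroup_with_minus_one[OF G'] by blast
  have "-1 \<in> G"
  proof -
    have "Quat 0 1 0 0 \<in> binT" by (simp add: Quat_in_binT_iff)
    then obtain h where h: "h \<in> G \<union> uminus ` G" "cj g h = Quat 0 1 0 0" using g(3) by (metis (no_types, lifting) imageE subsetD)
    have "cj g (h * h) = cj g (-1)" using g(1) by (simp add: cj_mult h(2)) (simp add: quat_arith)
    then have "h * h = -1" using cj_inj[OF g(1)] by blast
    moreover have "h * h \<in> G" using h(1) subgroupD(3)[OF G(1)] by auto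
    ultimately show ?thesis by simp
  qed
  then have "G \<union> uminus ` G = G" using subgroupD(3)[OF G(1), of "-1"] by auto
  then show ?thesis using that g by metis
qed

section \<open>Freely acting products with a graph\<close>

definition triples :: "(quat \<Rightarrow> quat) \<Rightarrow> quat set \<Rightarrow> quat set \<Rightarrow> (quat \<times> quat \<times> quat) set" where
  "triples f A D = {(a, f a, d) | a d. a \<in> A \<and> d \<in> D}"

text \<open>
For \<open>B\<^sub>0 = 1\<close> a Goursat group is a graph; the coset notation disappears because
\<open>\<pi>\<close> is constant on cosets of \<open>A\<^sub>0\<close>.
\<close>

lemma goursat_graph:
  assumes "1 \<in> A0" and "\<And>a h. a \<in> A \<Longrightarrow> h \<in> A0 \<Longrightarrow> \<pi> (a * h) = \<pi> a"
    and "\<And>a. a \<in> A \<Longrightarrow> F (\<pi> a) = f a" and "\<And>a. a \<in> A \<Longrightarrow> f a \<in> B"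
  shows "prod3 (goursat A A0 B {1} (iso_of \<pi> F)) D = triples f A D"
proof -
  have "iso_of \<pi> F (a <#\<^bsub>SU2\<^esub> A0) = {f a}" if a: "a \<in> A" for a
  proof -
    have "a <#\<^bsub>SU2\<^esub> A0 = (\<lambda>h. a * h) ` A0" by (auto simp: l_coset_def)
    then have "\<pi> ` (a <#\<^bsub>SU2\<^esub> A0) = {\<pi> a}"
      using assms(1) assms(2)[OF a] by (auto simp: image_iff)
    then show ?thesis by (simp add: iso_of_def assms(3)[OF a])
  qed
  moreover have "b <#\<^bsub>SU2\<^esub> {1} = {b}" for b by (simp add: l_coset_def)
  ultimately have "goursat A A0 B {1} (iso_of \<pi> F) = {(a, f a) | a. a \<in> A}"
    using assms(4) unfolding goursat_def by auto
  then show ?thesis unfolding prod3_def triples_def by auto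
qed

text \<open>
A homomorphism with values \<open>1\<close> and \<open>-1\<close> is determined by its kernel.
\<close>

lemma goursat_sign:
  assumes A: "subgroup A SU2" and f: "\<And>x y. x \<in> A \<Longrightarrow> y \<in> A \<Longrightarrow> f (x * y) = f x * f y"
    and sgn: "\<And>x. x \<in> A \<Longrightarrow> f x = 1 \<or> f x = -1" and K: "K = {x \<in> A. f x = 1}"
  shows "prod3 (goursat A K (Zc 2) {1} (iso_of (proj2 K) id)) D = triples f A D"
proof (rule goursat_graph)
  have one: "1 \<in> A" using subgroupD(2)[OF A] .
  note m1 = minus_one_ne_one
  have "f 1 = f 1 * f 1" using f[OF one one] by simp
  then have "f 1 = 1" using sgn[OF one] m1 by auto
  then show "1 \<in> K" using one K by simp
  show "proj2 K (a * h) = proj2 K a" if "a \<in> A" "h \<in> K" for a h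
    using that f[of a h] subgroupD(3)[OF A, of a h] by (auto simp: K proj2_def)
  show "id (proj2 K a) = f a" if "a \<in> A" for a
    using that sgn[OF that] by (auto simp: K proj2_def)
  show "f a \<in> Zc 2" if "a \<in> A" for a using sgn[OF that] by (auto simp: Zc_2)
qed

text \<open>
The three families of groups in the theorem to which a free graph can belong, as predicates of the group in
standard form.
\<close>

definition in_index_two_family :: "(quat \<times> quat \<times> quat) set \<Rightarrow> bool" where
  "in_index_two_family H \<longleftrightarrow> (\<exists>D'. ADE D' \<and>
         ((\<exists>k\<ge>2. H = prod3 (goursat (binD (2 * k)) (binD k) (Zc 2) {1}
                               (iso_of (proj2 (binD k)) id)) D') \<or>
          H = prod3 (goursat binO binT (Zc 2) {1} (iso_of (proj2 binT) id)) D' \<or>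
          (\<exists>k\<ge>2. H = prod3 (goursat (binD k) (Zc (2 * k)) (Zc 2) {1}
                               (iso_of (proj2 (Zc (2 * k))) id)) D')))"

definition in_cyclic_family :: "(quat \<times> quat \<times> quat) set \<Rightarrow> bool" where
  "in_cyclic_family H \<longleftrightarrow> (\<exists>k l r D'. k \<ge> 2 \<and> l \<ge> 2 \<and> coprime r k \<and> ADE D' \<and>
         H = prod3 (goursat (Zc (k * l)) (Zc l) (Zc k) {1} (iso_of (projZ k l) (autZ r))) D' \<and>
         \<not> [int l * int r = 1] (mod (int l * int k)) \<and>
         \<not> [int l * int r = - 1] (mod (int l * int k)) \<and>
         (let k1 = gcd (1 + int l * int r) (int k * int l);
              k2 = gcd (1 - int l * int r) (int k * int l)
          in (k1 = 1 \<and> k2 = 1) \<or>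
             ((k1 > 1 \<or> k2 > 1) \<and> (\<forall>\<kappa>\<in>{k1, k2}. \<kappa> > 1 \<longrightarrow> coprime_cond D' \<kappa>))))"

definition in_dihedral_family :: "(quat \<times> quat \<times> quat) set \<Rightarrow> bool" where
  "in_dihedral_family H \<longleftrightarrow> (\<exists>k l a b g m. k \<ge> 1 \<and> l > 2 \<and> coprime a (2 * l) \<and> b < 2 * l \<and> g \<in> binD l \<and> m \<ge> 2 \<and>
         H = prod3 (goursat (binD (l * (2 * k + 1))) (Zc (2 * k + 1)) (binD l) {1}
                      (iso_of (projD k l) (conj_by g \<circ> autD l a b))) (Zc m) \<and>
         \<not> [int a * (2 * int k + 1) = 1] (mod (2 * int l * (2 * int k + 1))) \<and>
         \<not> [int a * (2 * int k + 1) = - 1] (mod (2 * int l * (2 * int k + 1))) \<and>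
         \<not> 4 dvd m \<and>
         (let k1 = gcd (1 - int a * (2 * int k + 1)) (2 * int l * (2 * int k + 1));
              k2 = gcd (1 + int a * (2 * int k + 1)) (2 * int l * (2 * int k + 1))
          in \<forall>\<kappa>\<in>{k1, k2}. \<kappa> > 1 \<longrightarrow> gcd \<kappa> (int m) = 1))"

text \<open>
The graph of \<open>f\<close> is \<open>C\<close>, up to conjugation of the first factor. The assumption
\<open>free\<close> expresses that \<open>C \<times> D\<close> acts freely, and \<open>overlap\<close> that
\<open>A \<times> f(A) \<times> D\<close> does not.
\<close>

locale free_graph =
  fixes A D :: "quat set" and f :: "quat \<Rightarrow> quat"
  assumes A: "subgroup A SU2" "finite A" and D: "subgroup D SU2" "finite D" "D \<noteq> {1}"
    and f_U: "x \<in> A \<Longrightarrow> f x \<in> U" and f_mult: "x \<in> A \<Longrightarrow> y \<in> A \<Longrightarrow> f (x * y) = f x * f y"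
    and ker: "\<exists>a\<in>A. a \<noteq> 1 \<and> f a = 1" and nontriv: "\<exists>a\<in>A. f a \<noteq> 1"
    and free: "a \<in> A \<Longrightarrow> d \<in> D \<Longrightarrow> qRe a = qRe (f a) \<Longrightarrow> qRe (f a) = qRe d \<Longrightarrow> d = 1"
    and overlap: "\<exists>a\<in>A. \<exists>b\<in>A. \<exists>d\<in>D. d \<noteq> 1 \<and> qRe a = qRe (f b) \<and> qRe (f b) = qRe d"
begin

definition listed :: bool where
  "listed \<longleftrightarrow> (\<exists>g1\<in>U. \<exists>g2\<in>U. \<exists>g3\<in>U. \<exists>H. H = {(cj g1 a, cj g2 (f a), cj g3 d) | a d. a \<in> A \<and> d \<in> D} \<and>
     (in_index_two_family H \<or> in_cyclic_family H \<or> in_dihedral_family H))"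

lemma conj_triples:
  assumes "g1 \<in> U"
  shows "{(cj g1 a, cj g2 (f a), cj g3 d) | a d. a \<in> A \<and> d \<in> D} =
     triples (\<lambda>x. cj g2 (f (cj (qcnj g1) x))) (cj g1 ` A) (cj g3 ` D)"
proof -
  have "triples F (cj g1 ` A) (cj g3 ` D) = {(cj g1 a, F (cj g1 a), cj g3 d) | a d. a \<in> A \<and> d \<in> D}" for F
    unfolding triples_def by blast
  then show ?thesis using assms by simp
qed

lemma listedI:
  assumes "g1 \<in> U" "g2 \<in> U" "g3 \<in> U"
    and "H = triples (\<lambda>x. cj g2 (f (cj (qcnj g1) x))) (cj g1 ` A) (cj g3 ` D)" "in_index_two_family H \<or> in_cyclic_family H \<or> in_dihedral_family H"
  shows listed
  unfolding listed_def using assms(1-3,5) assms(4)[folded conj_triples[OF assms(1)]] by blast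

lemma A_closed: "x \<in> A \<Longrightarrow> y \<in> A \<Longrightarrow> x * y \<in> A" "1 \<in> A" "x \<in> A \<Longrightarrow> qcnj x \<in> A" "x \<in> A \<Longrightarrow> x \<in> U"
  using subgroupD[OF A(1)] by auto

lemma f_one [simp]: "f 1 = 1"
proof -
  have "f 1 * f 1 = f 1" using f_mult[of 1 1] A_closed by simp
  then have "qcnj (f 1) * (f 1 * f 1) = qcnj (f 1) * f 1" by simp
  then show ?thesis using f_U A_closed by simp
qed

lemma f_power: "x \<in> A \<Longrightarrow> f (x ^ n) = f x ^ n"
  by (induction n) (simp_all add: f_mult subgroup_power[OF A(1)])

lemma free_conj:
  assumes "a \<in> A" "g2 \<in> U" "g3 \<in> U" "d \<in> cj g3 ` D" "qRe (cj g2 (f a)) = qRe a" "qRe d = qRe a"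
  shows "d = 1"
proof -
  obtain e where e: "e \<in> D" "d = cj g3 e" using assms by blast
  then show ?thesis using free[OF assms(1) e(1)] assms by simp
qed

end

lemma sqrt_one: assumes "x \<in> U" "x * x = 1" shows "x = 1 \<or> x = -1"
proof -
  have "x = x * x * qcnj x" using assms(1) by (simp add: mult.assoc)
  then have "x = qcnj x" by (simp add: assms(2))
  then have v: "qI x = 0 \<and> qJ x = 0 \<and> qK x = 0" by (simp add: quat_eq_iff)
  then have "(qRe x)\<^sup>2 = 1" using assms(1) by (simp add: U_iff)
  then show ?thesis using v by (auto simp: power2_eq_1_iff quat_eq_iff)
qed

lemma pure_square: assumes "x \<in> U" "qRe x = 0" shows "x * x = -1"
proof -
  have "qcnj x = - x" using assms(2) by (simp add: quat_eq_iff)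
  then show ?thesis using qcnj_left[OF assms(1)] by (metis minus_mult_left minus_minus)
qed

text \<open>
Such elements satisfy \<open>x\<^sup>2 = x - 1\<close> or \<open>x\<^sup>2 = -x - 1\<close>.
\<close>

lemma half_cube: assumes "x \<in> U" "qRe x = 1/2 \<or> qRe x = -1/2" shows "x * x * x = 1 \<or> x * x * x = -1"
proof -
  define e where "e = 2 * qRe x"
  have e: "e = 1 \<or> e = -1" using assms(2) by (auto simp: e_def)
  have "x * x = Quat e 0 0 0 * x - 1"
    using assms(1) by (simp add: U_iff e_def quat_eq_iff component_mult power2_eq_square algebra_simps)
  then have sq: "x * x = x - 1 \<or> x * x = - x - 1"
  proof -
    have "Quat e 0 0 0 = 1 \<or> Quat e 0 0 0 = -1" using e by (simp add: quat_eq_iff)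
    with \<open>x * x = Quat e 0 0 0 * x - 1\<close> show ?thesis by (elim disjE; simp)
  qed
  then show ?thesis
  proof
    assume s: "x * x = x - 1"
    have "x * x * x = x * x - x" by (simp add: s left_diff_distrib)
    then show ?thesis by (simp add: s)
  next
    assume s: "x * x = - x - 1"
    have "x * x * x = - (x * x) - x" by (simp add: s left_diff_distrib)
    then show ?thesis by (simp add: s)
  qed
qed

lemma coprime_if_no_prime:
  fixes a b :: int
  assumes "a > 0" "\<And>p::nat. prime p \<Longrightarrow> int p dvd a \<Longrightarrow> int p dvd b \<Longrightarrow> False"
  shows "gcd a b = 1"
proof (rule ccontr)
  assume ne: "gcd a b \<noteq> 1"
  define n where "n = nat (gcd a b)"
  have "n \<noteq> 1" using ne by (simp add: n_def nat_eq_iff)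
  then obtain p where p: "prime p" "p dvd n" using prime_factor_nat by blast
  then have "int p dvd int n" by simp
  also have "int n = gcd a b" by (simp add: n_def)
  finally have "int p dvd gcd a b" .
  then show False using assms(2)[of p] p(1) by simp
qed

lemma qcis_prime_in_Zc: assumes "p dvd m" "m > 0" shows "qcis (2 * pi / of_nat p) \<in> Zc m"
proof -
  obtain q where q: "m = p * q" using assms by (auto elim: dvdE)
  then have "2 * pi / of_nat p = 2 * pi * of_int (int q) / of_nat m" using assms(2) by simp
  then show ?thesis using qcis_in_Zc by metis
qed

lemma cos_prime_ne: "p \<ge> 2 \<Longrightarrow> cos (2 * pi / real p) \<noteq> 1"
proof -
  assume "p \<ge> 2"
  then have "cos (2 * pi / real p) < cos 0" by (intro cos_monotone_0_pi) (auto simp: field_simps)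
  then show ?thesis by simp
qed

context free_graph
begin

text \<open>
If \<open>f\<close> multiplies angles by \<open>e\<close> and \<open>p\<close> divides \<open>1 - e\<close> or
\<open>1 + e\<close>, the rotation of order \<open>p\<close> is mapped to itself or to its inverse. Both have
the same real part as the rotation, which freeness forbids for \<open>D\<close>.
\<close>

lemma no_common_prime:
  fixes N :: nat and e :: int
  assumes p: "prime p" "p dvd N" "int p dvd 1 - e \<or> int p dvd 1 + e" and N: "N > 0"
    and z: "\<And>x::int. qcis (2 * pi * of_int x / of_nat N) \<in> A"
    and fz: "\<And>x::int. cj g2 (f (qcis (2 * pi * of_int x / of_nat N))) = qcis (2 * pi * of_int (e * x) / of_nat N)"
    and g: "g2 \<in> U" "g3 \<in> U" and d: "d \<in> cj g3 ` D" "qRe d = cos (2 * pi / of_nat p)"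
  shows False
proof -
  have p2: "p \<ge> 2" using p(1) prime_ge_2_nat by blast
  obtain q where q: "N = p * q" using p(2) by (auto elim: dvdE)
  define a where "a = qcis (2 * pi * of_int (int q) / of_nat N)"
  have a: "a = qcis (2 * pi / of_nat p)" using q N p2 by (simp add: a_def)
  have "cj g2 (f a) = qcis (2 * pi * of_int (e * int q) / of_nat N)" unfolding a_def by (rule fz)
  also have "2 * pi * of_int (e * int q) / of_nat N = of_int e * (2 * pi / of_nat p)" using q N p2 by simp
  finally have fa: "qRe (cj g2 (f a)) = cos (of_int e * (2 * pi / of_nat p))" by simp
  have "cos (of_int e * (2 * pi / of_nat p)) = cos (2 * pi / of_nat p)"
    using p(3)
  proof
    assume "int p dvd 1 - e"
    then obtain c where "1 - e = int p * c" by (auto elim: dvdE)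
    then have "e = 1 - int p * c" by simp
    then have e: "real_of_int e = 1 - real p * of_int c" by simp
    have "of_int e * (2 * pi / of_nat p) = 2 * pi / of_nat p + 2 * pi * of_int (- c)"
      using p2 unfolding e by (simp add: field_simps)
    then show ?thesis by (metis Re_qcis qcis_eq_iff)
  next
    assume "int p dvd 1 + e"
    then obtain c where "1 + e = int p * c" by (auto elim: dvdE)
    then have "e = int p * c - 1" by simp
    then have e: "real_of_int e = real p * of_int c - 1" by simp
    have "of_int e * (2 * pi / of_nat p) = - (2 * pi / of_nat p) + 2 * pi * of_int c"
      using p2 unfolding e by (simp add: field_simps)
    then show ?thesis by (metis Re_qcis qcis_eq_iff cos_minus)
  qed
  then have "qRe (cj g2 (f a)) = qRe a" "qRe d = qRe a" using fa d(2) by (simp_all add: a)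
  moreover have "a \<in> A" using z by (simp only: a_def)
  ultimately have "d = 1" using free_conj g d(1) by blast
  then show False using d(2) cos_prime_ne[OF p2] by simp
qed

end

section \<open>Cyclic first projection\<close>

text \<open>
A common factor \<open>l\<close> of the modulus and of the left-hand side would divide \<open>1\<close>.
\<close>

lemma multiple_not_cong_unit:
  fixes l k r :: nat
  assumes "l \<ge> 2" shows "\<not> [int l * int r = 1] (mod (int l * int k))" "\<not> [int l * int r = - 1] (mod (int l * int k))"
proof -
  have "False" if "int l dvd 1" using that assms by simp
  then have "\<not> int l dvd int l * int r - 1" "\<not> int l dvd int l * int r + 1"
    by (metis dvd_triv_left dvd_diff_right_iff, metis dvd_triv_left dvd_add_right_iff)
  then show "\<not> [int l * int r = 1] (mod (int l * int k))" "\<not> [int l * int r = - 1] (mod (int l * int k))"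
    unfolding cong_iff_dvd_diff by (auto dest: dvd_mult_left)
qed

lemma projZ_value:
  assumes "k > 0" "l > 0"
  shows "projZ k l (qcis (2 * pi * of_int y / of_nat (k * l))) = qcis (2 * pi * of_int y / of_nat k)"
  unfolding projZ_def
proof (rule the_equality)
  fix z assume "\<exists>y'::int. qcis (2 * pi * of_int y / of_nat (k * l)) = qcis (2 * pi * of_int y' / of_nat (k * l)) \<and>
    z = qcis (2 * pi * of_int y' / of_nat k)"
  then obtain y' :: int where z: "z = qcis (2 * pi * of_int y' / of_nat k)"
    and "int (k * l) dvd y - y'"
    using qcis_frac_eq_iff[of "k * l"] assms by auto
  then have "int k dvd y - y'" by (simp add: dvd_mult_left)
  then show "z = qcis (2 * pi * of_int y / of_nat k)" unfolding z qcis_frac_eq_iff[OF assms(1)] by (simp add: dvd_diff_commute)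
qed blast

context free_graph
begin

lemma listedI_second:
  assumes "g2 \<in> U" "g3 \<in> U"
    and "H = triples (\<lambda>x. cj g2 (f x)) A (cj g3 ` D)" "in_index_two_family H \<or> in_cyclic_family H \<or> in_dihedral_family H"
  shows listed
  using listedI[of 1 g2 g3 H] assms by simp

lemma generator_image:
  assumes z: "z \<in> A" "z ^ n = 1" and n: "n > 0"
  obtains g s where "g \<in> U" "s < n" "cj g (f z) = qcis (2 * pi * of_int (int s) / of_nat n)"
proof -
  obtain g t where g: "g \<in> U" "cj g (f z) = qcis t" using conj_into_circle f_U z by metis
  have "f z ^ n = 1" using f_power[OF z(1), of n] z(2) by simp
  then have "cj g (f z) ^ n = 1" using g(1) by (metis cj_power cj_one)
  then have "qcis (of_nat n * t) = 1" by (simp add: g(2) qcis_power)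
  then obtain k :: int where "of_nat n * t = 2 * pi * of_int k" by (auto simp: qcis_eq_1)
  then have t: "t = 2 * pi * of_int k / of_nat n" using n by (simp add: field_simps)
  have "cj g (f z) \<in> Zc n" unfolding g(2) t by (rule qcis_in_Zc)
  then obtain s where "s < n" "cj g (f z) = qcis (2 * pi * real s / real n)" unfolding Zc_image[OF n] by blast
  then show ?thesis using that g by simp
qed

lemma cyclic_hom:
  fixes s :: int
  assumes n: "n > 0" and z: "qcis (2 * pi / of_nat n) \<in> A" and g: "g \<in> U"
    and s: "cj g (f (qcis (2 * pi / of_nat n))) = qcis (2 * pi * of_int s / of_nat n)"
  shows "cj g (f (qcis (2 * pi * of_int x / of_nat n))) = qcis (2 * pi * of_int (s * x) / of_nat n)"
proof -
  obtain y w where x: "x = int y + int n * w" using int_period n by metis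
  have "2 * pi * of_int x / of_nat n = of_nat y * (2 * pi / of_nat n) + 2 * pi * of_int w"
    using n by (simp add: x field_simps)
  then have 1: "qcis (2 * pi * of_int x / of_nat n) = qcis (2 * pi / of_nat n) ^ y"
    unfolding qcis_power qcis_eq_iff by blast
  have "2 * pi * of_int (s * x) / of_nat n = of_nat y * (2 * pi * of_int s / of_nat n) + 2 * pi * of_int (s * w)"
    using n by (simp add: x field_simps)
  then have 2: "qcis (2 * pi * of_int (s * x) / of_nat n) = qcis (2 * pi * of_int s / of_nat n) ^ y"
    unfolding qcis_power qcis_eq_iff by blast
  show ?thesis unfolding 1 2 f_power[OF z] cj_power[OF g] s ..
qed

lemma prime_condition:
  fixes \<kappa> e :: int
  assumes \<kappa>: "\<kappa> dvd int N" "\<kappa> dvd 1 - e \<or> \<kappa> dvd 1 + e" and N: "N > 0"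
    and z: "\<And>x::int. qcis (2 * pi * of_int x / of_nat N) \<in> A"
    and fz: "\<And>x::int. cj g2 (f (qcis (2 * pi * of_int x / of_nat N))) = qcis (2 * pi * of_int (e * x) / of_nat N)"
    and g: "g2 \<in> U" "g3 \<in> U" and p: "prime p" "int p dvd \<kappa>"
    and d: "d \<in> cj g3 ` D" "qRe d = cos (2 * pi / of_nat p)"
  shows False
proof -
  have "int p dvd int N" using p(2) \<kappa>(1) dvd_trans by blast
  then have "p dvd N" by simp
  moreover have "int p dvd 1 - e \<or> int p dvd 1 + e" using p(2) \<kappa>(2) dvd_trans by blast
  ultimately show False using no_common_prime[OF p(1) _ _ N z fz g d] by blast
qed

text \<open>
For each type of ADE group the listed primes are orders of elements that it contains, with real part
\<open>cos (2\<pi>/p)\<close>; \<open>no_common_prime\<close> excludes them as divisors of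
\<open>\<kappa>\<close>.
\<close>

lemma coprime_cond_holds:
  fixes \<kappa> e :: int
  assumes \<kappa>: "\<kappa> > 0" "\<kappa> dvd int N" "\<kappa> dvd 1 - e \<or> \<kappa> dvd 1 + e" and N: "N > 0"
    and z: "\<And>x::int. qcis (2 * pi * of_int x / of_nat N) \<in> A"
    and fz: "\<And>x::int. cj g2 (f (qcis (2 * pi * of_int x / of_nat N))) = qcis (2 * pi * of_int (e * x) / of_nat N)"
    and g: "g2 \<in> U" "g3 \<in> U"
  shows "coprime_cond (cj g3 ` D) \<kappa>"
proof -
  define E where "E = cj g3 ` D"
  note P = prime_condition[OF \<kappa>(2,3) N z fz g, folded E_def]
  have Zm: "gcd (int m) \<kappa> = 1" if "m > 0" "Zc m \<subseteq> E" for m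
  proof (rule coprime_if_no_prime)
    fix p :: nat assume "prime p" "int p dvd int m" "int p dvd \<kappa>"
    moreover have "qcis (2 * pi / of_nat p) \<in> E" using qcis_prime_in_Zc[of p m] that calculation(2) by auto
    ultimately show False using P[of p "qcis (2 * pi / of_nat p)"] by simp
  qed (use that in simp)
  have two: "\<not> 2 dvd \<kappa>" and three: "\<not> 3 dvd \<kappa>" if "binT \<subseteq> E"
  proof -
    have in_T: "-1 \<in> binT" "Quat (-1/2) (1/2) (1/2) (1/2) \<in> binT"
      by (simp_all add: one_quat_def uminus_quat_def Quat_in_binT_iff)
    show "\<not> 2 dvd \<kappa>" using P[of 2 "-1"] in_T that by auto
    show "\<not> 3 dvd \<kappa>" using P[of 3 "Quat (-1/2) (1/2) (1/2) (1/2)"] in_T that cos_120 by auto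
  qed
  \<comment> \<open>The square of \<open>q\<close> is the rotation of order five.\<close>
  have five: "\<not> 5 dvd \<kappa>" if "E = binI"
  proof -
    have "1 \<in> binT" by (simp add: binT_explicit binD2_explicit)
    then have "icos_q ^ 2 * 1 \<in> binI" unfolding binI_def by (intro UN_I[of 2] imageI) auto
    then have q: "icos_q * icos_q \<in> E" using that by (simp add: power2_eq_square)
    have "cos (2 * pi / 5) = 2 * (cos (pi / 5))\<^sup>2 - 1" using cos_double_cos[of "pi / 5"] by simp
    also have "\<dots> = psi / 2" by (simp add: cos_pi_5_psi power2_eq_square psi_sq field_simps)
    also have "\<dots> = qRe (icos_q * icos_q)" by (simp add: icos_q_psi component_mult psi_sq field_simps)
    finally show ?thesis using P[of 5 "icos_q * icos_q"] q by auto
  qed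
  have "binT \<subseteq> binI" unfolding binI_def by (rule subsetI, rule UN_I[of 0]) auto
  moreover have "binT \<subseteq> binO" by (simp add: binO_def)
  ultimately have T: "E = binT \<or> E = binO \<or> E = binI \<Longrightarrow> \<not> 2 dvd \<kappa> \<and> \<not> 3 dvd \<kappa>" using two three by blast
  show ?thesis unfolding coprime_cond_def E_def[symmetric]
  proof (intro conjI allI impI)
    show "gcd (int m) \<kappa> = 1" if "2 \<le> m" "E = Zc m" for m using Zm[of m] that by simp
    show "gcd (2 * int m) \<kappa> = 1" if "2 \<le> m" "E = binD m" for m
      using Zm[of "2 * m"] that by (simp add: binD_eq)
  qed (use T five in auto)
qed

text \<open>
If the generator is sent to the \<open>s\<close>-th power of a primitive \<open>n\<close>-th root of unity,
then \<open>l = gcd s n\<close> is the order of the kernel and \<open>k = n/l\<close> the order of the image.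
A nontrivial image and kernel mean \<open>k, l \<ge> 2\<close>.
\<close>

lemma cyclic_case:
  assumes An: "A = Zc n" and n: "n \<ge> 2"
  shows listed
proof -
  have n0: "n > 0" using n by simp
  have z: "qcis (2 * pi * of_int x / of_nat n) \<in> A" for x :: int unfolding An by (rule qcis_in_Zc)
  have z1: "qcis (2 * pi / of_nat n) \<in> A" using z[of 1] by simp
  have "qcis (2 * pi / of_nat n) ^ n = 1" using n0 by (simp add: qcis_power qcis_eq_1)
  then obtain g2 s where g2: "g2 \<in> U" and s: "cj g2 (f (qcis (2 * pi / of_nat n))) = qcis (2 * pi * of_int (int s) / of_nat n)"
    using generator_image[OF z1 _ n0] by metis
  note fz = cyclic_hom[OF n0 z1 g2 s]
  obtain g3 where g3: "g3 \<in> U" "ADE (cj g3 ` D)" using finite_subgroup_ADE[OF D] by metis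
  define l where "l = gcd s n"
  have l0: "l > 0" using n0 by (simp add: l_def)
  obtain r k where r: "s = r * l" "n = k * l" "coprime r k" unfolding l_def
    using gcd_coprime_exists[of s n] n0 by auto
  have k0: "k > 0" using r n0 by (cases k) auto
  have fk: "qcis (2 * pi * of_int (int s * x) / of_nat n) = qcis (2 * pi * of_int (int r * x) / of_nat k)" for x
  proof -
    have "2 * pi * of_int (int s * x) / of_nat n = 2 * pi * of_int (int r * x) / of_nat k"
      using l0 k0 by (simp add: r field_simps)
    then show ?thesis by simp
  qed
  have k2: "k \<ge> 2"
  proof (rule ccontr)
    assume "\<not> k \<ge> 2"
    then have "k = 1" using k0 by simp
    have "f a = 1" if aA: "a \<in> A" for a
    proof -
      obtain x :: int where a: "a = qcis (2 * pi * of_int x / of_nat n)" using aA unfolding An Zc_def by blast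
      have "cj g2 (f a) = qcis (2 * pi * of_int (int r * x) / of_nat k)" unfolding a fz fk ..
      also have "\<dots> = 1" unfolding qcis_eq_1 using \<open>k = 1\<close> by (intro exI[of _ "int r * x"]) simp
      finally show ?thesis using cj_inj[OF g2, of "f a" 1] g2 by simp
    qed
    then show False using nontriv by blast
  qed
  have l2: "l \<ge> 2"
  proof (rule ccontr)
    assume "\<not> l \<ge> 2"
    then have "l = 1" using l0 by simp
    obtain a where a: "a \<in> A" "a \<noteq> 1" "f a = 1" using ker by blast
    obtain x :: int where x: "a = qcis (2 * pi * of_int x / of_nat n)" using a(1) unfolding An Zc_def by blast
    have "qcis (2 * pi * of_int (int r * x) / of_nat k) = qcis (2 * pi * of_int 0 / of_nat k)"
      using fz[of x] fk[of x] a(3) g2 x by simp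
    then have "int k dvd int r * x" unfolding qcis_frac_eq_iff[OF k0] by simp
    moreover have "coprime (int k) (int r)" using r(3) by (simp add: coprime_commute)
    ultimately have "int n dvd x - 0" using \<open>l = 1\<close> r(2) by (simp add: coprime_dvd_mult_right_iff)
    then have "a = qcis (2 * pi * of_int 0 / of_nat n)" unfolding x qcis_frac_eq_iff[OF n0] .
    then have "a = 1" by simp
    then show False using a by simp
  qed
  define H where "H = triples (\<lambda>x. cj g2 (f x)) A (cj g3 ` D)"
  have H: "H = prod3 (goursat (Zc (k * l)) (Zc l) (Zc k) {1} (iso_of (projZ k l) (autZ r))) (cj g3 ` D)"
    unfolding H_def An r(2)
  proof (rule goursat_graph[symmetric])
    show "1 \<in> Zc l" using qcis_in_Zc[of 0 l] by simp
    fix a assume "a \<in> Zc (k * l)"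
    then obtain y :: int where a: "a = qcis (2 * pi * of_int y / of_nat (k * l))" by (auto simp: Zc_def)
    have pa: "projZ k l a = qcis (2 * pi * of_int y / of_nat k)" unfolding a using k0 l0 by (rule projZ_value)
    have fa: "cj g2 (f a) = qcis (2 * pi * of_int (int r * y) / of_nat k)" using fz[of y] fk[of y] unfolding a r(2) by simp
    show "projZ k l (a * h) = projZ k l a" if hZ: "h \<in> Zc l" for h
    proof -
      obtain x :: int where h: "h = qcis (2 * pi * of_int x / of_nat l)" using hZ by (auto simp: Zc_def)
      have "2 * pi * of_int y / of_nat (k * l) + 2 * pi * of_int x / of_nat l = 2 * pi * of_int (y + int k * x) / of_nat (k * l)"
        using k0 l0 by (simp add: field_simps)
      then have "a * h = qcis (2 * pi * of_int (y + int k * x) / of_nat (k * l))"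
        unfolding a h qcis_add[symmetric] by simp
      then have "projZ k l (a * h) = qcis (2 * pi * of_int (y + int k * x) / of_nat k)"
        by (simp only: projZ_value[OF k0 l0])
      also have "2 * pi * of_int (y + int k * x) / of_nat k = 2 * pi * of_int y / of_nat k + 2 * pi * of_int x"
        using k0 by (simp add: field_simps)
      also have "qcis \<dots> = projZ k l a" unfolding pa qcis_eq_iff by blast
      finally show ?thesis .
    qed
    show "autZ r (projZ k l a) = cj g2 (f a)"
      unfolding fa pa autZ_def qcis_power by (simp add: algebra_simps)
    show "cj g2 (f a) \<in> Zc k" unfolding fa by (rule qcis_in_Zc)
  qed
  have cc: "coprime_cond (cj g3 ` D) \<kappa>" if "\<kappa> \<in> {gcd (1 + int l * int r) (int k * int l), gcd (1 - int l * int r) (int k * int l)}" for \<kappa>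
  proof (rule coprime_cond_holds[where N = n and e = "int s"])
    show "\<kappa> > 0" "\<kappa> dvd int n" using that k0 l0 by (auto simp: r)
    show "\<kappa> dvd 1 - int s \<or> \<kappa> dvd 1 + int s" using that by (auto simp: r mult.commute)
  qed (use n0 z fz g2 g3 in auto)
  have pos: "gcd (1 + int l * int r) (int k * int l) > 0" "gcd (1 - int l * int r) (int k * int l) > 0"
    using k0 l0 by simp_all
  have "in_cyclic_family H"
    unfolding in_cyclic_family_def Let_def
    using k2 l2 r(3) g3(2) H multiple_not_cong_unit[OF l2] cc pos
    by (intro exI[of _ k] exI[of _ l] exI[of _ r] exI[of _ "cj g3 ` D"]) (smt (verit))
  then show listed using listedI_second[OF g2 g3(1) H_def] by blast
qed

end

section \<open>Polyhedral first projection\<close>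

lemma ADE_without_minus_one:
  assumes "ADE G" "-1 \<notin> G" obtains m where "m \<ge> 2" "odd m" "G = Zc m"
proof -
  have T: "-1 \<in> binT" by (simp add: one_quat_def uminus_quat_def Quat_in_binT_iff)
  then have "(-1::quat) \<in> binO" by (simp add: binO_def)
  moreover have "icos_q ^ 0 * -1 \<in> binI" unfolding binI_def using T by (intro UN_I[of 0] imageI) auto
  then have "-1 \<in> binI" by simp
  moreover have even: "-1 \<in> Zc m" if "even m" "m > 0" for m
    using qcis_prime_in_Zc[of 2 m] that by simp
  have "-1 \<in> binD n" if "n \<ge> 2" for n using even[of "2 * n"] that by (simp add: binD_eq)
  ultimately obtain m where "m \<ge> 2" "G = Zc m" using T assms unfolding ADE_def by blast
  then show ?thesis using that even[of m] assms(2) by fastforce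
qed

lemma Zc_commute: "x \<in> Zc m \<Longrightarrow> y \<in> Zc m \<Longrightarrow> x * y = y * x"
  unfolding Zc_def by (auto simp: qcis_add[symmetric] add.commute)

text \<open>
The quaternion units preserve only the coordinate axes, which \<open>omega\<close> permutes cyclically.
\<close>

lemma binT_no_axis:
  assumes "binT \<subseteq> A" shows "\<not> preserves_axis A"
proof
  assume "preserves_axis A"
  then obtain P where P: "qRe P = 0" "P \<noteq> 0" "\<And>h. h \<in> A \<Longrightarrow> h * P = P * h \<or> h * P = - (P * h)"
    unfolding preserves_axis_def by blast
  have "Quat 0 1 0 0 \<in> A" "Quat 0 0 1 0 \<in> A" "omega \<in> A" using assms by (auto simp: Quat_in_binT_iff)
  note p = P(3)[OF this(1)] P(3)[OF this(2)] P(3)[OF this(3)]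
  have "qI P = 0 \<or> qJ P = 0 \<and> qK P = 0"
    using p(1) P(1) by (elim disjE) (simp_all add: quat_eq_iff component_mult)
  moreover have "qI P = qJ P \<and> qJ P = qK P \<or> qI P = 0 \<and> qJ P = 0 \<and> qK P = 0"
  proof -
    have c: "qRe (omega * P) = - (qI P + qJ P + qK P) / 2" "qRe (P * omega) = - (qI P + qJ P + qK P) / 2"
      "qI (omega * P) = (qI P + qK P - qJ P) / 2" "qI (P * omega) = (qI P + qJ P - qK P) / 2"
      "qJ (omega * P) = (qJ P + qI P - qK P) / 2" "qJ (P * omega) = (qJ P + qK P - qI P) / 2"
      "qK (omega * P) = (qK P + qJ P - qI P) / 2" "qK (P * omega) = (qK P + qI P - qJ P) / 2"
      by (simp_all add: component_mult P(1) field_simps)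
    from p(3) show ?thesis
    proof
      assume "omega * P = P * omega"
      then have "qI (omega * P) = qI (P * omega)" "qJ (omega * P) = qJ (P * omega)" by simp_all
      then show ?thesis unfolding c by argo
    next
      assume "omega * P = - (P * omega)"
      then have "qI (omega * P) = - qI (P * omega)" "qJ (omega * P) = - qJ (P * omega)"
        "qK (omega * P) = - qK (P * omega)" by simp_all
      then show ?thesis unfolding c by argo
    qed
  qed
  ultimately have "qI P = 0 \<and> qJ P = 0 \<and> qK P = 0" by argo
  then show False using P(1,2) by (simp add: quat_eq_iff)
qed

lemma cube_root_Re: assumes "x \<in> U" "x * x * x = 1" "x \<noteq> 1" shows "qRe x = -1/2"
proof -
  have "x * x = x * x * x * qcnj x" using assms(1) by (simp add: mult.assoc)
  then have "x * x = qcnj x" by (simp add: assms(2))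
  then have "qRe (x * x) = qRe x" by simp
  moreover have "qRe (x * x) = 2 * (qRe x * qRe x) - 1" using assms(1) by (simp add: component_mult U_iff power2_eq_square)
  ultimately have "(qRe x - 1) * (2 * qRe x + 1) = 0" by (simp add: algebra_simps)
  moreover have "qRe x \<noteq> 1" using U_Re_one assms by blast
  ultimately show ?thesis by simp
qed

context free_graph
begin

lemma D_U: "d \<in> D \<Longrightarrow> d \<in> U" using subgroupD[OF D(1)] by auto

lemma f_minus_one: "-1 \<in> A \<Longrightarrow> f (-1) = 1 \<or> f (-1) = -1"
  using f_mult[of "-1" "-1"] f_U by (intro sqrt_one) auto

lemma f_qcnj: "x \<in> A \<Longrightarrow> f (qcnj x) = qcnj (f x)"
proof -
  assume x: "x \<in> A"
  have "f x * f (qcnj x) = 1" using f_mult[OF x A_closed(3)[OF x]] A_closed(4)[OF x] by simp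
  then have "qcnj (f x) * (f x * f (qcnj x)) = qcnj (f x)" by simp
  then show ?thesis using f_U[OF x] by simp
qed

lemma f_neg: assumes "-1 \<in> A" "f (-1) = 1" "x \<in> A" shows "f (- x) = f x"
  using f_mult[OF assms(1,3)] assms(2) by simp

text \<open>
Elements of square \<open>-1\<close> are sent to square roots of \<open>1\<close>, which are \<open>1\<close>
and \<open>-1\<close> only. This rules out most quotients of \<open>A\<close>, such as dihedral or symmetric
groups, as subgroups of \<open>SU(2)\<close>.
\<close>

lemma pure_sign:
  assumes "-1 \<in> A" "f (-1) = 1" "a \<in> A" "qRe a = 0" shows "f a = 1 \<or> f a = -1"
proof -
  have "f a * f a = f (a * a)" using assms f_mult by simp
  also have "a * a = -1" using pure_square A_closed(4) assms by simp
  finally show ?thesis using sqrt_one f_U assms by simp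
qed

lemma listed_if_signs:
  assumes sgn: "\<And>x. x \<in> A \<Longrightarrow> f x = 1 \<or> f x = -1" and g: "g \<in> U"
    and "(\<exists>k\<ge>2. cj g ` A = binD (2 * k) \<and> cj g ` {x \<in> A. f x = 1} = binD k) \<or>
         (cj g ` A = binO \<and> cj g ` {x \<in> A. f x = 1} = binT) \<or>
         (\<exists>k\<ge>2. cj g ` A = binD k \<and> cj g ` {x \<in> A. f x = 1} = Zc (2 * k))"
  shows listed
proof -
  define f' where "f' = (\<lambda>x. cj 1 (f (cj (qcnj g) x)))"
  obtain g3 where g3: "g3 \<in> U" "ADE (cj g3 ` D)" using finite_subgroup_ADE[OF D] by metis
  have "prod3 (goursat (cj g ` A) (cj g ` {x \<in> A. f x = 1}) (Zc 2) {1} (iso_of (proj2 (cj g ` {x \<in> A. f x = 1})) id)) (cj g3 ` D)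
    = triples f' (cj g ` A) (cj g3 ` D)"
  proof (rule goursat_sign)
    show "subgroup (cj g ` A) SU2" using cj_subgroup g A by blast
    show "f' (x * y) = f' x * f' y" if "x \<in> cj g ` A" "y \<in> cj g ` A" for x y
      using that g by (auto simp: f'_def cj_mult[symmetric] f_mult A_closed)
    show "f' x = 1 \<or> f' x = - 1" if "x \<in> cj g ` A" for x
      using that g sgn[of "cj (qcnj g) x"] by (fastforce simp: f'_def)
    show "cj g ` {x \<in> A. f x = 1} = {x \<in> cj g ` A. f' x = 1}" using g by (auto simp: f'_def)
  qed
  note H = this[symmetric]
  have "in_index_two_family (triples f' (cj g ` A) (cj g3 ` D))"
    unfolding in_index_two_family_def
  proof (intro exI[of _ "cj g3 ` D"] conjI)
    from assms(3) show "(\<exists>k\<ge>2. triples f' (cj g ` A) (cj g3 ` D) = prod3 (goursat (binD (2 * k)) (binD k) (Zc 2) {1}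
          (iso_of (proj2 (binD k)) id)) (cj g3 ` D)) \<or>
        triples f' (cj g ` A) (cj g3 ` D) = prod3 (goursat binO binT (Zc 2) {1} (iso_of (proj2 binT) id)) (cj g3 ` D) \<or>
        (\<exists>k\<ge>2. triples f' (cj g ` A) (cj g3 ` D) = prod3 (goursat (binD k) (Zc (2 * k)) (Zc 2) {1}
          (iso_of (proj2 (Zc (2 * k))) id)) (cj g3 ` D))"
    proof (elim disjE exE conjE, goal_cases)
      case (1 k)
      then show ?case using H by (intro disjI1 exI[of _ k] conjI) simp_all
    next
      case 2
      then show ?case using H by (intro disjI2 disjI1) simp
    next
      case (3 k)
      then show ?case using H by (intro disjI2 exI[of _ k] conjI) simp_all
    qed
  qed (rule g3)
  then show listed using listedI[OF g U_one g3(1)] unfolding f'_def by blast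
qed

text \<open>
Otherwise the kernel is a nontrivial finite group without \<open>-1\<close>, hence cyclic. As it is normal,
all conjugates of one of its elements commute and \<open>A\<close> preserves an axis, which a group containing
\<open>2T\<close> does not.
\<close>

lemma kernel_contains_minus_one:
  assumes T: "binT \<subseteq> A" shows "f (-1) = 1"
proof (rule ccontr)
  assume ne: "f (-1) \<noteq> 1"
  define N where "N = {a \<in> A. f a = 1}"
  have N: "subgroup N SU2" unfolding subgroup_U_iff
  proof (intro conjI ballI)
    show "N \<subseteq> U" using A_closed(4) by (auto simp: N_def)
    show "1 \<in> N" using A_closed(2) by (simp add: N_def)
    show "x * y \<in> N" if "x \<in> N" "y \<in> N" for x y using that by (simp add: N_def f_mult A_closed)
    show "qcnj x \<in> N" if "x \<in> N" for x using that by (simp add: N_def f_qcnj A_closed)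
  qed
  obtain a where a: "a \<in> A" "a \<noteq> 1" "f a = 1" using ker by blast
  have "finite N" "N \<noteq> {1}" using A(2) a by (auto simp: N_def)
  then obtain g where g: "g \<in> U" "ADE (cj g ` N)" using finite_subgroup_ADE[OF N] by metis
  have m1: "-1 \<notin> N" using ne by (simp add: N_def)
  have "-1 \<notin> cj g ` N" using m1 minus_one_in_conj[OF g(1)] by blast
  then obtain m where m: "cj g ` N = Zc m" using ADE_without_minus_one[OF g(2)] by metis
  have comm: "x * y = y * x" if "x \<in> N" "y \<in> N" for x y
  proof -
    have "cj g x * cj g y = cj g y * cj g x" using that m Zc_commute by blast
    then have "cj g (x * y) = cj g (y * x)" using g(1) by (simp add: cj_mult)
    then show ?thesis using cj_inj[OF g(1)] by blast
  qed
  have aU: "a \<in> U" using A_closed a by blast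
  have "a \<noteq> -1" using a(3) ne by auto
  then have "qRe a \<noteq> 1" "qRe a \<noteq> -1" using U_Re_one[OF aU] U_Re_minus_one[OF aU] a(2) by auto
  then have lt: "\<bar>qRe a\<bar> < 1" using U_Re_le[OF aU] by auto
  have "cj h a * a = a * cj h a" if h: "h \<in> A" for h
  proof (rule comm)
    show "a \<in> N" using a by (simp add: N_def)
    show "cj h a \<in> N" using h a f_U[OF h] by (simp add: N_def cj_def A_closed f_mult f_qcnj)
  qed
  then have "preserves_axis A" using preserves_axis_if_conjugates_commute[of A a] aU lt A_closed(4) by blast
  then show False using binT_no_axis[OF T] by blast
qed

text \<open>
The units \<open>i\<close>, \<open>j\<close>, \<open>k\<close> are conjugate under \<open>omega\<close> and
have central images, so these images agree; as \<open>i j = k\<close>, they are \<open>1\<close>.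
\<close>

lemma quaternion_group_in_kernel:
  assumes T: "binT \<subseteq> A"
  shows "a \<in> binD 2 \<Longrightarrow> f a = 1"
proof -
  have fm: "f (-1) = 1" by (rule kernel_contains_minus_one[OF T])
  define i j k where "i = Quat 0 1 0 0" and "j = Quat 0 0 1 0" and "k = Quat 0 0 0 1"
  have inA: "-1 \<in> A" "i \<in> A" "j \<in> A" "k \<in> A" "omega \<in> A"
    using T by (auto simp: one_quat_def uminus_quat_def i_def j_def k_def Quat_in_binT_iff subset_iff)
  have sgn: "f i = 1 \<or> f i = -1" "f j = 1 \<or> f j = -1" "f k = 1 \<or> f k = -1"
    using pure_sign[OF inA(1) fm] inA by (auto simp: i_def j_def k_def)
  have cancel: "x = y" if "z * x = y * z" "z \<in> U" "x = 1 \<or> x = -1" "y = 1 \<or> y = -1" for x y z :: quat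
  proof -
    have "x = qcnj z * (z * x)" using that(2) by simp
    also have "\<dots> = qcnj z * (z * y)" using that(1,4) by auto
    also have "\<dots> = y" using that(2) by simp
    finally show ?thesis .
  qed
  have wU: "f omega \<in> U" using f_U inA by blast
  have "omega * i = j * omega" "omega * j = k * omega" "i * j = k"
    by (simp_all add: i_def j_def k_def times_quat_def)
  then have "f omega * f i = f j * f omega" "f omega * f j = f k * f omega" and ij: "f i * f j = f k"
    using f_mult inA by metis+
  then have "f i = f j" "f j = f k" using cancel[OF _ wU] sgn by blast+
  then have ijk: "f i = 1" "f j = 1" "f k = 1" using sgn ij by auto
  have "f (- i) = 1" "f (- j) = 1" "f (- k) = 1" using f_neg[OF inA(1) fm] inA ijk by auto
  moreover have "- i = Quat 0 (-1) 0 0" "- j = Quat 0 0 (-1) 0" "- k = Quat 0 0 0 (-1)"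
    by (simp_all add: i_def j_def k_def uminus_quat_def)
  ultimately show "a \<in> binD 2 \<Longrightarrow> f a = 1"
    unfolding binD2_explicit using ijk fm i_def j_def k_def by auto
qed

lemma half_cube_in_kernel:
  assumes T: "binT \<subseteq> A" and a: "a \<in> A" "qRe a = 1/2 \<or> qRe a = -1/2"
  shows "f a * f a * f a = 1"
proof -
  have "f a * f a * f a = f (a * a * a)" using a A_closed by (simp add: f_mult)
  then show ?thesis using half_cube[of a] a A_closed(4) kernel_contains_minus_one[OF T] by auto
qed

text \<open>
The cube of \<open>f omega\<close> is \<open>1\<close>, so a sign for \<open>f omega\<close> must be
\<open>1\<close>. Together with the quaternion group, \<open>omega\<close> generates \<open>2T\<close>.
\<close>

lemma binT_in_kernel:
  assumes T: "binT \<subseteq> A" and w: "f omega = 1 \<or> f omega = -1"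
  shows "a \<in> binT \<Longrightarrow> f a = 1"
proof -
  have wA: "omega \<in> A" using T by (auto simp: Quat_in_binT_iff)
  have "f omega * f omega * f omega = 1" using half_cube_in_kernel[OF T wA] by simp
  moreover have "(-1::quat) \<noteq> 1" by (simp add: quat_eq_iff)
  ultimately have w1: "f omega = 1" using w by auto
  have DA: "y \<in> binD 2 \<Longrightarrow> y \<in> A" for y using T by (auto simp: binT_def)
  assume "a \<in> binT"
  then show "f a = 1"
  proof (cases rule: binT_cases)
    case 1
    then show ?thesis using quaternion_group_in_kernel[OF T] by blast
  next
    case (2 p q r s)
    obtain y where y: "y \<in> binD 2" "a = y * omega \<or> a = y * qcnj omega" using binT_half_eq[OF 2(2-5)] 2(1) by blast
    have "f (y * omega) = 1" "f (y * qcnj omega) = 1"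
      using f_mult f_qcnj w1 wA DA[OF y(1)] quaternion_group_in_kernel[OF T y(1)] A_closed(3)[OF wA] by simp_all
    then show ?thesis using y(2) by auto
  qed
qed

text \<open>
Elements outside \<open>2D\<^sub>4\<close> have real part \<open>1/2\<close> or \<open>-1/2\<close> and the
same image as their negatives; their images are cube roots of unity. An overlap therefore happens at real part
\<open>-1/2\<close>, where the graph itself already violates freeness.
\<close>

lemma tetrahedral_impossible:
  assumes "A = binT" shows False
proof -
  have T: "binT \<subseteq> A" using assms by simp
  obtain b d where b: "b \<in> A" and d: "d \<in> D" "d \<noteq> 1" "qRe (f b) = qRe d" using overlap by metis
  have dR: "qRe d \<noteq> 1" using U_Re_one[OF D_U[OF d(1)]] d(2) by blast
  have fb: "f b \<noteq> 1" using dR d(3) by auto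
  have "b \<in> binT" using b assms by simp
  then show False
  proof (cases rule: binT_cases)
    case 1
    then show False using quaternion_group_in_kernel[OF T] fb by blast
  next
    case (2 p q r s)
    have bR: "qRe b = 1/2 \<or> qRe b = -1/2" using 2 by auto
    have "f b * f b * f b = 1" using half_cube_in_kernel[OF T b bR] .
    then have fR: "qRe (f b) = -1/2" using cube_root_Re f_U[OF b] fb by blast
    have m1: "-1 \<in> A" using T by (auto simp: one_quat_def uminus_quat_def Quat_in_binT_iff)
    have "f (- b) = f b" using f_neg[OF m1 kernel_contains_minus_one[OF T] b] .
    moreover have "- b \<in> A" using A_closed(1)[OF m1 b] by simp
    ultimately show False using free[OF b d(1)] free[of "- b" d] d fR bR by auto
  qed
qed

text \<open>
The elements \<open>e j\<close> and \<open>omega e k\<close> with \<open>e =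
e\<^sup>i\<^sup>\<pi>\<^sup>/\<^sup>4\<close> are pure, so \<open>pure_sign\<close> determines
\<open>f\<close> on \<open>e\<close> and \<open>omega\<close> up to sign.
\<close>

lemma octahedral_case:
  assumes AO: "A = binO" shows listed
proof -
  define e where "e = qcis (pi / 4)"
  have e_eq: "e = Quat (sqrt 2 / 2) (sqrt 2 / 2) 0 0" by (simp add: e_def qcis_pi_4)
  have T: "binT \<subseteq> A" using AO by (simp add: binO_def)
  have fm: "f (-1) = 1" by (rule kernel_contains_minus_one[OF T])
  have inT: "-1 \<in> binT" "1 \<in> binT" "Quat 0 0 1 0 \<in> binT" "Quat 0 0 0 1 \<in> binT" "omega \<in> binT"
    by (simp_all add: one_quat_def uminus_quat_def Quat_in_binT_iff)
  have inA: "-1 \<in> A" "Quat 0 0 1 0 \<in> A" "Quat 0 0 0 1 \<in> A" "omega \<in> A" using inT T by auto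
  have "e * 1 \<in> A" unfolding AO binO_def e_def using inT by blast
  then have eA: "e \<in> A" by simp
  have jk: "f (Quat 0 0 1 0) = 1" "f (Quat 0 0 0 1) = 1"
    using quaternion_group_in_kernel[OF T] by (simp_all add: binD2_explicit)
  have "f (e * Quat 0 0 1 0) = 1 \<or> f (e * Quat 0 0 1 0) = -1"
    using pure_sign[OF inA(1) fm] A_closed(1)[OF eA inA(2)] by (simp add: e_eq component_mult)
  then have fe: "f e = 1 \<or> f e = -1" using f_mult[OF eA inA(2)] jk by simp
  have ek: "e * Quat 0 0 0 1 \<in> A" "f (e * Quat 0 0 0 1) = f e"
    using A_closed(1)[OF eA inA(3)] f_mult[OF eA inA(3)] jk by simp_all
  have "f (omega * (e * Quat 0 0 0 1)) = 1 \<or> f (omega * (e * Quat 0 0 0 1)) = -1"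
    using pure_sign[OF inA(1) fm] A_closed(1)[OF inA(4) ek(1)] by (simp add: e_eq component_mult)
  then have "f omega * f e = 1 \<or> f omega * f e = -1" using f_mult[OF inA(4) ek(1)] ek(2) by simp
  then have "f omega = 1 \<or> f omega = -1" using fe by (auto simp: minus_equation_iff[of "f omega"])
  note fT = binT_in_kernel[OF T this]
  have feT: "f (e * x) = f e" if "x \<in> binT" for x using f_mult[OF eA, of x] fT[OF that] T that by auto
  have A_cases: "a \<in> binT \<or> (\<exists>x\<in>binT. a = e * x)" if "a \<in> A" for a
    using that unfolding AO binO_def e_def by blast
  have "f e \<noteq> 1" using nontriv A_cases fT feT by metis
  then have e1: "f e = -1" using fe by blast
  note m1 = minus_one_ne_one
  have "{x \<in> A. f x = 1} = binT"
  proof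
    show "{x \<in> A. f x = 1} \<subseteq> binT" using A_cases feT e1 m1 by fastforce
    show "binT \<subseteq> {x \<in> A. f x = 1}" using T fT by blast
  qed
  then show listed using listed_if_signs[of 1] A_cases fT feT e1 AO by (simp, metis)
qed

text \<open>
Since \<open>q k\<close> is pure and \<open>q\<^sup>5 = -1\<close>, the generator \<open>q\<close> is sent to
\<open>1\<close>; since \<open>q omega\<close> is pure, \<open>f omega\<close> is a sign. So \<open>f\<close>
is trivial.
\<close>

lemma icosahedral_impossible:
  assumes AI: "A = binI" shows False
proof -
  have bI: "icos_q ^ s * x \<in> A" if "x \<in> binT" "s \<le> 4" for s x
    unfolding AI binI_def using that by (intro UN_I[of s] imageI) auto
  have T: "binT \<subseteq> A" using bI[of _ 0] by auto
  have fm: "f (-1) = 1" by (rule kernel_contains_minus_one[OF T])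
  have inT: "-1 \<in> binT" "1 \<in> binT" "Quat 0 0 0 1 \<in> binT" "omega \<in> binT"
    by (simp_all add: one_quat_def uminus_quat_def Quat_in_binT_iff)
  have inA: "-1 \<in> A" "Quat 0 0 0 1 \<in> A" "omega \<in> A" using inT T by auto
  have qA: "icos_q \<in> A" using bI[of 1 1] inT by simp
  note m1 = minus_one_ne_one
  have k: "f (Quat 0 0 0 1) = 1"
    using quaternion_group_in_kernel[OF T] by (simp add: binD2_explicit)
  have "f (icos_q * Quat 0 0 0 1) = 1 \<or> f (icos_q * Quat 0 0 0 1) = -1"
    using pure_sign[OF inA(1) fm] A_closed(1)[OF qA inA(2)] by (simp add: icos_q_psi component_mult)
  then have fq: "f icos_q = 1 \<or> f icos_q = -1" using f_mult[OF qA inA(2)] k by simp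
  have "icos_q ^ 5 = -1" using pow5_of_Re A_closed(4)[OF qA] by (simp add: cos_pi_5_psi icos_q_psi)
  then have "f icos_q ^ 5 = 1" using f_power[OF qA, of 5] fm by simp
  then have q1: "f icos_q = 1" using fq m1 by (auto simp: uminus_power_if)
  have "f (icos_q * omega) = 1 \<or> f (icos_q * omega) = -1"
  proof (rule pure_sign[OF inA(1) fm A_closed(1)[OF qA inA(3)]])
    show "qRe (icos_q * omega) = 0" by (simp add: icos_q_psi component_mult field_simps)
  qed
  then have "f omega = 1 \<or> f omega = -1" using f_mult[OF qA inA(3)] q1 by simp
  note fT = binT_in_kernel[OF T this]
  have "f a = 1" if aA: "a \<in> A" for a
  proof -
    obtain s x where "x \<in> binT" "a = icos_q ^ s * x" using aA unfolding AI binI_def by blast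
    then show ?thesis using f_mult[OF subgroup_power[OF A(1) qA], of x s] f_power[OF qA, of s] q1 fT T by auto
  qed
  then show False using nontriv by blast
qed

end

section \<open>Binary dihedral first projection, even kernel\<close>

definition sign_hom :: "nat \<Rightarrow> (quat \<Rightarrow> quat) \<Rightarrow> bool" where
  "sign_hom n f \<longleftrightarrow> (\<forall>x\<in>binD n. f x = 1 \<or> f x = -1) \<and> (\<forall>x\<in>binD n. \<forall>y\<in>binD n. f (x * y) = f x * f y)"

text \<open>
Up to conjugation, \<open>f\<close> has a domain and a kernel from the list of index two pairs.
\<close>

definition sign_normal :: "nat \<Rightarrow> (quat \<Rightarrow> quat) \<Rightarrow> bool" where
  "sign_normal n f \<longleftrightarrow> (\<exists>g\<in>U.
     (\<exists>k\<ge>2. cj g ` binD n = binD (2 * k) \<and> cj g ` {x \<in> binD n. f x = 1} = binD k) \<or>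
     (\<exists>k\<ge>2. cj g ` binD n = binD k \<and> cj g ` {x \<in> binD n. f x = 1} = Zc (2 * k)))"

definition rot :: "nat \<Rightarrow> int \<Rightarrow> quat" where "rot n x = qcis (pi * of_int x / of_nat n)"

lemma rot_0 [simp]: "rot n 0 = 1" by (simp add: rot_def)

lemma binD_rot: "binD n = {rot n x | x. True} \<union> {quat_j * rot n x | x. True}"
  unfolding binD_def rot_def ..

lemma rot_add: "rot n (x + y) = rot n x * rot n y"
  by (simp add: rot_def qcis_add[symmetric] add_divide_distrib distrib_left)

lemma rot_in: "rot n x \<in> binD n" "quat_j * rot n x \<in> binD n"
  unfolding binD_rot by blast+

lemma binD_cases:
  assumes "a \<in> binD n" obtains x where "a = rot n x" | x where "a = quat_j * rot n x"
  using assms unfolding binD_rot by blast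

lemma rot_eq_Zc: "Zc (2 * n) = range (rot n)"
  unfolding Zc_def rot_def by auto

lemma sign_normal_transport:
  assumes h: "h \<in> U" "cj h ` binD n = binD n" and s: "sign_normal n (\<lambda>x. f (cj (qcnj h) x))"
  shows "sign_normal n f"
proof -
  have "{x \<in> cj h ` binD n. f (cj (qcnj h) x) = 1} = cj h ` {x \<in> binD n. f x = 1}" using h(1) by auto
  then have K: "{x \<in> binD n. f (cj (qcnj h) x) = 1} = cj h ` {x \<in> binD n. f x = 1}" by (simp only: h(2))
  obtain g where g: "g \<in> U" "(\<exists>k\<ge>2. cj g ` binD n = binD (2 * k) \<and> cj g ` {x \<in> binD n. f (cj (qcnj h) x) = 1} = binD k) \<or>
     (\<exists>k\<ge>2. cj g ` binD n = binD k \<and> cj g ` {x \<in> binD n. f (cj (qcnj h) x) = 1} = Zc (2 * k))"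
    using s unfolding sign_normal_def by blast
  have E1: "cj g ` binD n = cj (g * h) ` binD n" using arg_cong[OF h(2), of "\<lambda>X. cj g ` X"]
    by (simp add: image_image cj_cj)
  have E2: "cj g ` {x \<in> binD n. f (cj (qcnj h) x) = 1} = cj (g * h) ` {x \<in> binD n. f x = 1}"
    unfolding K by (simp add: image_image cj_cj)
  from g(2) have "(\<exists>k\<ge>2. cj (g * h) ` binD n = binD (2 * k) \<and> cj (g * h) ` {x \<in> binD n. f x = 1} = binD k) \<or>
     (\<exists>k\<ge>2. cj (g * h) ` binD n = binD k \<and> cj (g * h) ` {x \<in> binD n. f x = 1} = Zc (2 * k))"
    by (simp only: E1 E2)
  moreover have "g * h \<in> U" using g(1) h(1) by (rule U_mult)
  ultimately show ?thesis unfolding sign_normal_def by (rule bexI)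
qed

lemma sign_hom_transport:
  assumes h: "h \<in> U" "cj h ` binD n = binD n" and s: "sign_hom n f"
  shows "sign_hom n (\<lambda>x. f (cj (qcnj h) x))"
proof -
  have "cj (qcnj h) x \<in> binD n" if "x \<in> binD n" for x
  proof -
    obtain y where "y \<in> binD n" "x = cj h y" using \<open>x \<in> binD n\<close> h(2) by blast
    then show ?thesis using h(1) by simp
  qed
  then show ?thesis using s h(1) unfolding sign_hom_def by (simp add: cj_mult)
qed

lemma j_in_binD: "quat_j \<in> binD n" using rot_in(2)[of n 0] by simp

lemma sign_hom_rot:
  assumes "sign_hom n f" shows "f (rot n x) = (if even x then 1 else f (rot n 1))"
proof -
  have sq: "f (rot n y) * f (rot n y) = 1" for y using assms rot_in(1)[of n y] unfolding sign_hom_def by fastforce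
  have m: "f (rot n (y + z)) = f (rot n y) * f (rot n z)" for y z
    unfolding rot_add using assms rot_in(1)[where n = n] unfolding sign_hom_def by blast
  have ev: "f (rot n (2 * y)) = 1" for y using m[of y y] sq[of y] by (simp only: mult_2)
  show ?thesis
  proof (cases "even x")
    case True
    then obtain y where "x = 2 * y" by (auto elim!: evenE)
    then show ?thesis using ev True by simp
  next
    case False
    then obtain y where "x = 2 * y + 1" by (auto elim!: oddE)
    then show ?thesis using m[of "2 * y" 1] ev[of y] False by simp
  qed
qed

lemma sign_hom_j_rot: "sign_hom n f \<Longrightarrow> f (quat_j * rot n x) = f quat_j * f (rot n x)"
  unfolding sign_hom_def using rot_in(1) j_in_binD by blast

lemma sign_normal_rot_trivial:
  assumes s: "sign_hom n f" and n: "n \<ge> 2" and f: "f (rot n 1) = 1" "f quat_j = -1"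
  shows "sign_normal n f"
proof -
  have r: "f (rot n x) = 1" for x using sign_hom_rot[OF s, of x] f(1) by simp
  then have "f (quat_j * rot n x) = -1" for x using sign_hom_j_rot[OF s, of x] f(2) by simp
  then have "{x \<in> binD n. f x = 1} = Zc (2 * n)"
    unfolding rot_eq_Zc using r rot_in minus_one_ne_one by (auto elim!: binD_cases)
  then show ?thesis unfolding sign_normal_def using n by (intro bexI[of _ 1] disjI2 exI[of _ n]) auto
qed

text \<open>
A rotation by half a step normalises the dihedral group and exchanges the two classes of reflections.
\<close>

lemma cj_half_step:
  assumes "n > 0" defines "h \<equiv> qcis (pi / (2 * of_nat n))"
  shows "cj h (rot n x) = rot n x" "cj h (quat_j * rot n x) = quat_j * rot n (x - 1)"
    "cj h ` binD n = binD n"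
proof -
  show 1: "cj h (rot n x) = rot n x" for x
    by (simp add: rot_def cj_def h_def qcnj_qcis qcis_add[symmetric])
  have hh: "qcnj h * qcnj h = rot n (-1)" by (simp add: rot_def h_def qcnj_qcis qcis_add[symmetric])
  have j: "h * quat_j = quat_j * qcnj h" by (simp add: h_def qcnj_qcis j_qcis)
  have c: "qcnj h * rot n x = rot n x * qcnj h" for x by (simp add: rot_def h_def qcnj_qcis qcis_add[symmetric] add.commute)
  show 2: "cj h (quat_j * rot n x) = quat_j * rot n (x - 1)" for x
  proof -
    have "cj h (quat_j * rot n x) = h * quat_j * rot n x * qcnj h" by (simp add: cj_def mult.assoc)
    also have "\<dots> = quat_j * (qcnj h * rot n x) * qcnj h" by (simp add: j mult.assoc)
    also have "\<dots> = quat_j * (rot n x * (qcnj h * qcnj h))" by (simp add: c mult.assoc)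
    also have "\<dots> = quat_j * rot n (x - 1)" unfolding hh rot_add[symmetric] by simp
    finally show ?thesis .
  qed
  show "cj h ` binD n = binD n"
  proof
    show "cj h ` binD n \<subseteq> binD n" using 1 2 rot_in by (auto elim!: binD_cases)
    show "binD n \<subseteq> cj h ` binD n"
    proof
      fix a assume "a \<in> binD n"
      then show "a \<in> cj h ` binD n"
      proof (cases rule: binD_cases)
        case (1 x)
        then show ?thesis using \<open>cj h (rot n x) = rot n x\<close>[symmetric] rot_in(1) by (metis imageI)
      next
        case (2 x)
        have "a = cj h (quat_j * rot n (x + 1))" unfolding \<open>\<And>x. cj h (quat_j * rot n x) = quat_j * rot n (x - 1)\<close> 2 by simp
        then show ?thesis using rot_in(2) by blast
      qed
    qed
  qed
qed

text \<open>
The kernel consists of the even rotations and the even reflections. For \<open>n = 2\<close> it is \<open>{1,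
-1, j, -j}\<close>, and the symmetry of the quaternion group moves \<open>j\<close> to \<open>i\<close>, so
that this kernel becomes the group of rotations.
\<close>

lemma sign_normal_j_trivial:
  assumes s: "sign_hom n f" and n: "n \<ge> 2" "even n" and f: "f (rot n 1) = -1" "f quat_j = 1"
  shows "sign_normal n f"
proof -
  obtain k where k: "n = 2 * k" using n(2) by (auto elim: evenE)
  show ?thesis
  proof (cases "k \<ge> 2")
    case True
    have r: "f (rot n x) = (if even x then 1 else -1)" for x using sign_hom_rot[OF s, of x] f(1) by simp
    have jr: "f (quat_j * rot n x) = (if even x then 1 else -1)" for x using sign_hom_j_rot[OF s, of x] f(2) r by simp
    have "rot k x = rot n (2 * x)" for x by (simp add: rot_def k)
    then have "binD k = {rot n (2 * x) | x. True} \<union> {quat_j * rot n (2 * x) | x. True}" unfolding binD_rot by simp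
    also have "\<dots> = {x \<in> binD n. f x = 1}"
    proof
      show "{rot n (2 * x) | x. True} \<union> {quat_j * rot n (2 * x) | x. True} \<subseteq> {x \<in> binD n. f x = 1}"
        using r jr rot_in by auto
      show "{x \<in> binD n. f x = 1} \<subseteq> {rot n (2 * x) | x. True} \<union> {quat_j * rot n (2 * x) | x. True}"
      proof
        fix a assume a: "a \<in> {x \<in> binD n. f x = 1}"
        then have "a \<in> binD n" by simp
        then show "a \<in> {rot n (2 * x) | x. True} \<union> {quat_j * rot n (2 * x) | x. True}"
        proof (cases rule: binD_cases)
          case (1 x)
          then have "even x" using a r[of x] minus_one_ne_one by (auto split: if_splits)
          then show ?thesis using 1 by (auto elim!: evenE)
        next
          case (2 x)
          then have "even x" using a jr[of x] minus_one_ne_one by (auto split: if_splits)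
          then show ?thesis using 2 by (auto elim!: evenE)
        qed
      qed
    qed
    finally show ?thesis unfolding sign_normal_def using True k by (intro bexI[of _ 1] disjI1 exI[of _ k]) auto
  next
    case False
    then have n2: "n = 2" using k n(1) by simp
    \<comment> \<open>Conjugation by \<open>qcnj omega\<close> sends \<open>j\<close> to \<open>i\<close> and \<open>k\<close> to \<open>j\<close>.\<close>
    define h where "h = qcnj omega"
    have wU: "omega \<in> U" by (simp add: U_iff power2_eq_square)
    then have hU: "h \<in> U" by (simp add: h_def)
    have one: "cj (qcnj omega) 1 = 1" "cj (qcnj omega) (-1) = -1" using wU by simp_all
    have hD: "cj h ` binD n = binD n"
      unfolding n2 binD2_explicit h_def image_insert image_empty one cj_rot by auto
    have i: "rot n 1 = Quat 0 1 0 0" by (simp add: rot_def n2 qcis_def)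
    have j: "quat_j = Quat 0 0 1 0" by (simp add: quat_j_def)
    have "Quat 0 1 0 0 * quat_j = Quat 0 0 0 1" by (simp add: quat_arith)
    moreover have "f (rot n 1 * quat_j) = f (rot n 1) * f quat_j"
      using s rot_in(1)[of n 1] j_in_binD unfolding sign_hom_def by blast
    ultimately have fk: "f (Quat 0 0 0 1) = -1" using f i by simp
    show ?thesis
    proof (rule sign_normal_transport[OF hU hD], rule sign_normal_rot_trivial[OF sign_hom_transport[OF hU hD s] n(1)])
      show "f (cj (qcnj h) (rot n 1)) = 1" unfolding i h_def qcnj_qcnj cj_rot using f(2) by (simp add: j)
      show "f (cj (qcnj h) quat_j) = -1" unfolding j h_def qcnj_qcnj cj_rot by (rule fk)
    qed
  qed
qed

text \<open>
A homomorphism to signs is determined by its values on the rotation \<open>rot n 1\<close> and on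
\<open>j\<close>. The relation \<open>j\<^sup>2 = rot n n\<close> makes \<open>n\<close> even if the rotation
has value \<open>-1\<close>; a half step then makes the value on \<open>j\<close> equal to \<open>1\<close>.
\<close>

lemma sign_normal_exists:
  assumes s: "sign_hom n f" and n: "n \<ge> 2" and nontriv: "\<exists>x\<in>binD n. f x \<noteq> 1"
  shows "sign_normal n f"
proof -
  have j: "f quat_j = 1 \<or> f quat_j = -1" and t: "f (rot n 1) = 1 \<or> f (rot n 1) = -1"
    using s j_in_binD rot_in(1)[of n 1] unfolding sign_hom_def by blast+
  from t show ?thesis
  proof
    assume t1: "f (rot n 1) = 1"
    then have r: "f (rot n x) = 1" for x using sign_hom_rot[OF s, of x] by simp
    have "f quat_j \<noteq> 1"
    proof
      assume "f quat_j = 1"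
      then have "f (quat_j * rot n x) = 1" for x using sign_hom_j_rot[OF s, of x] r by simp
      then show False using nontriv r by (auto elim!: binD_cases)
    qed
    then show ?thesis using sign_normal_rot_trivial[OF s n t1] j by blast
  next
    assume t1: "f (rot n 1) = -1"
    have "f (quat_j * quat_j) = f quat_j * f quat_j" using s j_in_binD unfolding sign_hom_def by blast
    then have "f (-1) = 1" using j by auto
    moreover have "rot n (int n) = -1" using n by (simp add: rot_def)
    ultimately have "f (rot n (int n)) = 1" by simp
    then have ev: "even n" using sign_hom_rot[OF s, of "int n"] t1 minus_one_ne_one by (auto split: if_splits)
    from j show ?thesis
    proof
      assume "f quat_j = 1"
      then show ?thesis using sign_normal_j_trivial[OF s n ev t1] by blast
    next
      assume jm: "f quat_j = -1"
      define h where "h = qcis (pi / (2 * of_nat n))"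
      have n0: "n > 0" using n by simp
      have hU: "h \<in> U" by (simp add: h_def)
      note step = cj_half_step[OF n0, folded h_def]
      have ht: "cj (qcnj h) (rot n 1) = rot n 1" using step(1)[of 1] hU by (metis cj_inv(1))
      have "cj h (quat_j * rot n 1) = quat_j" using step(2)[of 1] by simp
      then have hj: "cj (qcnj h) quat_j = quat_j * rot n 1" using hU by (metis cj_inv(1))
      have fj: "f (quat_j * rot n 1) = 1" using sign_hom_j_rot[OF s, of 1] jm t1 by simp
      show ?thesis
      proof (rule sign_normal_transport[OF hU step(3)], rule sign_normal_j_trivial[OF sign_hom_transport[OF hU step(3) s] n ev])
        show "f (cj (qcnj h) (rot n 1)) = -1" unfolding ht by (rule t1)
        show "f (cj (qcnj h) quat_j) = 1" unfolding hj by (rule fj)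
      qed
    qed
  qed
qed

context free_graph
begin

lemma dihedral_even_kernel_case:
  assumes An: "A = binD n" and n: "n \<ge> 2" and fm: "f (-1) = 1"
  shows listed
proof -
  have m1: "-1 \<in> A" using rot_in(1)[of n "int n"] n by (simp add: An rot_def)
  have jA: "quat_j \<in> A" using j_in_binD An by simp
  have pj: "f (quat_j * rot n x) = 1 \<or> f (quat_j * rot n x) = -1" for x
    using pure_sign[OF m1 fm, of "quat_j * rot n x"] rot_in(2) by (simp add: An rot_def quat_arith)
  have sgn: "f a = 1 \<or> f a = -1" if "a \<in> A" for a
  proof -
    from that have "a \<in> binD n" by (simp add: An)
    then show ?thesis
    proof (cases rule: binD_cases)
      case (1 x)
      have "f (quat_j * rot n x) = f quat_j * f (rot n x)" using f_mult[OF jA] rot_in(1) An by blast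
      moreover have "f quat_j = 1 \<or> f quat_j = -1" using pj[of 0] by simp
      ultimately show ?thesis using pj[of x] 1 by (auto simp: minus_equation_iff[of "f (rot n x)"])
    next
      case (2 x)
      then show ?thesis using pj by blast
    qed
  qed
  have "sign_hom n f" using sgn f_mult unfolding sign_hom_def An by blast
  then have "sign_normal n f" using sign_normal_exists[OF _ n] nontriv An by blast
  then obtain g where g: "g \<in> U" "(\<exists>k\<ge>2. cj g ` A = binD (2 * k) \<and> cj g ` {x \<in> A. f x = 1} = binD k) \<or>
     (\<exists>k\<ge>2. cj g ` A = binD k \<and> cj g ` {x \<in> A. f x = 1} = Zc (2 * k))"
    unfolding sign_normal_def An by blast
  show listed by (rule listed_if_signs[OF sgn g(1)]) (use g(2) in argo)+
qed

end

section \<open>Binary dihedral first projection, odd kernel\<close>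

lemma rot_eq_iff: "n > 0 \<Longrightarrow> rot n x = rot n y \<longleftrightarrow> 2 * int n dvd x - y"
  using qcis_frac_eq_iff[of "2 * n" x y] by (simp add: rot_def)

lemma j_rot_ne_rot: "quat_j * rot n x \<noteq> rot n' y"
proof
  assume "quat_j * rot n x = rot n' y"
  then have "cos (pi * of_int y / of_nat n') = 0" "sin (pi * of_int y / of_nat n') = 0"
    by (simp_all add: quat_eq_iff component_mult rot_def) (simp_all add: quat_arith)
  then show False using sin_cos_squared_add[of "pi * of_int y / of_nat n'"] by simp
qed

lemma j_cancel: "quat_j * x = quat_j * y \<longleftrightarrow> x = y"
  by (metis U_j cancel_left(1))

lemma rot_power: "rot n x ^ p = rot n (int p * x)"
  by (simp add: rot_def qcis_power algebra_simps)

lemma rot_scale: "d > 0 \<Longrightarrow> rot (l * d) (x * int d) = rot l x"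
  by (simp add: rot_def)

lemma projD_rot:
  assumes "l > 0"
  shows "projD k l (rot (l * (2 * k + 1)) y) = rot l y"
    "projD k l (quat_j * rot (l * (2 * k + 1)) y) = quat_j * rot l y"
proof -
  have N: "l * (2 * k + 1) > 0" using assms by simp
  have dv: "2 * int l dvd 2 * int (l * (2 * k + 1))" by simp
  have eq: "rot l y = rot l y'" if "rot (l * (2 * k + 1)) y = rot (l * (2 * k + 1)) y'" for y'
    using that unfolding rot_eq_iff[OF N] rot_eq_iff[OF assms] using dv dvd_trans by blast
  have P: "projD k l x = (THE z. \<exists>y. (x = rot (l * (2 * k + 1)) y \<and> z = rot l y) \<or>
     (x = quat_j * rot (l * (2 * k + 1)) y \<and> z = quat_j * rot l y))" for x
    unfolding projD_def rot_def ..
  show "projD k l (rot (l * (2 * k + 1)) y) = rot l y"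
    unfolding P
  proof (rule the_equality)
    fix z assume "\<exists>y'. (rot (l * (2 * k + 1)) y = rot (l * (2 * k + 1)) y' \<and> z = rot l y') \<or>
     (rot (l * (2 * k + 1)) y = quat_j * rot (l * (2 * k + 1)) y' \<and> z = quat_j * rot l y')"
    then show "z = rot l y" using eq j_rot_ne_rot by metis
  qed blast
  show "projD k l (quat_j * rot (l * (2 * k + 1)) y) = quat_j * rot l y"
    unfolding P
  proof (rule the_equality)
    fix z assume "\<exists>y'. (quat_j * rot (l * (2 * k + 1)) y = rot (l * (2 * k + 1)) y' \<and> z = rot l y') \<or>
     (quat_j * rot (l * (2 * k + 1)) y = quat_j * rot (l * (2 * k + 1)) y' \<and> z = quat_j * rot l y')"
    then show "z = quat_j * rot l y" using eq j_rot_ne_rot unfolding j_cancel by metis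
  qed blast
qed

text \<open>
The generator \<open>s\<close> of the reflections in \<open>autD\<close> is \<open>j\<close> times one
rotation step. The offset \<open>b = a - 1\<close> is the one for which \<open>j\<close> itself is fixed.
\<close>

lemma autD_rot:
  assumes l: "l > 0" and b: "[int b = int a - 1] (mod (2 * int l))"
  shows "autD l a b (rot l y) = rot l (int a * y)"
    "autD l a b (quat_j * rot l y) = quat_j * rot l (int a * y)"
proof -
  have t: "qcis (pi / of_nat l) = rot l 1" by (simp add: rot_def)
  have s: "quat_j * rot l 1 * rot l p = quat_j * rot l (p + 1)" for p
    by (simp add: rot_add mult.assoc) (metis rot_add add.commute)
  have P: "autD l a b x = (THE z. \<exists>p::nat. (x = rot l (int p) \<and> z = rot l (int (a * p))) \<or>
     (x = quat_j * rot l (int p + 1) \<and> z = quat_j * rot l (int (a * p + b) + 1)))" for x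
    unfolding autD_def Let_def t rot_power s by simp
  \<comment> \<open>The definition of \<open>autD\<close> quantifies over natural exponents.\<close>
  have nat_rep: "\<exists>p::nat. rot l x = rot l (int p)" for x
  proof -
    have "2 * int l dvd x - int (nat (x mod (2 * int l)))" using l by (simp add: minus_mod_eq_mult_div)
    then show ?thesis using rot_eq_iff[OF l] by blast
  qed
  have mult: "rot l (int a * x) = rot l (int a * x')" if "rot l x = rot l x'" for x x'
    using that unfolding rot_eq_iff[OF l] right_diff_distrib[symmetric] by simp
  have jval: "rot l (int (a * p + b) + 1) = rot l (int a * y)" if "rot l (int p + 1) = rot l y" for p y
  proof -
    have "rot l (int a * (int p + 1)) = rot l (int a * y)" using mult that by blast
    moreover have "rot l (int (a * p + b) + 1) = rot l (int a * (int p + 1))"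
    proof -
      have e: "int (a * p + b) + 1 - int a * (int p + 1) = int b - (int a - 1)" by (simp add: algebra_simps)
      show ?thesis unfolding rot_eq_iff[OF l] e using b by (simp only: cong_iff_dvd_diff)
    qed
    ultimately show ?thesis by simp
  qed
  show "autD l a b (rot l y) = rot l (int a * y)"
    unfolding P
  proof (rule the_equality)
    obtain p where p: "rot l y = rot l (int p)" using nat_rep by blast
    have "rot l (int a * y) = rot l (int (a * p))" using mult[OF p] by (simp only: of_nat_mult)
    then show "\<exists>p::nat. (rot l y = rot l (int p) \<and> rot l (int a * y) = rot l (int (a * p))) \<or>
     (rot l y = quat_j * rot l (int p + 1) \<and> rot l (int a * y) = quat_j * rot l (int (a * p + b) + 1))"
      using p by blast
  next
    fix z assume "\<exists>p::nat. (rot l y = rot l (int p) \<and> z = rot l (int (a * p))) \<or>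
     (rot l y = quat_j * rot l (int p + 1) \<and> z = quat_j * rot l (int (a * p + b) + 1))"
    then obtain p :: nat where "rot l y = rot l (int p)" "z = rot l (int (a * p))" using j_rot_ne_rot by metis
    then show "z = rot l (int a * y)" using mult[of y "int p"] by (simp only: of_nat_mult)
  qed
  show "autD l a b (quat_j * rot l y) = quat_j * rot l (int a * y)"
    unfolding P
  proof (rule the_equality)
    obtain p where "rot l (y - 1) = rot l (int p)" using nat_rep by blast
    then have p: "rot l y = rot l (int p + 1)" unfolding rot_eq_iff[OF l] by (simp add: algebra_simps)
    then have "rot l (int a * y) = rot l (int (a * p + b) + 1)" using jval by metis
    then show "\<exists>p::nat. (quat_j * rot l y = rot l (int p) \<and> quat_j * rot l (int a * y) = rot l (int (a * p))) \<or>
     (quat_j * rot l y = quat_j * rot l (int p + 1) \<and> quat_j * rot l (int a * y) = quat_j * rot l (int (a * p + b) + 1))"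
      using p by metis
  next
    fix z assume "\<exists>p::nat. (quat_j * rot l y = rot l (int p) \<and> z = rot l (int (a * p))) \<or>
     (quat_j * rot l y = quat_j * rot l (int p + 1) \<and> z = quat_j * rot l (int (a * p + b) + 1))"
    then obtain p :: nat where "rot l y = rot l (int p + 1)" "z = quat_j * rot l (int (a * p + b) + 1)"
      using j_rot_ne_rot unfolding j_cancel by metis
    then show "z = quat_j * rot l (int a * y)" using jval by metis
  qed
qed

text \<open>
With \<open>j\<close> fixed by \<open>f\<close>, the inner automorphism can be taken trivial.
\<close>

lemma goursat_dihedral:
  assumes l: "l > 0" and r: "r > 0" and f: "\<And>x. f (rot (l * (2 * k + 1)) x) = rot l (int r * x)"
    "\<And>x. f (quat_j * rot (l * (2 * k + 1)) x) = quat_j * rot l (int r * x)"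
  shows "prod3 (goursat (binD (l * (2 * k + 1))) (Zc (2 * k + 1)) (binD l) {1}
      (iso_of (projD k l) (conj_by 1 \<circ> autD l r ((r - 1) mod (2 * l))))) D = triples f (binD (l * (2 * k + 1))) D"
proof (rule goursat_graph)
  have b: "[int ((r - 1) mod (2 * l)) = int r - 1] (mod (2 * int l))"
    using r by (simp add: zmod_int of_nat_diff cong_def)
  have conj1: "conj_by 1 x = x" for x by (simp add: conj_by_def)
  show "1 \<in> Zc (2 * k + 1)" using qcis_in_Zc[of 0 "2 * k + 1"] by simp
  fix a assume a: "a \<in> binD (l * (2 * k + 1))"
  show "(conj_by 1 \<circ> autD l r ((r - 1) mod (2 * l))) (projD k l a) = f a"
    using a by (cases rule: binD_cases) (simp_all only: projD_rot[OF l] autD_rot[OF l b] f comp_apply conj1)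
  show "f a \<in> binD l" using a by (cases rule: binD_cases) (simp_all only: f rot_in)
  fix h assume "h \<in> Zc (2 * k + 1)"
  then obtain x :: int where "h = qcis (2 * pi * of_int x / of_nat (2 * k + 1))" unfolding Zc_def by blast
  then have "h = rot (2 * k + 1) (2 * x)" by (simp add: rot_def mult_ac)
  then have h: "h = rot (l * (2 * k + 1)) (2 * int l * x)"
    using rot_scale[OF l, of "2 * k + 1" "2 * x"] by (simp only: mult_ac)
  have e: "rot l (y + 2 * (int l * x)) = rot l y" for y unfolding rot_eq_iff[OF l] by simp
  show "projD k l (a * h) = projD k l a"
    using a by (cases rule: binD_cases) (simp_all only: h mult.assoc rot_add[symmetric] projD_rot[OF l] e)
qed

lemma order_four:
  assumes "x \<in> U" "x ^ 4 = 1" "x \<noteq> 1" shows "qRe x = -1 \<or> qRe x = 0"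
proof -
  have "x ^ 4 = (x * x) * (x * x)" by (simp add: numeral_eq_Suc mult.assoc)
  then have "(x * x) * (x * x) = 1" using assms(2) by simp
  then have "x * x = 1 \<or> x * x = -1" using sqrt_one[of "x * x"] assms(1) by simp
  then show ?thesis
  proof
    assume "x * x = 1"
    then have "x = -1" using sqrt_one[OF assms(1)] assms(3) by blast
    then show ?thesis by simp
  next
    assume "x * x = -1"
    then have "qRe (x * x) = -1" by simp
    moreover have "qRe (x * x) = 2 * (qRe x * qRe x) - 1" using assms(1) by (simp add: component_mult U_iff power2_eq_square)
    ultimately show ?thesis by simp
  qed
qed

context free_graph
begin

text \<open>
Since \<open>(-1, -1) \<in> C\<close>, freeness gives \<open>-1 \<notin> D\<close> and \<open>D\<close> is
cyclic of odd order. Write the image of the generating rotation as the power \<open>s\<close> of a root of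
unity of order \<open>2n\<close>, and let \<open>d = gcd s n\<close>, \<open>n = l d\<close>. As
\<open>-1\<close> is sent to \<open>-1\<close>, \<open>s\<close> and \<open>d = 2k + 1\<close> are odd. If
\<open>d = 1\<close>, \<open>f\<close> would be injective, and if \<open>l \<le> 2\<close>, every image has
order dividing four, whereas \<open>D\<close> has no element of order two or four with which it could share a
real part. The images of reflections are pure, which puts \<open>f j\<close> perpendicular to the axis of the
rotations; a rotation about this axis moves it to \<open>j\<close>.
\<close>

lemma dihedral_odd_kernel_case:
  assumes An: "A = binD n" and n: "n \<ge> 2" and fm: "f (-1) \<noteq> 1"
  shows listed
proof -
  have n0: "n > 0" using n by simp
  have rotn: "rot n (int n) = -1" using n0 by (simp add: rot_def)
  have rA: "rot n x \<in> A" "quat_j * rot n x \<in> A" for x unfolding An by (rule rot_in)+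
  have jA: "quat_j \<in> A" using j_in_binD An by simp
  have m1A: "-1 \<in> A" using rA(1)[of "int n"] by (simp only: rotn)
  have fm1: "f (-1) = -1" using f_minus_one[OF m1A] fm by blast
  have m1D: "-1 \<notin> D" using free[OF m1A, of "-1"] fm1 minus_one_ne_one by auto
  have jrot_sq: "quat_j * rot n x * (quat_j * rot n x) = -1" for x
    using A_closed(4)[OF rA(2)] by (intro pure_square) (simp_all add: rot_def quat_arith)
  have fjrot_sq: "f (quat_j * rot n x) * f (quat_j * rot n x) = -1" for x
    using f_mult[OF rA(2) rA(2), of x x] by (simp only: jrot_sq fm1)

  obtain g3 where g3: "g3 \<in> U" "ADE (cj g3 ` D)" using finite_subgroup_ADE[OF D] by metis
  have "-1 \<notin> cj g3 ` D" using m1D minus_one_in_conj[OF g3(1)] by blast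
  then obtain m where m: "m \<ge> 2" "odd m" "cj g3 ` D = Zc m" using ADE_without_minus_one[OF g3(2)] by metis

  have N0: "2 * n > 0" using n0 by simp
  have t: "qcis (2 * pi / of_nat (2 * n)) = rot n 1" by (simp add: rot_def)
  have tN: "qcis (2 * pi * of_int x / of_nat (2 * n)) = rot n x" for x by (simp add: rot_def)
  have tpow: "rot n 1 ^ (2 * n) = 1"
    unfolding rot_power using rot_eq_iff[OF n0, of "int (2 * n)" 0] by simp
  obtain g s where g: "g \<in> U" and s: "cj g (f (rot n 1)) = rot n (int s)"
    using generator_image[OF rA(1) tpow N0] unfolding tN by metis
  have fz: "cj g (f (rot n x)) = rot n (int s * x)" for x
    using cyclic_hom[OF N0 _ g, of "int s" x] rA(1)[of 1] s unfolding t tN by blast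
  have "odd s"
  proof
    assume "even s"
    then obtain w where w: "s = 2 * w" by (auto elim: evenE)
    have "cj g (f (-1)) = rot n (int s * int n)" using fz[of "int n"] unfolding rotn .
    also have "\<dots> = rot n 0" unfolding rot_eq_iff[OF n0] by (simp add: w)
    finally have "-1 = (1::quat)" using g by (simp add: fm1)
    then show False using minus_one_ne_one by blast
  qed
  \<comment> \<open>The common divisor is taken with \<open>n\<close>, not with the order \<open>2n\<close> of the rotation; as it is odd, this makes no difference.\<close>
  obtain r l where rl: "s = r * gcd s n" "n = l * gcd s n" "coprime r l"
    using gcd_coprime_exists[of s n] n0 by auto
  define d where "d = gcd s n"
  have d: "s = r * d" "n = l * d" using rl by (simp_all add: d_def)
  have "odd d" "odd r" using \<open>odd s\<close> d(1) by auto
  then obtain k where k: "d = 2 * k + 1" by (auto elim: oddE)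
  have l0: "l > 0" and r0: "r > 0" using n0 d \<open>odd r\<close> by (auto intro: Nat.gr0I)
  have co: "coprime r (2 * l)" using rl(3) \<open>odd r\<close> by simp
  have nl: "n = l * (2 * k + 1)" using d(2) k by simp
  have reduce: "rot n (int s * x) = rot l (int r * x)" for x
  proof -
    have "d > 0" using \<open>odd d\<close> by (auto intro: Nat.gr0I)
    moreover have "int s * x = (int r * x) * int d" by (simp add: d(1))
    ultimately show ?thesis using rot_scale[of d l "int r * x"] by (simp only: d(2))
  qed
  have fz': "cj g (f (rot n x)) = rot l (int r * x)" for x unfolding fz reduce ..

  have k1: "k \<ge> 1"
  proof (rule ccontr)
    assume "\<not> k \<ge> 1"
    then have nl': "n = l" using nl by simp
    obtain a where a: "a \<in> A" "a \<noteq> 1" "f a = 1" using ker by blast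
    from a(1) have "a \<in> binD n" by (simp add: An)
    then show False
    proof (cases rule: binD_cases)
      case (1 x)
      have "rot l (int r * x) = rot l 0" using fz'[of x] a(3) g 1 by simp
      then have "int (2 * l) dvd int r * x" unfolding rot_eq_iff[OF l0] by simp
      moreover have "coprime (int (2 * l)) (int r)" using co by (simp only: coprime_int_iff coprime_commute)
      ultimately have "int (2 * l) dvd x" by (metis coprime_dvd_mult_right_iff)
      then have "rot n x = rot n 0" unfolding rot_eq_iff[OF n0] by (simp add: nl')
      then show False using a 1 by simp
    next
      case (2 x)
      then show False using fjrot_sq[of x] a(3) minus_one_ne_one by simp
    qed
  qed

  have l3: "l > 2"
  proof (rule ccontr)
    assume "\<not> l > 2"
    then have l12: "l = 1 \<or> l = 2" using l0 by linarith
    obtain b e where b: "b \<in> A" and e: "e \<in> D" "e \<noteq> 1" "qRe (f b) = qRe e" using overlap by metis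
    have eU: "e \<in> U" by (rule D_U[OF e(1)])
    have "qRe e \<noteq> 1" using U_Re_one[OF eU] e(2) by blast
    then have ne: "f b \<noteq> 1" using e(3) by auto
    from b have "b \<in> binD n" by (simp add: An)
    then have "f b ^ 4 = 1"
    proof (cases rule: binD_cases)
      case (1 x)
      have "cj g (f b ^ 4) = rot l (4 * (int r * x))" unfolding cj_power[OF g] 1 fz' rot_power by simp
      also have "\<dots> = rot l 0" unfolding rot_eq_iff[OF l0] using l12 by auto
      also have "\<dots> = cj g 1" using g by simp
      finally show ?thesis using cj_inj[OF g] by blast
    next
      case (2 x)
      have "f b ^ 4 = (f b * f b) * (f b * f b)" by (simp add: numeral_eq_Suc mult.assoc)
      then show ?thesis using fjrot_sq[of x] 2 by simp
    qed
    then have "qRe e = -1 \<or> qRe e = 0" using order_four[OF f_U[OF b]] ne e(3) by simp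
    then show False
    proof
      assume "qRe e = -1"
      then have "e = -1" using U_Re_minus_one[OF eU] by blast
      then show False using m1D e(1) by blast
    next
      assume "qRe e = 0"
      then have "e * e = -1" using pure_square[OF eU] by blast
      then show False using m1D subgroupD(3)[OF D(1) e(1) e(1)] by simp
    qed
  qed

  define v where "v = cj g (f quat_j)"
  have v: "v \<in> U" using f_U[OF jA] g by (simp add: v_def)
  have pure: "qRe (f (quat_j * rot n x)) = 0" for x
  proof -
    have w: "f (quat_j * rot n x) \<in> U" using f_U[OF rA(2)] .
    have "qRe (f (quat_j * rot n x) * f (quat_j * rot n x)) = -1" unfolding fjrot_sq by simp
    moreover have "qRe (f (quat_j * rot n x) * f (quat_j * rot n x)) = 2 * (qRe (f (quat_j * rot n x)) * qRe (f (quat_j * rot n x))) - 1"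
      using w by (simp add: component_mult U_iff power2_eq_square)
    ultimately show ?thesis by simp
  qed
  have vR: "qRe v = 0" using pure[of 0] g by (simp add: v_def)
  have "cj g (f (quat_j * rot n 1)) = v * rot l (int r)"
    using f_mult[OF jA rA(1), of 1] fz'[of 1] g by (simp add: cj_mult v_def)
  then have "qRe (v * rot l (int r)) = 0" using pure[of 1] g by (metis Re_cj)
  then have "qI v * sin (pi * of_int (int r) / of_nat l) = 0"
    by (simp add: component_mult vR rot_def) (simp add: qcis_def)
  moreover have "sin (pi * of_int (int r) / of_nat l) \<noteq> 0"
  proof
    assume "sin (pi * of_int (int r) / of_nat l) = 0"
    then obtain w :: int where "pi * of_int (int r) / of_nat l = of_int w * pi" unfolding sin_zero_iff_int2 by blast
    then have "pi * real_of_int (int r) = pi * real_of_int (int l * w)" using l0 by (simp add: field_simps)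
    then have "real_of_int (int r) = real_of_int (int l * w)" by simp
    then have "int r = int l * w" by (simp only: of_int_eq_iff)
    then have "int l dvd int r" by simp
    then have "l dvd r" by simp
    then have "l = 1" using rl(3) by (metis coprime_common_divisor_nat dvd_refl)
    then show False using l3 by simp
  qed
  ultimately have vI: "qI v = 0" by simp
  obtain \<sigma> where \<sigma>: "cj (qcis \<sigma>) v = quat_j" using conj_to_j[OF v vR vI] by metis
  define g2 where "g2 = qcis \<sigma> * g"
  have g2: "g2 \<in> U" using g by (simp add: g2_def)
  have F1: "cj g2 (f (rot n x)) = rot l (int r * x)" for x
  proof -
    have "cj g2 (f (rot n x)) = cj (qcis \<sigma>) (rot l (int r * x))" by (simp add: g2_def cj_cj[symmetric] fz')
    also have "\<dots> = rot l (int r * x)" by (simp add: cj_def rot_def qcnj_qcis qcis_add[symmetric])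
    finally show ?thesis .
  qed
  have Fj: "cj g2 (f quat_j) = quat_j" by (simp add: g2_def cj_cj[symmetric] v_def[symmetric] \<sigma>)
  have F2: "cj g2 (f (quat_j * rot n x)) = quat_j * rot l (int r * x)" for x
    using f_mult[OF jA rA(1), of x] F1[of x] Fj g2 by (simp add: cj_mult)
  define H where "H = triples (\<lambda>x. cj g2 (f x)) A (cj g3 ` D)"
  have H: "H = prod3 (goursat (binD (l * (2 * k + 1))) (Zc (2 * k + 1)) (binD l) {1}
      (iso_of (projD k l) (conj_by 1 \<circ> autD l r ((r - 1) mod (2 * l))))) (Zc m)"
    unfolding H_def An nl m(3)
    using goursat_dihedral[OF l0 r0, of "\<lambda>x. cj g2 (f x)" k] F1 F2 unfolding nl by blast
  have FN: "cj g2 (f (qcis (2 * pi * of_int x / of_nat (2 * n)))) = qcis (2 * pi * of_int (int s * x) / of_nat (2 * n))" for x :: int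
    unfolding tN F1 reduce ..
  have inN: "qcis (2 * pi * of_int x / of_nat (2 * n)) \<in> A" for x :: int unfolding tN by (rule rA)
  have intN: "2 * int l * (2 * int k + 1) = int (2 * n)" by (simp add: nl algebra_simps)
  have ints: "int r * (2 * int k + 1) = int s" by (simp add: d(1) k algebra_simps)
  have gc: "gcd \<kappa> (int m) = 1" if \<kappa>: "\<kappa> \<in> {gcd (1 - int r * (2 * int k + 1)) (2 * int l * (2 * int k + 1)),
      gcd (1 + int r * (2 * int k + 1)) (2 * int l * (2 * int k + 1))}" for \<kappa>
  proof (rule coprime_if_no_prime)
    show "\<kappa> > 0" using \<kappa> n0 unfolding intN by auto
    fix p :: nat assume p: "prime p" "int p dvd \<kappa>" "int p dvd int m"
    have 1: "\<kappa> dvd int (2 * n)" "\<kappa> dvd 1 - int s \<or> \<kappa> dvd 1 + int s" using \<kappa> unfolding intN ints by auto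
    have "qcis (2 * pi / of_nat p) \<in> cj g3 ` D" using qcis_prime_in_Zc[of p m] p(3) m by simp
    then show False using prime_condition[OF 1 N0 inN FN g2 g3(1) p(1,2)] Re_qcis by blast
  qed
  have nodvd: "\<not> (2 * int k + 1) dvd 1" using k1 by simp
  have c1: "\<not> [int r * (2 * int k + 1) = 1] (mod (2 * int l * (2 * int k + 1)))"
  proof
    assume "[int r * (2 * int k + 1) = 1] (mod (2 * int l * (2 * int k + 1)))"
    then have "(2 * int k + 1) dvd int r * (2 * int k + 1) - 1" unfolding cong_iff_dvd_diff by (rule dvd_mult_right)
    then show False using nodvd by (metis dvd_diff_right_iff dvd_triv_right)
  qed
  have c2: "\<not> [int r * (2 * int k + 1) = - 1] (mod (2 * int l * (2 * int k + 1)))"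
  proof
    assume "[int r * (2 * int k + 1) = - 1] (mod (2 * int l * (2 * int k + 1)))"
    then have "(2 * int k + 1) dvd int r * (2 * int k + 1) - (-1)" unfolding cong_iff_dvd_diff by (rule dvd_mult_right)
    then show False using nodvd by (simp add: dvd_add_right_iff)
  qed
  have m4: "\<not> 4 dvd m" using m(2) by (metis dvd_trans even_numeral numeral_Bit0_eq_double dvd_triv_left)
  have "in_dihedral_family H" unfolding in_dihedral_family_def Let_def
  proof (rule exI[of _ k], rule exI[of _ l], rule exI[of _ r], rule exI[of _ "(r - 1) mod (2 * l)"], rule exI[of _ 1], rule exI[of _ m],
      intro conjI)
    show "1 \<in> binD l" using rot_in(1)[of l 0] by simp
    show "(r - 1) mod (2 * l) < 2 * l" using l0 by simp
  qed (use k1 l3 co m(1) H c1 c2 m4 gc in auto)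
  then show listed using listedI_second[OF g2 g3(1) H_def] by blast
qed

end

context free_graph
begin

theorem listed_if_ADE:
  assumes "ADE A" shows listed
  using assms unfolding ADE_def
proof (elim disjE exE conjE)
  show listed if "2 \<le> n" "A = Zc n" for n using cyclic_case that by blast
  show listed if "2 \<le> n" "A = binD n" for n
    using dihedral_even_kernel_case[OF that(2,1)] dihedral_odd_kernel_case[OF that(2,1)] by blast
  show listed if "A = binT" using tetrahedral_impossible that by blast
  show listed if "A = binO" using octahedral_case that by blast
  show listed if "A = binI" using icosahedral_impossible that by blast
qed

end

section \<open>Type II groups as graphs\<close>

lemma not_ADE_trivial: "\<not> ADE {1}"
proof
  assume "ADE {1}"
  moreover have "-1 \<notin> {1::quat}" using minus_one_ne_one by simp
  ultimately obtain m where m: "m \<ge> 2" "{1} = Zc m" using ADE_without_minus_one by metis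
  then have "qcis (2 * pi / of_nat m) \<in> {1}" using qcis_prime_in_Zc[of m m] by simp
  then have "qRe (qcis (2 * pi / of_nat m)) = 1" by simp
  then show False using cos_prime_ne[OF m(1)] by simp
qed

lemma conjugate_SU2_iff: "H \<subseteq> U \<Longrightarrow> conjugate SU2 H H' \<longleftrightarrow> (\<exists>g\<in>U. H' = cj g ` H)"
  unfolding conjugate_def by (intro bex_cong refl arg_cong2[of _ _ _ _ "(=)"] image_cong) (simp_all add: cj_def)

lemma subgroup_SU2sqD:
  assumes "subgroup C SU2sq"
  shows "(a, b) \<in> C \<Longrightarrow> a \<in> U \<and> b \<in> U" "(1, 1) \<in> C"
    "(a, b) \<in> C \<Longrightarrow> (a', b') \<in> C \<Longrightarrow> (a * a', b * b') \<in> C"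
    "(a, b) \<in> C \<Longrightarrow> (qcnj a, qcnj b) \<in> C"
proof -
  show U: "a \<in> U \<and> b \<in> U" if "(a, b) \<in> C" for a b
    using subgroup.subset[OF assms] that by (auto simp: DirProd_def)
  show "(1, 1) \<in> C" using subgroup.one_closed[OF assms] by (simp add: DirProd_def)
  show "(a, b) \<in> C \<Longrightarrow> (a', b') \<in> C \<Longrightarrow> (a * a', b * b') \<in> C"
    using subgroup.m_closed[OF assms, of "(a, b)" "(a', b')"] by (simp add: DirProd_def)
  show "(qcnj a, qcnj b) \<in> C" if "(a, b) \<in> C"
    using subgroup.m_inv_closed[OF assms that] U[OF that] by (simp add: inv_DirProd group_SU2)
qed

lemma conjugate_G3:
  assumes "g1 \<in> U" "g2 \<in> U" "g3 \<in> U" "H \<subseteq> U \<times> U \<times> U"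
  shows "conjugate G3 H {(cj g1 a, cj g2 b, cj g3 d) | a b d. (a, b, d) \<in> H}"
proof -
  have inv: "inv\<^bsub>G3\<^esub> (g1, g2, g3) = (qcnj g1, qcnj g2, qcnj g3)"
    using assms by (simp add: inv_DirProd group_SU2 DirProd_group)
  have "(g1, g2, g3) \<otimes>\<^bsub>G3\<^esub> (a, b, d) \<otimes>\<^bsub>G3\<^esub> (qcnj g1, qcnj g2, qcnj g3) = (cj g1 a, cj g2 b, cj g3 d)" for a b d
    by (simp add: DirProd_def cj_def)
  then have "(\<lambda>h. (g1, g2, g3) \<otimes>\<^bsub>G3\<^esub> h \<otimes>\<^bsub>G3\<^esub> inv\<^bsub>G3\<^esub> (g1, g2, g3)) ` H =
      (\<lambda>(a, b, d). (cj g1 a, cj g2 b, cj g3 d)) ` H"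
    unfolding inv by (intro image_cong refl) (simp only: split_paired_all prod.case)
  also have "\<dots> = {(cj g1 a, cj g2 b, cj g3 d) | a b d. (a, b, d) \<in> H}" by (auto intro: image_eqI[rotated])
  finally have "{(cj g1 a, cj g2 b, cj g3 d) | a b d. (a, b, d) \<in> H} =
      (\<lambda>h. (g1, g2, g3) \<otimes>\<^bsub>G3\<^esub> h \<otimes>\<^bsub>G3\<^esub> inv\<^bsub>G3\<^esub> (g1, g2, g3)) ` H" ..
  moreover have "(g1, g2, g3) \<in> carrier G3" using assms by (simp add: carrier_G3)
  ultimately show ?thesis unfolding conjugate_def by blast
qed

text \<open>
The function \<open>f\<^sub>0\<close> with graph \<open>C\<close> exists because two partners of one
\<open>a\<close> differ by an element of \<open>B\<^sub>0\<close>. Moving \<open>A\<close> to standard form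
first makes the case distinction applicable; the conjugations found there are composed with this one.
\<close>

lemma free_type_II_listed:
  fixes C :: "(quat \<times> quat) set" and D :: "quat set"
  assumes "type_II C D"
    and "acts_freely (prod3 C D)"
    and "\<not> (\<exists>S. splittable S \<and> acts_freely S \<and> prod3 C D \<subseteq> S)"
  shows "\<exists>H. conjugate G3 (prod3 C D) H \<and> (in_index_two_family H \<or> in_cyclic_family H \<or> in_dihedral_family H)"
proof -
  have C: "subgroup C SU2sq" "finite C" and D: "subgroup D SU2" "finite D" "D \<noteq> {1}"
    and ADE_A: "\<exists>A. ADE A \<and> conjugate SU2 (gA C) A" and ADE_B: "\<exists>B. ADE B \<and> conjugate SU2 (gB C) B"
    and A0: "gA0 C \<noteq> {1}" and B0: "gB0 C = {1}"
    using assms(1) unfolding type_II_def nontriv_finite_subgroup_def by auto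
  note CD = subgroup_SU2sqD[OF C(1)]
  have DU: "d \<in> D \<Longrightarrow> d \<in> U" for d using subgroupD(5)[OF D(1)] .
  have gA: "a \<in> gA C \<longleftrightarrow> (\<exists>b. (a, b) \<in> C)" for a unfolding gA_def by force
  have gB: "b \<in> gB C \<longleftrightarrow> (\<exists>a. (a, b) \<in> C)" for b unfolding gB_def by force
  have subA: "subgroup (gA C) SU2" unfolding subgroup_U_iff using CD by (auto simp: gA subset_iff) blast+
  have subB: "subgroup (gB C) SU2" unfolding subgroup_U_iff using CD by (auto simp: gB subset_iff) blast+
  have finA: "finite (gA C)" and finB: "finite (gB C)" using C(2) by (simp_all add: gA_def gB_def)

  have uniq: "b = b'" if "(a, b) \<in> C" "(a, b') \<in> C" for a b b'
  proof -
    have "(qcnj a * a, qcnj b * b') \<in> C" using CD(3)[OF CD(4)[OF that(1)] that(2)] .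
    then have "qcnj b * b' \<in> gB0 C" using CD(1)[OF that(1)] by (simp add: gB0_def)
    then have "qcnj b * b' = 1" using B0 by simp
    then have "b * (qcnj b * b') = b" by simp
    then show ?thesis using CD(1)[OF that(1)] by simp
  qed
  define f0 where "f0 a = (THE b. (a, b) \<in> C)" for a
  have f0: "f0 a = b" if "(a, b) \<in> C" for a b
    unfolding f0_def using that uniq by blast
  have f0C: "(a, f0 a) \<in> C" if "a \<in> gA C" for a using that f0 gA by metis

  obtain a0 where a0: "(a0, 1) \<in> C" "a0 \<noteq> 1" using A0 CD(2) unfolding gA0_def by blast
  have Ane: "gA C \<noteq> {1}" using a0 gA by blast
  \<comment> \<open>The trivial group is not an ADE group, so \<open>B\<close> is nontrivial.\<close>
  have Bne: "gB C \<noteq> {1}"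
  proof
    assume B1: "gB C = {1}"
    obtain B where B: "ADE B" "conjugate SU2 (gB C) B" using ADE_B by blast
    obtain g where "g \<in> U" "B = cj g ` gB C" using B(2) conjugate_SU2_iff[OF subgroupD(1)[OF subB]] by blast
    then have "B = {1}" by (simp add: B1)
    then show False using B(1) not_ADE_trivial by simp
  qed
  obtain A where adeA: "ADE A" "conjugate SU2 (gA C) A" using ADE_A by blast
  obtain g where g: "g \<in> U" and Ag: "A = cj g ` gA C"
    using adeA(2) conjugate_SU2_iff[OF subgroupD(1)[OF subA]] by blast
  define f where "f x = f0 (cj (qcnj g) x)" for x
  have f: "f (cj g a) = b" if "(a, b) \<in> C" for a b using g f0[OF that] by (simp add: f_def)
  have A_cases: "\<exists>a b. (a, b) \<in> C \<and> x = cj g a \<and> f x = b" if "x \<in> A" for x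
    using that f unfolding Ag gA_def by force
  have A_intro: "cj g a \<in> A" if "(a, b) \<in> C" for a b using that gA unfolding Ag by blast

  have CDU: "prod3 C D \<subseteq> U \<times> U \<times> U" using CD(1) DU unfolding prod3_def by auto
  have free: "d = 1" if "(a, b) \<in> C" "d \<in> D" "qRe a = qRe b" "qRe b = qRe d" for a b d
    using assms(2)[unfolded acts_freely_iff[OF CDU]] that unfolding prod3_def by blast

  define S where "S = gA C \<times> gB C \<times> D"
  have "splittable S" unfolding splittable_def nontriv_finite_subgroup_def S_def SU2_simps
    using subA finA Ane subB finB Bne D by blast
  moreover have "prod3 C D \<subseteq> S" unfolding prod3_def S_def using gA gB by blast
  ultimately have nf: "\<not> acts_freely S" using assms(3) by blast
  have SU: "S \<subseteq> U \<times> U \<times> U" using subgroupD(1)[OF subA] subgroupD(1)[OF subB] DU unfolding S_def by blast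
  obtain a b d where abd: "a \<in> gA C" "b \<in> gB C" "d \<in> D" "d \<noteq> 1" "qRe a = qRe b" "qRe b = qRe d"
    using nf[unfolded acts_freely_iff[OF SU]] unfolding S_def by blast

  interpret free_graph A D f
  proof (rule free_graph.intro)
    show "subgroup A SU2" "finite A" unfolding Ag using cj_subgroup[OF g subA] finA by simp_all
    show "subgroup D SU2" "finite D" "D \<noteq> {1}" by (fact D)+
    show "f x \<in> U" if "x \<in> A" for x using A_cases[OF that] CD(1) by blast
    show "f (x * y) = f x * f y" if xA: "x \<in> A" and yA: "y \<in> A" for x y
    proof -
      obtain p q where x: "(p, q) \<in> C" "x = cj g p" "f x = q" using A_cases[OF xA] by blast
      obtain r s where y: "(r, s) \<in> C" "y = cj g r" "f y = s" using A_cases[OF yA] by blast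
      have "f (cj g (p * r)) = q * s" using f CD(3)[OF x(1) y(1)] by blast
      then show ?thesis using x y g by (simp add: cj_mult)
    qed
    show "\<exists>x\<in>A. x \<noteq> 1 \<and> f x = 1"
    proof (intro bexI conjI)
      show "cj g a0 \<in> A" using A_intro a0 by blast
      show "f (cj g a0) = 1" using f a0 by blast
      show "cj g a0 \<noteq> 1" using cj_inj[OF g, of a0 1] g a0(2) by simp
    qed
    show "\<exists>x\<in>A. f x \<noteq> 1"
    proof -
      obtain b1 where "b1 \<in> gB C" "b1 \<noteq> 1" using Bne subgroupD(2)[OF subB] by blast
      then show ?thesis using gB f A_intro by metis
    qed
    show "e = 1" if xA: "x \<in> A" and e: "e \<in> D" "qRe x = qRe (f x)" "qRe (f x) = qRe e" for x e
    proof -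
      obtain p q where x: "(p, q) \<in> C" "x = cj g p" "f x = q" using A_cases[OF xA] by blast
      then show ?thesis using free[OF x(1) e(1)] e g by simp
    qed
    show "\<exists>x\<in>A. \<exists>y\<in>A. \<exists>e\<in>D. e \<noteq> 1 \<and> qRe x = qRe (f y) \<and> qRe (f y) = qRe e"
    proof -
      obtain a' where a': "(a', b) \<in> C" using abd(2) gB by blast
      have "cj g a \<in> A" using abd(1) Ag by blast
      moreover have "cj g a' \<in> A" "f (cj g a') = b" using a' A_intro f by blast+
      moreover have "qRe (cj g a) = qRe b" using g abd(5) by simp
      ultimately show ?thesis using abd(3,4,6) by metis
    qed
  qed
  obtain g1 g2 g3 H where h: "g1 \<in> U" "g2 \<in> U" "g3 \<in> U"
    and H: "H = {(cj g1 x, cj g2 (f x), cj g3 d) | x d. x \<in> A \<and> d \<in> D}" "in_index_two_family H \<or> in_cyclic_family H \<or> in_dihedral_family H"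
    using listed_if_ADE[OF adeA(1)] unfolding listed_def by blast
  have "H = {(cj (g1 * g) a, cj g2 b, cj g3 d) | a b d. (a, b, d) \<in> prod3 C D}"
  proof
    show "H \<subseteq> {(cj (g1 * g) a, cj g2 b, cj g3 d) | a b d. (a, b, d) \<in> prod3 C D}"
    proof
      fix z assume "z \<in> H"
      then obtain x d where z: "z = (cj g1 x, cj g2 (f x), cj g3 d)" "x \<in> A" "d \<in> D" unfolding H(1) by blast
      obtain p q where x: "(p, q) \<in> C" "x = cj g p" "f x = q" using A_cases[OF z(2)] by blast
      have "z = (cj (g1 * g) p, cj g2 q, cj g3 d)" by (simp add: z(1) x cj_cj[symmetric] x(3)[unfolded x(2)])
      moreover have "(p, q, d) \<in> prod3 C D" using x(1) z(3) unfolding prod3_def by blast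
      ultimately show "z \<in> {(cj (g1 * g) a, cj g2 b, cj g3 d) | a b d. (a, b, d) \<in> prod3 C D}" by blast
    qed
    show "{(cj (g1 * g) a, cj g2 b, cj g3 d) | a b d. (a, b, d) \<in> prod3 C D} \<subseteq> H"
    proof
      fix z assume "z \<in> {(cj (g1 * g) a, cj g2 b, cj g3 d) | a b d. (a, b, d) \<in> prod3 C D}"
      then obtain p q d where z: "z = (cj (g1 * g) p, cj g2 q, cj g3 d)" "(p, q) \<in> C" "d \<in> D"
        unfolding prod3_def by blast
      have "z = (cj g1 (cj g p), cj g2 (f (cj g p)), cj g3 d)" by (simp add: z(1) cj_cj f[OF z(2)])
      then show "z \<in> H" unfolding H(1) using A_intro[OF z(2)] z(3) by blast
    qed
  qed
  then have "conjugate G3 (prod3 C D) H"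
    using conjugate_G3[OF U_mult[OF h(1) g] h(2,3) CDU] by simp
  then show ?thesis using H(2) by blast
qed

theorem theorem4p4:
  fixes C :: "(quat \<times> quat) set" and D :: "quat set"
  assumes "type_II C D"
    and "acts_freely (prod3 C D)"
    and "\<not> (\<exists>S. splittable S \<and> acts_freely S \<and> prod3 C D \<subseteq> S)"
  shows "\<exists>H. conjugate G3 (prod3 C D) H \<and>
    ( \<comment> \<open>(1)\<close>
      (\<exists>r n. coprime r (3::nat) \<and> n \<ge> 2 \<and> \<not> 3 dvd n \<and>
         H = prod3 (goursat binT (binD 2) (Zc 3) {1} (iso_of projT (autZ r))) (Zc n))
    \<or> \<comment> \<open>(2)\<close>
      (\<exists>r l. coprime r (3::nat) \<and> l \<ge> 2 \<and> \<not> 3 dvd 2 * l \<and>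
         H = prod3 (goursat binT (binD 2) (Zc 3) {1} (iso_of projT (autZ r))) (binD l))
    \<or> \<comment> \<open>(3)\<close>
      (\<exists>D'. ADE D' \<and>
         ((\<exists>k\<ge>2. H = prod3 (goursat (binD (2 * k)) (binD k) (Zc 2) {1}
                               (iso_of (proj2 (binD k)) id)) D') \<or>
          H = prod3 (goursat binO binT (Zc 2) {1} (iso_of (proj2 binT) id)) D' \<or>
          (\<exists>k\<ge>2. H = prod3 (goursat (binD k) (Zc (2 * k)) (Zc 2) {1}
                               (iso_of (proj2 (Zc (2 * k))) id)) D')))
    \<or> \<comment> \<open>(4)\<close>
      (\<exists>k l r D'. k \<ge> 2 \<and> l \<ge> 2 \<and> coprime r k \<and> ADE D' \<and>
         H = prod3 (goursat (Zc (k * l)) (Zc l) (Zc k) {1} (iso_of (projZ k l) (autZ r))) D' \<and>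
         \<not> [int l * int r = 1] (mod (int l * int k)) \<and>
         \<not> [int l * int r = - 1] (mod (int l * int k)) \<and>
         (let k1 = gcd (1 + int l * int r) (int k * int l);
              k2 = gcd (1 - int l * int r) (int k * int l)
          in (k1 = 1 \<and> k2 = 1) \<or>
             ((k1 > 1 \<or> k2 > 1) \<and> (\<forall>\<kappa>\<in>{k1, k2}. \<kappa> > 1 \<longrightarrow> coprime_cond D' \<kappa>))))
    \<or> \<comment> \<open>(5)\<close>
      (\<exists>k l a b g m. k \<ge> 1 \<and> l > 2 \<and> coprime a (2 * l) \<and> b < 2 * l \<and> g \<in> binD l \<and> m \<ge> 2 \<and>
         H = prod3 (goursat (binD (l * (2 * k + 1))) (Zc (2 * k + 1)) (binD l) {1}
                      (iso_of (projD k l) (conj_by g \<circ> autD l a b))) (Zc m) \<and>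
         \<not> [int a * (2 * int k + 1) = 1] (mod (2 * int l * (2 * int k + 1))) \<and>
         \<not> [int a * (2 * int k + 1) = - 1] (mod (2 * int l * (2 * int k + 1))) \<and>
         \<not> 4 dvd m \<and>
         (let k1 = gcd (1 - int a * (2 * int k + 1)) (2 * int l * (2 * int k + 1));
              k2 = gcd (1 + int a * (2 * int k + 1)) (2 * int l * (2 * int k + 1))
          in \<forall>\<kappa>\<in>{k1, k2}. \<kappa> > 1 \<longrightarrow> gcd \<kappa> (int m) = 1)))"
proof -
  obtain H where H: "conjugate G3 (prod3 C D) H" "in_index_two_family H \<or> in_cyclic_family H \<or> in_dihedral_family H"
    using free_type_II_listed[OF assms] by blast
  from H(2) show ?thesis
  proof (elim disjE)
    assume "in_index_two_family H"
    then show ?thesis unfolding in_index_two_family_def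
      by (intro exI[of _ H] conjI H(1)) (rule disjI2, rule disjI2, rule disjI1)
  next
    assume "in_cyclic_family H"
    then show ?thesis unfolding in_cyclic_family_def
      by (intro exI[of _ H] conjI H(1)) (rule disjI2, rule disjI2, rule disjI2, rule disjI1)
  next
    assume "in_dihedral_family H"
    then show ?thesis unfolding in_dihedral_family_def
      by (intro exI[of _ H] conjI H(1)) (rule disjI2, rule disjI2, rule disjI2, rule disjI2)
  qed
qed

end
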